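(* Let $n\ge3$ and let $W\in C_b(\mathbb S^{n-1}\times\mathbb S^{n-1})$ be rotationally symmetric, with at least one negative component of its spherical harmonics decomposition $(\hat W_j)_{j\in\mathbb N}$. If $\hat W_k<0$ is a unique component of the decomposition, i.e. $\hat W_j\neq\hat W_k$ for all $j\in\mathbb N\setminus\{k\}$, then $(0,\gamma_k)$ with $\gamma_k=-\frac1{\hat W_k}$ is a bifurcation point of $\hat F(u,\gamma)=0$. Moreover there exist $\delta>0$ and at least one bifurcation curve $\hat S(t)=(\hat x(t),\gamma(t))$, $t\in(-\delta,\delta)$, of the form $$\hat x(t)=tY_{k,0}+tz(t),\qquad\gamma(t)=\gamma_k+\mu(t),$$ where $z,\mu$ are continuous functions with $z(0)=0$, $\mu(0)=0$, and $\hat x(t)\in L_2^s(\mathbb S^{n-1})$ for all $t\in(-\delta,\delta)$.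
   Context: $\mathbb N=\{1,2,\dots\}$. $\sigma$ is the surface measure on the unit sphere $\mathbb S^{n-1}\subset\mathbb R^n$, $\omega_n=\sigma(\mathbb S^{n-1})$, $\langle f,g\rangle_{L_2}=\omega_n^{-1}\int fg\,d\sigma$, $\bar\rho=1/\omega_n$. Rotationally symmetric means $W(x,y)=W(\langle x,y\rangle)$ with $W:[-1,1]\to\mathbb R$. $(W*u)(x)=\int W(\langle x,y\rangle)u(y)\,d\sigma(y)$. Gegenbauer polynomials: $C_0^\lambda=1$, $C_1^\lambda(t)=2\lambda t$, $(k+2)C_{k+2}^\lambda(t)=2(\lambda+k+1)tC_{k+1}^\lambda(t)-(2\lambda+k)C_k^\lambda(t)$. $$\hat W_k=\frac{\Gamma(\frac n2)}{\sqrt\pi\,\Gamma(\frac{n-1}2)}\int_{-1}^1W(t)\frac{C_k^{\frac{n-2}2}(t)}{C_k^{\frac{n-2}2}(1)}(1-t^2)^{\frac{n-3}2}dt .$$ $Y_{k,0}(x)=A_kC_k^{\frac{n-2}2}(x_n)$ with $A_k>0$ such that $\|Y_{k,0}\|_{L_2}=1$; $L_2^s(\mathbb S^{n-1})$ is the closed span in $L_2$ of these functions. The shifted Gibbs map $\hat F:L_2(\mathbb S^{n-1})\times\mathbb R_+\to L_2(\mathbb S^{n-1})$ is $$\hat F(u,\gamma)=\bar\rho+u-\frac1{Z(\gamma,u)}e^{-\gamma W*(\bar\rho+u)},\qquad Z(\gamma,u)=\int_{\mathbb S^{n-1}}e^{-\gamma W*(\bar\rho+u)}d\sigma .$$ One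 has $\hat F(0,\gamma)=0$ for all $\gamma$. $(0,\gamma_k)$ is a bifurcation point if it lies in the closure of $\{(u,\gamma):\hat F(u,\gamma)=0,\ u\ne0\}$. A bifurcation curve at a bifurcation point $(0,\gamma_k)$ is a continuous map $\hat S:(-\delta,\delta)\to L_2(\mathbb S^{n-1})\times\mathbb R$ with $\hat S(0)=(0,\gamma_k)$ and $\hat F(\hat S(t))=0$ for all $t$. *)

theory Defs
  imports "HOL-Analysis.Analysis"
begin

section \<open>Surface measure on the unit sphere\<close>

(* The surface measure of A is n times the Lebesgue measure of the cone {r x | 0 < r < 1, x \<in> A}
   (polar coordinates). *)
definition sphere_measure :: "(real^'n::finite) measure" where
  "sphere_measure = scale_measure (of_nat CARD('n))
     (distr (restrict_space lborel (ball 0 1 - {0})) (restrict_space borel (sphere 0 1))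
        (\<lambda>x. x /\<^sub>R norm x))"

definition sphere_area :: "'n::finite itself \<Rightarrow> real" where
  "sphere_area _ = measure (sphere_measure :: (real^'n) measure) (sphere 0 1)"

lemma space_sphere_measure [simp]: "space sphere_measure = sphere 0 1"
  by (simp add: sphere_measure_def space_scale_measure space_restrict_space)

lemma sets_sphere_measure [measurable_cong]:
  "sets sphere_measure = sets (restrict_space borel (sphere 0 1))"
  by (simp add: sphere_measure_def)

lemma sphere_projection_measurable:
  "(\<lambda>x::real^'n::finite. x /\<^sub>R norm x)
     \<in> restrict_space lborel (ball 0 1 - {0}) \<rightarrow>\<^sub>M restrict_space borel (sphere 0 1)"
proof (rule measurable_restrict_space2)
  show "(\<lambda>x::real^'n. x /\<^sub>R norm x) \<in> space (restrict_space lborel (ball 0 1 - {0})) \<rightarrow> sphere 0 1"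
    by (auto simp: space_restrict_space)
  show "(\<lambda>x::real^'n. x /\<^sub>R norm x) \<in> borel_measurable (restrict_space lborel (ball 0 1 - {0}))"
    by (intro measurable_restrict_space1) simp
qed

lemma emeasure_sphere_measure:
  fixes A :: "(real^'n::finite) set"
  assumes "A \<in> sets borel" "A \<subseteq> sphere 0 1"
  shows "emeasure sphere_measure A
    = of_nat CARD('n) * emeasure lborel {x. 0 < norm x \<and> norm x < 1 \<and> x /\<^sub>R norm x \<in> A}"
proof -
  have A: "A \<in> sets (restrict_space borel (sphere 0 1))"
    using assms by (simp add: sets_restrict_space_iff)
  have eq: "(\<lambda>x. x /\<^sub>R norm x) -` A \<inter> (ball 0 1 - {0})
      = {x. 0 < norm x \<and> norm x < 1 \<and> x /\<^sub>R norm x \<in> A}" by auto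
  have "emeasure (restrict_space lborel (ball 0 1 - {0})) ((\<lambda>x. x /\<^sub>R norm x) -` A \<inter> (ball 0 1 - {0}))
    = emeasure lborel ((\<lambda>x. x /\<^sub>R norm x) -` A \<inter> (ball 0 1 - {0}))"
    by (rule emeasure_restrict_space) auto
  then show ?thesis
    unfolding sphere_measure_def
    using emeasure_distr[OF sphere_projection_measurable A]
    by (simp add: eq space_restrict_space)
qed

lemma emeasure_sphere_measure_space:
  "emeasure (sphere_measure :: (real^'n::finite) measure) (sphere 0 1)
     = of_nat CARD('n) * emeasure lborel (ball (0::real^'n) 1)"
proof -
  have eq: "{x::real^'n. 0 < norm x \<and> norm x < 1 \<and> x /\<^sub>R norm x \<in> sphere 0 1} = ball 0 1 - {0}"
    by auto
  have "emeasure lborel (ball (0::real^'n) 1 - {0}) = emeasure lborel (ball (0::real^'n) 1)"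
    by (rule emeasure_Diff_null_set) auto
  then show ?thesis
    using emeasure_sphere_measure[of "sphere (0::real^'n) 1"] by (simp only: eq) simp
qed

lemma finite_measure_sphere_measure: "finite_measure (sphere_measure :: (real^'n::finite) measure)"
proof
  have "emeasure lborel (ball (0::real^'n) 1) < \<infinity>"
    by (rule emeasure_bounded_finite) simp
  then show "emeasure (sphere_measure :: (real^'n) measure) (space sphere_measure) \<noteq> \<infinity>"
    by (auto simp: emeasure_sphere_measure_space ennreal_mult_eq_top_iff)
qed

lemma sphere_area_eq: "sphere_area TYPE('n::finite) = real CARD('n) * measure lborel (ball (0::real^'n) 1)"
  by (simp add: sphere_area_def measure_def emeasure_sphere_measure_space enn2real_mult)

lemma sphere_area_pos: "sphere_area TYPE('n::finite) > 0"
  by (simp add: sphere_area_eq)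


section \<open>The Hilbert space $L_2$ of the sphere\<close>

definition square_integrable :: "((real^'n::finite) \<Rightarrow> real) \<Rightarrow> bool" where
  "square_integrable f \<longleftrightarrow>
     f \<in> borel_measurable sphere_measure \<and> integrable sphere_measure (\<lambda>x. (f x)\<^sup>2)"

definition L2_eq :: "((real^'n::finite) \<Rightarrow> real) \<Rightarrow> ((real^'n) \<Rightarrow> real) \<Rightarrow> bool" where
  "L2_eq f g \<longleftrightarrow> square_integrable f \<and> square_integrable g \<and> (AE x in sphere_measure. f x = g x)"

lemma square_integrable_zero: "square_integrable (\<lambda>_. 0)"
  by (simp add: square_integrable_def)

lemma square_integrable_scale: "square_integrable f \<Longrightarrow> square_integrable (\<lambda>x. c * f x)"
  by (auto simp: square_integrable_def power_mult_distrib)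

lemma square_integrable_mult:
  assumes "square_integrable f" "square_integrable g"
  shows "integrable sphere_measure (\<lambda>x. f x * g x)"
proof (rule Bochner_Integration.integrable_bound)
  show "integrable sphere_measure (\<lambda>x. (f x)\<^sup>2 + (g x)\<^sup>2)"
    using assms by (auto simp: square_integrable_def)
  show "(\<lambda>x. f x * g x) \<in> borel_measurable sphere_measure"
    using assms by (auto simp: square_integrable_def)
  show "AE x in sphere_measure. norm (f x * g x) \<le> norm ((f x)\<^sup>2 + (g x)\<^sup>2)"
  proof (rule AE_I2)
    fix x
    have "0 \<le> (\<bar>f x\<bar> - \<bar>g x\<bar>)\<^sup>2" by simp
    then have "2 * (\<bar>f x\<bar> * \<bar>g x\<bar>) \<le> (f x)\<^sup>2 + (g x)\<^sup>2"
      by (simp add: power2_diff)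
    moreover have "0 \<le> \<bar>f x\<bar> * \<bar>g x\<bar>" by simp
    ultimately have "\<bar>f x\<bar> * \<bar>g x\<bar> \<le> (f x)\<^sup>2 + (g x)\<^sup>2"
      by linarith
    then show "norm (f x * g x) \<le> norm ((f x)\<^sup>2 + (g x)\<^sup>2)"
      by (simp add: abs_mult)
  qed
qed

lemma square_integrable_add:
  assumes "square_integrable f" "square_integrable g"
  shows "square_integrable (\<lambda>x. f x + g x)"
proof -
  have "integrable sphere_measure (\<lambda>x. (f x)\<^sup>2 + (g x)\<^sup>2 + 2 * (f x * g x))"
    using assms square_integrable_mult[OF assms] by (auto simp: square_integrable_def)
  then show ?thesis
    using assms by (auto simp: square_integrable_def power2_sum mult.assoc)
qed

lemma square_integrable_diff:
  assumes "square_integrable f" "square_integrable g"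
  shows "square_integrable (\<lambda>x. f x - g x)"
  using square_integrable_add[OF assms(1) square_integrable_scale[OF assms(2), of "-1"]] by simp

lemma square_integrable_bounded:
  fixes f :: "(real^'n::finite) \<Rightarrow> real"
  assumes "f \<in> borel_measurable sphere_measure" "\<And>x. x \<in> sphere 0 1 \<Longrightarrow> \<bar>f x\<bar> \<le> B"
  shows "square_integrable f"
proof -
  interpret finite_measure "sphere_measure :: (real^'n) measure"
    by (rule finite_measure_sphere_measure)
  have "integrable sphere_measure (\<lambda>x. (f x)\<^sup>2)"
    by (rule integrable_const_bound[where B="B\<^sup>2"])
      (use assms in \<open>auto intro!: AE_I2 simp: abs_le_square_iff[symmetric] intro: order_trans[OF _ abs_ge_self]\<close>)
  then show ?thesis using assms by (simp add: square_integrable_def)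
qed

quotient_type (overloaded) 'n sphere_L2 = "(real^'n::finite) \<Rightarrow> real" / partial: L2_eq
proof (rule part_equivpI)
  show "\<exists>f. L2_eq f f" using square_integrable_zero by (auto simp: L2_eq_def)
  show "symp L2_eq" by (rule sympI) (auto simp: L2_eq_def elim: eventually_mono)
  show "transp L2_eq" by (rule transpI) (auto simp: L2_eq_def)
qed

(* The class of f; meaningful for square integrable f, with value 0 otherwise. *)
lift_definition L2_of :: "((real^'n::finite) \<Rightarrow> real) \<Rightarrow> 'n sphere_L2"
  is "\<lambda>f. if square_integrable f then f else (\<lambda>_. 0)"
  by (auto simp: L2_eq_def square_integrable_zero)

instantiation sphere_L2 :: (finite) real_vector
begin

lift_definition zero_sphere_L2 :: "'a sphere_L2" is "\<lambda>_. 0"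
  by (simp add: L2_eq_def square_integrable_zero)

lift_definition plus_sphere_L2 :: "'a sphere_L2 \<Rightarrow> 'a sphere_L2 \<Rightarrow> 'a sphere_L2"
  is "\<lambda>f g x. f x + g x"
  by (auto simp: L2_eq_def square_integrable_add)

lift_definition scaleR_sphere_L2 :: "real \<Rightarrow> 'a sphere_L2 \<Rightarrow> 'a sphere_L2"
  is "\<lambda>c f x. c * f x"
  by (auto simp: L2_eq_def square_integrable_scale)

lift_definition uminus_sphere_L2 :: "'a sphere_L2 \<Rightarrow> 'a sphere_L2" is "\<lambda>f x. - f x"
  using square_integrable_scale[of _ "-1"] by (auto simp: L2_eq_def)

lift_definition minus_sphere_L2 :: "'a sphere_L2 \<Rightarrow> 'a sphere_L2 \<Rightarrow> 'a sphere_L2"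
  is "\<lambda>f g x. f x - g x"
  by (auto simp: L2_eq_def square_integrable_diff)

instance
proof
  fix u v w :: "'a sphere_L2" and a b :: real
  show "u + v + w = u + (v + w)"
    by transfer (auto simp: L2_eq_def square_integrable_add add.assoc)
  show "u + v = v + u"
    by transfer (auto simp: L2_eq_def square_integrable_add add.commute)
  show "0 + u = u"
    by transfer (auto simp: L2_eq_def)
  show "- u + u = 0"
    by transfer (auto simp: L2_eq_def square_integrable_zero)
  show "u - v = u + - v"
    by transfer (auto simp: L2_eq_def square_integrable_diff)
  show "a *\<^sub>R (u + v) = a *\<^sub>R u + a *\<^sub>R v"
    by transfer (auto simp: L2_eq_def distrib_left
        intro!: square_integrable_add square_integrable_scale)
  show "(a + b) *\<^sub>R u = a *\<^sub>R u + b *\<^sub>R u"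
    by transfer (auto simp: L2_eq_def distrib_right
        intro!: square_integrable_add square_integrable_scale)
  show "a *\<^sub>R b *\<^sub>R u = (a * b) *\<^sub>R u"
    by transfer (use square_integrable_scale in \<open>auto simp: L2_eq_def mult.assoc\<close>)
  show "1 *\<^sub>R u = u"
    by transfer (auto simp: L2_eq_def)
qed

end

instantiation sphere_L2 :: (finite) real_inner
begin

lift_definition inner_sphere_L2 :: "'a sphere_L2 \<Rightarrow> 'a sphere_L2 \<Rightarrow> real"
  is "\<lambda>f g. (1 / sphere_area TYPE('a)) * (LINT x|sphere_measure. f x * g x)"
proof -
  fix f f' g g' :: "(real^'a) \<Rightarrow> real"
  assume "L2_eq f f'" "L2_eq g g'"
  then have "(LINT x|sphere_measure. f x * g x) = (LINT x|sphere_measure. f' x * g' x)"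
    by (intro integral_cong_AE) (auto simp: L2_eq_def square_integrable_def)
  then show "(1 / sphere_area TYPE('a)) * (LINT x|sphere_measure. f x * g x)
      = (1 / sphere_area TYPE('a)) * (LINT x|sphere_measure. f' x * g' x)" by simp
qed

definition norm_sphere_L2 :: "'a sphere_L2 \<Rightarrow> real" where
  "norm_sphere_L2 u = sqrt (inner u u)"

definition sgn_sphere_L2 :: "'a sphere_L2 \<Rightarrow> 'a sphere_L2" where
  "sgn_sphere_L2 u = u /\<^sub>R norm u"

definition dist_sphere_L2 :: "'a sphere_L2 \<Rightarrow> 'a sphere_L2 \<Rightarrow> real" where
  "dist_sphere_L2 u v = norm (u - v)"

definition uniformity_sphere_L2 :: "('a sphere_L2 \<times> 'a sphere_L2) filter" where
  "uniformity_sphere_L2 = (INF e\<in>{0<..}. principal {(u, v). dist u v < e})"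

definition open_sphere_L2 :: "'a sphere_L2 set \<Rightarrow> bool" where
  "open_sphere_L2 U \<longleftrightarrow> (\<forall>u\<in>U. \<forall>\<^sub>F (u', v) in uniformity. u' = u \<longrightarrow> v \<in> U)"

instance
proof
  fix u v w :: "'a sphere_L2" and a :: real
  show "dist u v = norm (u - v)" by (rule dist_sphere_L2_def)
  show "sgn u = u /\<^sub>R norm u" by (rule sgn_sphere_L2_def)
  show "(uniformity :: ('a sphere_L2 \<times> 'a sphere_L2) filter)
      = (INF e\<in>{0<..}. principal {(u, v). dist u v < e})"
    by (rule uniformity_sphere_L2_def)
  show "open U \<longleftrightarrow> (\<forall>u\<in>U. \<forall>\<^sub>F (u', v) in uniformity. u' = u \<longrightarrow> v \<in> U)"
    for U :: "'a sphere_L2 set" by (rule open_sphere_L2_def)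
  show "norm u = sqrt (inner u u)" by (rule norm_sphere_L2_def)
  show "inner u v = inner v u"
    by transfer (simp add: mult.commute)
  show "inner (u + v) w = inner u w + inner v w"
    by transfer (simp add: L2_eq_def distrib_right distrib_left square_integrable_mult add_divide_distrib)
  show "inner (a *\<^sub>R u) v = a * inner u v"
    by transfer (simp add: mult.assoc)
  show "0 \<le> inner u u"
    by transfer (use sphere_area_pos[where 'n='a] in \<open>simp add: integral_nonneg_AE\<close>)
  show "inner u u = 0 \<longleftrightarrow> u = 0"
  proof (transfer, goal_cases)
    case (1 f)
    then have f: "square_integrable f" by (simp add: L2_eq_def)
    have "(LINT x|sphere_measure. f x * f x) = 0 \<longleftrightarrow> (AE x in sphere_measure. f x * f x = 0)"
      by (rule integral_nonneg_eq_0_iff_AE) (auto intro: square_integrable_mult f)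
    then show ?case
      using sphere_area_pos[where 'n='a] f
      by (auto simp: L2_eq_def square_integrable_zero)
  qed
qed

end


section \<open>Gegenbauer polynomials and zonal harmonics\<close>

fun gegenbauer :: "real \<Rightarrow> nat \<Rightarrow> real \<Rightarrow> real" where
  "gegenbauer l 0 t = 1"
| "gegenbauer l (Suc 0) t = 2 * l * t"
| "gegenbauer l (Suc (Suc k)) t =
     (2 * (l + real k + 1) * t * gegenbauer l (Suc k) t - (2 * l + real k) * gegenbauer l k t)
       / (real k + 2)"

(* Polynomials on the sphere of R^n, where n = CARD('n), have parameter (n - 2) / 2. *)
definition sphere_gegenbauer :: "'n::finite itself \<Rightarrow> nat \<Rightarrow> real \<Rightarrow> real" where
  "sphere_gegenbauer _ k t = gegenbauer ((real CARD('n) - 2) / 2) k t"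

(* The coordinate p plays the role of the last coordinate x_n. *)
definition zonal_harmonic :: "'n::finite \<Rightarrow> nat \<Rightarrow> 'n sphere_L2" where
  "zonal_harmonic p k =
     (let g = L2_of (\<lambda>x. sphere_gegenbauer TYPE('n) k (x $ p))
      in (THE A. 0 < A \<and> norm (A *\<^sub>R g) = 1) *\<^sub>R g)"

definition symmetric_L2 :: "'n::finite \<Rightarrow> 'n sphere_L2 set" where
  "symmetric_L2 p = closure (span (range (zonal_harmonic p)))"


section \<open>Rotationally symmetric interaction kernels\<close>

definition rotationally_symmetric :: "(real^'n::finite \<Rightarrow> real^'n \<Rightarrow> real) \<Rightarrow> (real \<Rightarrow> real) \<Rightarrow> bool" where
  "rotationally_symmetric W w \<longleftrightarrow> (\<forall>x\<in>sphere 0 1. \<forall>y\<in>sphere 0 1. W x y = w (inner x y))"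

(* Here w is the profile of the kernel: W x y = w (inner x y). *)
definition spherical_component :: "'n::finite itself \<Rightarrow> (real \<Rightarrow> real) \<Rightarrow> nat \<Rightarrow> real" where
  "spherical_component N w k =
     Gamma (real CARD('n) / 2) / (sqrt pi * Gamma ((real CARD('n) - 1) / 2)) *
     (LINT t:{-1..1}|lborel.
        w t * (sphere_gegenbauer N k t / sphere_gegenbauer N k 1)
          * (1 - t\<^sup>2) powr ((real CARD('n) - 3) / 2))"


section \<open>The shifted Gibbs map\<close>

definition sphere_conv ::
    "(real^'n::finite \<Rightarrow> real^'n \<Rightarrow> real) \<Rightarrow> 'n sphere_L2 \<Rightarrow> real^'n \<Rightarrow> real" where
  "sphere_conv W u x = (LINT y|sphere_measure. W x y * rep_sphere_L2 u y)"

definition uniform_density :: "'n::finite sphere_L2" where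
  "uniform_density = L2_of (\<lambda>_. 1 / sphere_area TYPE('n))"

definition gibbs_Z :: "(real^'n::finite \<Rightarrow> real^'n \<Rightarrow> real) \<Rightarrow> real \<Rightarrow> 'n sphere_L2 \<Rightarrow> real" where
  "gibbs_Z W \<gamma> u =
     (LINT x|sphere_measure. exp (- \<gamma> * sphere_conv W (uniform_density + u) x))"

definition gibbs_map ::
    "(real^'n::finite \<Rightarrow> real^'n \<Rightarrow> real) \<Rightarrow> 'n sphere_L2 \<times> real \<Rightarrow> 'n sphere_L2" where
  "gibbs_map W = (\<lambda>(u, \<gamma>). uniform_density + u -
     (1 / gibbs_Z W \<gamma> u) *\<^sub>R L2_of (\<lambda>x. exp (- \<gamma> * sphere_conv W (uniform_density + u) x)))"

lemma square_integrable_rep: "square_integrable (rep_sphere_L2 u)"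
  using Quotient3_rep_reflp[OF Quotient3_sphere_L2, of u] by (simp add: L2_eq_def)

lemma square_integrable_const: "square_integrable (\<lambda>_. c)"
  by (rule square_integrable_bounded[of _ "\<bar>c\<bar>"]) auto

lemma square_integrable_gibbs:
  fixes W :: "real^'n::finite \<Rightarrow> real^'n \<Rightarrow> real"
  assumes cont: "continuous_on (sphere 0 1 \<times> sphere 0 1) (\<lambda>(x, y). W x y)"
  shows "square_integrable (\<lambda>x. exp (- \<gamma> * sphere_conv W u x))"
proof -
  interpret finite_measure "sphere_measure :: (real^'n) measure"
    by (rule finite_measure_sphere_measure)
  let ?S = "sphere 0 1 :: (real^'n) set"
  let ?f = "rep_sphere_L2 u"
  have f: "?f \<in> borel_measurable sphere_measure"
    using square_integrable_rep[of u] by (simp add: square_integrable_def)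
  have fint: "integrable sphere_measure ?f"
    using square_integrable_mult[OF square_integrable_rep[of u] square_integrable_const[of 1]] by simp
  have "compact ((\<lambda>(x, y). W x y) ` (?S \<times> ?S))"
    by (intro compact_continuous_image cont compact_Times) auto
  then obtain B where B: "\<And>x y. x \<in> ?S \<Longrightarrow> y \<in> ?S \<Longrightarrow> \<bar>W x y\<bar> \<le> B"
    by (force dest!: compact_imp_bounded simp: bounded_iff)
  have id: "(\<lambda>x. x) \<in> sphere_measure \<rightarrow>\<^sub>M (borel :: (real^'n) measure)"
    unfolding measurable_cong_sets[OF sets_sphere_measure refl]
    by (rule measurable_restrict_space1) simp
  have "(\<lambda>z. z) \<in> sphere_measure \<Otimes>\<^sub>M sphere_measure \<rightarrow>\<^sub>M restrict_space borel (?S \<times> ?S)"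
  proof (rule measurable_restrict_space2)
    show "(\<lambda>z. z) \<in> space (sphere_measure \<Otimes>\<^sub>M sphere_measure) \<rightarrow> ?S \<times> ?S"
      by (auto simp: space_pair_measure)
    have "(\<lambda>z. (fst z, snd z)) \<in> sphere_measure \<Otimes>\<^sub>M sphere_measure \<rightarrow>\<^sub>M
        (borel \<Otimes>\<^sub>M borel :: ((real^'n) \<times> (real^'n)) measure)"
      by (intro measurable_Pair measurable_compose[OF measurable_fst id]
          measurable_compose[OF measurable_snd id])
    then show "(\<lambda>z. z) \<in> sphere_measure \<Otimes>\<^sub>M sphere_measure \<rightarrow>\<^sub>M
        (borel :: ((real^'n) \<times> (real^'n)) measure)"
      by (simp add: borel_prod)
  qed
  from measurable_compose[OF this borel_measurable_continuous_on_restrict[OF cont]]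
  have W: "(\<lambda>(x, y). W x y) \<in> borel_measurable (sphere_measure \<Otimes>\<^sub>M sphere_measure)" .
  have m: "sphere_conv W u \<in> borel_measurable sphere_measure"
    unfolding sphere_conv_def
    by (rule borel_measurable_lebesgue_integral) (use W f in measurable)
  have b: "\<bar>sphere_conv W u x\<bar> \<le> (LINT y|sphere_measure. B * \<bar>?f y\<bar>)" if x: "x \<in> ?S" for x
  proof -
    have "norm (LINT y|sphere_measure. W x y * ?f y) \<le> (LINT y|sphere_measure. B * \<bar>?f y\<bar>)"
    proof (rule order_trans[OF integral_norm_bound Bochner_Integration.integral_mono])
      have Wx: "W x \<in> borel_measurable sphere_measure"
        using measurable_Pair2[OF W, of x] x by simp
      show "integrable sphere_measure (\<lambda>y. norm (W x y * ?f y))"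
        by (rule integrable_norm, rule Bochner_Integration.integrable_bound[where f="\<lambda>y. B * \<bar>?f y\<bar>"])
          (use Wx f fint B x in \<open>auto simp: abs_mult intro!: AE_I2 mult_mono order_trans[OF B abs_ge_self]\<close>)
      show "integrable sphere_measure (\<lambda>y. B * \<bar>?f y\<bar>)" using fint by auto
      show "norm (W x y * ?f y) \<le> B * \<bar>?f y\<bar>" if "y \<in> space sphere_measure" for y
        using that B x by (auto simp: abs_mult intro!: mult_right_mono)
    qed
    then show ?thesis by (simp add: sphere_conv_def)
  qed
  let ?C = "\<bar>\<gamma>\<bar> * (LINT y|sphere_measure. B * \<bar>?f y\<bar>)"
  show ?thesis
  proof (rule square_integrable_bounded)
    show "(\<lambda>x. exp (- \<gamma> * sphere_conv W u x)) \<in> borel_measurable sphere_measure" using m by simp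
    show "\<bar>exp (- \<gamma> * sphere_conv W u x)\<bar> \<le> exp ?C" if x: "x \<in> ?S" for x
    proof -
      have "- \<gamma> * sphere_conv W u x \<le> \<bar>\<gamma>\<bar> * \<bar>sphere_conv W u x\<bar>"
        using abs_ge_self[of "- \<gamma> * sphere_conv W u x"] by (simp add: abs_mult)
      also have "\<dots> \<le> ?C" by (intro mult_left_mono b x) simp
      finally show ?thesis by simp
    qed
  qed
qed

(* The parameter \<gamma> ranges over the positive reals. *)
definition bifurcation_point ::
    "(real^'n::finite \<Rightarrow> real^'n \<Rightarrow> real) \<Rightarrow> 'n sphere_L2 \<times> real \<Rightarrow> bool" where
  "bifurcation_point W P \<longleftrightarrow>
     P \<in> closure {(u, \<gamma>). 0 < \<gamma> \<and> gibbs_map W (u, \<gamma>) = 0 \<and> u \<noteq> 0}"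

definition bifurcation_curve ::
    "(real^'n::finite \<Rightarrow> real^'n \<Rightarrow> real) \<Rightarrow> 'n sphere_L2 \<times> real \<Rightarrow> real
       \<Rightarrow> (real \<Rightarrow> 'n sphere_L2 \<times> real) \<Rightarrow> bool" where
  "bifurcation_curve W P \<delta> S \<longleftrightarrow>
     continuous_on {-\<delta><..<\<delta>} S \<and> S 0 = P \<and>
     (\<forall>t\<in>{-\<delta><..<\<delta>}. 0 < snd (S t) \<and> gibbs_map W (S t) = 0)"

end

theory Submission
  imports Defs
begin

text \<open>
  \<^bold>\<open>The linearisation.\<close> Write \<open>\<rho>\<close> for the uniform density and \<open>A u\<close> for the mean-free part of
  \<open>\<rho> W*u\<close>. At \<open>u = 0\<close> the shifted Gibbs map has the derivative \<open>I + \<gamma> A\<close>. By the Funk--Hecke formula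
  the zonal harmonics \<open>Y\<^sub>j\<close> diagonalise \<open>A\<close>: the eigenvalue is the component \<open>W\<^sub>j\<close> of the kernel for
  \<open>j \<ge> 1\<close>, and 0 for \<open>j = 0\<close> because constants have no mean-free part. Hence at \<open>\<gamma>\<^sub>k = - 1 / W\<^sub>k\<close>
  the operator \<open>I + \<gamma>\<^sub>k A\<close> kills \<open>Y\<^sub>k\<close>, and when no other component equals \<open>W\<^sub>k\<close> its kernel among the
  functions that are symmetric about the axis is exactly the line through \<open>Y\<^sub>k\<close>. Bessel's inequality,
  applied to the sections \<open>W x\<close>, bounds the sum of the \<open>W\<^sub>j\<^sup>2\<close>; so the components tend to 0
  and \<open>I + \<gamma>\<^sub>k A\<close> is even invertible, with bounded inverse, on the orthogonal complement of \<open>Y\<^sub>k\<close>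
  (\<open>spectral_gap\<close>, \<open>diagonal_operator_surj\<close>). This is bifurcation from a simple eigenvalue.

  \<^bold>\<open>The branch.\<close> With \<open>u = t y\<close> one has \<open>exp (- \<gamma> W*u) = 1 + t h\<close>, where
  \<open>h = (exp (t v) - 1) / t\<close> and \<open>v = - \<gamma> W*y\<close>. Clearing the normalising constant turns the
  Gibbs equation into \<open>y = \<rho> (h - mean h) - t (mean h) y\<close>, which is regular at \<open>t = 0\<close>, where
  \<open>h = v\<close> and the equation is \<open>y + \<gamma> A y = 0\<close> (\<open>gibbs_map_eq_0\<close>). Now put \<open>y = Y\<^sub>k + z\<close> with \<open>z\<close>
  orthogonal to \<open>Y\<^sub>k\<close>, and \<open>\<gamma> = \<gamma>\<^sub>k + \<mu>\<close>. The two unknowns are merged into one vector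
  \<open>\<xi> = z + \<mu> Y\<^sub>k\<close>, and the equation becomes \<open>B \<xi> = Q t \<xi>\<close>. Here \<open>B\<close> agrees with \<open>I + \<gamma>\<^sub>k A\<close> on the
  complement of \<open>Y\<^sub>k\<close> and multiplies \<open>Y\<^sub>k\<close> by \<open>W\<^sub>k\<close>; it is diagonal and invertible. The right-hand side
  \<open>Q\<close> consists of terms of size \<open>t\<close> and of the quadratic term \<open>\<mu> A z\<close>, so its Lipschitz constant on
  a ball of radius \<open>r\<close> is a multiple of \<open>\<bar>t\<bar> + r\<close>. Banach's fixed point theorem yields \<open>\<xi> t\<close>, and
  \<open>\<xi>\<close> is continuous since the contraction depends continuously on \<open>t\<close>
  (\<open>small_nonlinear_perturbation\<close>, \<open>branch_of_solutions\<close>).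

  \<^bold>\<open>The harmonic analysis.\<close> Everything on the sphere is derived from the invariance of the surface
  measure under reflections. Invariance gives a recurrence for the moments of a coordinate, and
  integration by parts gives the same recurrence for the weight of the Gegenbauer polynomials, so the
  weight describes the distribution of a coordinate. Invariance also shows that convolution with a
  rotationally symmetric kernel does not raise the degree of a polynomial in one coordinate. As
  convolution is symmetric, its eigenfunctions among these polynomials are the orthogonal polynomials
  of the weight; this is \<open>Funk_Hecke_zonal\<close>.
\<close>

section \<open>Rotation invariance of the surface measure\<close>

lemma nn_integral_lborel_shift:
  fixes h :: "'a::euclidean_space \<Rightarrow> ennreal"
  assumes [measurable]: "h \<in> borel_measurable borel"
  shows "(\<integral>\<^sup>+y. h (a + y) \<partial>lborel) = (\<integral>\<^sup>+y. h y \<partial>lborel)"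
proof -
  have "(\<integral>\<^sup>+y. h y \<partial>lborel) = (\<integral>\<^sup>+y. h y \<partial>distr lborel borel ((+) a))"
    by (simp add: lborel_distr_plus)
  also have "\<dots> = (\<integral>\<^sup>+y. h (a + y) \<partial>lborel)"
    by (subst nn_integral_distr) auto
  finally show ?thesis by simp
qed

lemma orthogonal_transformation_measurable:
  fixes f :: "'a::euclidean_space \<Rightarrow> 'a"
  assumes "orthogonal_transformation f"
  shows "f \<in> borel_measurable borel"
  using assms
  by (intro borel_measurable_continuous_onI linear_continuous_on linear_conv_bounded_linear[THEN iffD1]
      orthogonal_transformation_linear)

text \<open>
  A uniqueness argument for translation-invariant measures. Let \<open>g\<close> be the indicator of the unit ball,
  \<open>h\<close> that of \<open>X\<close>, and integrate \<open>g x * h (f x + y)\<close> over both variables. Integrating over \<open>y\<close>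
  first gives the volume of the ball times that of \<open>X\<close>. A shift of \<open>x\<close> turns the integrand into
  \<open>g (f x - y) * h (f x)\<close>, because \<open>f\<close> preserves the ball, and then integrating over \<open>y\<close> first
  gives the volume of the ball times that of the preimage of \<open>X\<close>.
\<close>

lemma lborel_distr_orthogonal:
  fixes f :: "'a::euclidean_space \<Rightarrow> 'a"
  assumes f: "orthogonal_transformation f"
  shows "distr lborel borel f = lborel"
proof (rule measure_eqI)
  fix X assume "X \<in> sets (distr lborel borel f)"
  then have X[measurable]: "X \<in> sets borel" by simp
  have lin: "linear f" and nrm: "\<And>x. norm (f x) = norm x"
    using f by (auto simp: orthogonal_transformation)
  have [measurable]: "f \<in> borel_measurable borel"
    by (rule orthogonal_transformation_measurable[OF f])
  obtain f' where f': "\<And>y. f (f' y) = y"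
    using orthogonal_transformation_surj[OF f] by (metis surjD)
  define g :: "'a \<Rightarrow> ennreal" where "g = indicator (ball 0 1)"
  define h :: "'a \<Rightarrow> ennreal" where "h = indicator X"
  have [measurable]: "g \<in> borel_measurable borel" "h \<in> borel_measurable borel"
    unfolding g_def h_def by (rule borel_measurable_indicator, simp)+
  have gf: "g (f x) = g x" "g (x - y) = g (y - x)" for x y
    by (auto simp: g_def indicator_def nrm norm_minus_commute)
  let ?c = "emeasure lborel (ball (0::'a) 1)"
  have c: "?c \<noteq> 0" "?c \<noteq> \<infinity>"
  proof -
    show "?c \<noteq> \<infinity>" using emeasure_bounded_finite[of "ball (0::'a) 1"] by simp
    have "measure lborel (ball (0::'a) 1) > 0" by (simp add: content_ball_pos)
    then show "?c \<noteq> 0" by (metis measure_def enn2real_0 less_irrefl)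
  qed
  have gi: "(\<integral>\<^sup>+y. g y \<partial>lborel) = ?c" by (simp add: g_def)
  have "?c * emeasure lborel X = (\<integral>\<^sup>+x. g x * emeasure lborel X \<partial>lborel)"
    by (simp add: nn_integral_multc gi)
  also have "\<dots> = (\<integral>\<^sup>+x. (\<integral>\<^sup>+y. g x * h (f x + y) \<partial>lborel) \<partial>lborel)"
    by (simp add: nn_integral_cmult nn_integral_lborel_shift) (simp add: h_def)
  also have "\<dots> = (\<integral>\<^sup>+y. (\<integral>\<^sup>+x. g x * h (f x + y) \<partial>lborel) \<partial>lborel)"
    by (rule lborel_pair.Fubini') measurable
  also have "\<dots> = (\<integral>\<^sup>+y. (\<integral>\<^sup>+x. g (f x - y) * h (f x) \<partial>lborel) \<partial>lborel)"
  proof (rule nn_integral_cong)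
    fix y
    have "(\<integral>\<^sup>+x. g (f x - y) * h (f x) \<partial>lborel)
        = (\<integral>\<^sup>+x. g (f (f' y + x) - y) * h (f (f' y + x)) \<partial>lborel)"
      by (rule nn_integral_lborel_shift[symmetric]) measurable
    also have "\<dots> = (\<integral>\<^sup>+x. g x * h (f x + y) \<partial>lborel)"
      by (simp add: linear_add[OF lin] f' gf add.commute)
    finally show "(\<integral>\<^sup>+x. g x * h (f x + y) \<partial>lborel) = (\<integral>\<^sup>+x. g (f x - y) * h (f x) \<partial>lborel)" ..
  qed
  also have "\<dots> = (\<integral>\<^sup>+x. (\<integral>\<^sup>+y. g (f x - y) * h (f x) \<partial>lborel) \<partial>lborel)"
    by (rule lborel_pair.Fubini') measurable
  also have "\<dots> = (\<integral>\<^sup>+x. ?c * h (f x) \<partial>lborel)"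
  proof (rule nn_integral_cong)
    fix x
    have "(\<integral>\<^sup>+y. g (f x - y) \<partial>lborel) = (\<integral>\<^sup>+y. g (- f x + y) \<partial>lborel)"
      by (subst gf(2)) simp
    also have "\<dots> = ?c" by (subst nn_integral_lborel_shift) (auto simp: gi)
    finally show "(\<integral>\<^sup>+y. g (f x - y) * h (f x) \<partial>lborel) = ?c * h (f x)"
      by (simp add: nn_integral_multc)
  qed
  also have "\<dots> = ?c * emeasure (distr lborel borel f) X"
    by (simp add: nn_integral_cmult h_def flip: nn_integral_distr)
      (simp add: nn_integral_distr emeasure_distr flip: nn_integral_indicator)
  finally show "emeasure (distr lborel borel f) X = emeasure lborel X"
    using c by (simp add: ennreal_mult_cancel_left)
qed simp

text \<open>
  The cone over the preimage of a set is the preimage of the cone, so invariance of the surface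
  measure is that of Lebesgue measure.
\<close>

lemma distr_sphere_measure_orthogonal:
  fixes f :: "real^'n::finite \<Rightarrow> real^'n"
  assumes f: "orthogonal_transformation f"
  shows "f \<in> sphere_measure \<rightarrow>\<^sub>M sphere_measure" "distr sphere_measure sphere_measure f = sphere_measure"
proof -
  have nrm: "\<And>x. norm (f x) = norm x" and lin: "linear f"
    using f by (auto simp: orthogonal_transformation)
  have [measurable]: "f \<in> borel_measurable borel"
    by (rule orthogonal_transformation_measurable[OF f])
  show m: "f \<in> sphere_measure \<rightarrow>\<^sub>M sphere_measure"
    unfolding measurable_cong_sets[OF sets_sphere_measure sets_sphere_measure]
    by (rule measurable_restrict_space3) (auto simp: nrm)
  show "distr sphere_measure sphere_measure f = sphere_measure"
  proof (rule measure_eqI)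
    fix A assume "A \<in> sets (distr sphere_measure sphere_measure f)"
    then have A: "A \<in> sets sphere_measure" by simp
    then have A2[measurable]: "A \<in> sets borel" and A1: "A \<subseteq> sphere 0 1"
      by (auto simp: sets_sphere_measure sets_restrict_space_iff)
    have B: "f -` A \<in> sets borel" "f -` A \<subseteq> sphere 0 1"
      using measurable_sets_borel[of f borel A] A1 nrm by auto
    let ?C = "\<lambda>A. {x. 0 < norm x \<and> norm x < 1 \<and> x /\<^sub>R norm x \<in> A}"
    have f0: "f x = 0 \<longleftrightarrow> x = 0" for x using nrm[of x] by (metis norm_eq_zero)
    have C[measurable]: "?C A \<in> sets borel" by measurable
    have "f -` A \<inter> sphere 0 1 = f -` A" using B by auto
    then have "emeasure (distr sphere_measure sphere_measure f) A = emeasure sphere_measure (f -` A)"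
      using m A by (simp add: emeasure_distr)
    also have "\<dots> = of_nat CARD('n) * emeasure lborel (?C (f -` A))"
      by (rule emeasure_sphere_measure[OF B])
    also have "?C (f -` A) = f -` (?C A)"
      by (auto simp: nrm f0 linear_scale[OF lin])
    also have "emeasure lborel (f -` (?C A)) = emeasure (distr lborel borel f) (?C A)"
      by (simp add: emeasure_distr)
    also have "\<dots> = emeasure lborel (?C A)" by (simp add: lborel_distr_orthogonal[OF f])
    also have "of_nat CARD('n) * \<dots> = emeasure sphere_measure A"
      by (rule emeasure_sphere_measure[OF A2 A1, symmetric])
    finally show "emeasure (distr sphere_measure sphere_measure f) A = emeasure sphere_measure A" .
  qed simp
qed

lemma integral_sphere_orthogonal:
  fixes f :: "real^'n::finite \<Rightarrow> real^'n" and g :: "real^'n \<Rightarrow> real"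
  assumes f: "orthogonal_transformation f" and g: "g \<in> borel_measurable sphere_measure"
  shows "(LINT x|sphere_measure. g (f x)) = (LINT x|sphere_measure. g x)"
  using integral_distr[OF distr_sphere_measure_orthogonal(1)[OF f] g]
  by (simp add: distr_sphere_measure_orthogonal(2)[OF f])

text \<open>
  The reflection in the hyperplane orthogonal to \<open>v\<close>. Such a reflection can exchange any two vectors
  of equal norm, and it then fixes every vector that is orthogonal to both; these are all the
  rotations that the arguments below need.
\<close>

definition reflect :: "'a::real_inner \<Rightarrow> 'a \<Rightarrow> 'a" where
  "reflect v x = x - (2 * (x \<bullet> v) / (v \<bullet> v)) *\<^sub>R v"

lemma orthogonal_transformation_reflect: "orthogonal_transformation (reflect v)"
  unfolding orthogonal_transformation_def
proof (intro conjI allI)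
  show "linear (reflect v)"
    by (rule linearI) (auto simp: reflect_def inner_add_left add_divide_distrib algebra_simps)
  fix x y show "reflect v x \<bullet> reflect v y = x \<bullet> y"
    by (cases "v = 0") (auto simp: reflect_def inner_diff_left inner_diff_right inner_commute field_simps)
qed

lemma reflect_swap:
  assumes "norm a = norm b"
  shows "reflect (a - b) a = b"
proof (cases "a = b")
  case True then show ?thesis by (simp add: reflect_def)
next
  case False
  have "a \<bullet> a = b \<bullet> b" using assms by (simp add: dot_square_norm)
  then have "(a - b) \<bullet> (a - b) = 2 * (a \<bullet> (a - b))"
    by (simp add: inner_diff_left inner_diff_right inner_commute)
  moreover have "(a - b) \<bullet> (a - b) \<noteq> 0" using False by simp
  ultimately have "2 * (a \<bullet> (a - b)) / ((a - b) \<bullet> (a - b)) = 1" by simp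
  then show ?thesis unfolding reflect_def by (simp only: scaleR_one) simp
qed

lemma reflect_orthogonal: "x \<bullet> v = 0 \<Longrightarrow> reflect v x = x"
  by (simp add: reflect_def)

lemma reflect_minus: "reflect (- v) = reflect v"
  by (simp add: reflect_def fun_eq_iff)

section \<open>Moments of a coordinate on the sphere\<close>

definition sphere_mean :: "(real^'n::finite \<Rightarrow> real) \<Rightarrow> real" where
  "sphere_mean g = (LINT x|sphere_measure. g x) / sphere_area TYPE('n)"

lemma sphere_continuous_measurable:
  fixes g :: "real^'n::finite \<Rightarrow> real"
  assumes "continuous_on (sphere 0 1) g"
  shows "g \<in> borel_measurable sphere_measure"
  unfolding measurable_cong_sets[OF sets_sphere_measure refl]
  using assms by (rule borel_measurable_continuous_on_restrict)

lemma sphere_bounded_integrable: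
  fixes g :: "real^'n::finite \<Rightarrow> real"
  assumes "g \<in> borel_measurable sphere_measure" "\<And>x. x \<in> sphere 0 1 \<Longrightarrow> \<bar>g x\<bar> \<le> B"
  shows "integrable sphere_measure g"
proof -
  interpret finite_measure "sphere_measure :: (real^'n) measure"
    by (rule finite_measure_sphere_measure)
  show ?thesis
    using assms by (intro integrable_const_bound[where B=B]) (auto intro!: AE_I2)
qed

lemma sphere_continuous_integrable:
  fixes g :: "real^'n::finite \<Rightarrow> real"
  assumes "continuous_on (sphere 0 1) g"
  shows "integrable sphere_measure g"
proof -
  have "bounded (g ` sphere 0 1)"
    by (intro compact_imp_bounded compact_continuous_image assms) auto
  then obtain B where "\<And>x. x \<in> sphere 0 1 \<Longrightarrow> \<bar>g x\<bar> \<le> B"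
    by (force simp: bounded_iff)
  then show ?thesis
    by (rule sphere_bounded_integrable[OF sphere_continuous_measurable[OF assms]])
qed

lemma sphere_mean_cong:
  "(\<And>x. x \<in> sphere 0 1 \<Longrightarrow> f x = g x) \<Longrightarrow> sphere_mean f = sphere_mean g"
  unfolding sphere_mean_def by (intro arg_cong2[where f="(/)"] Bochner_Integration.integral_cong) auto

lemma sphere_mean_const [simp]: "sphere_mean (\<lambda>x::real^'n::finite. c) = c"
proof -
  interpret finite_measure "sphere_measure :: (real^'n) measure"
    by (rule finite_measure_sphere_measure)
  show ?thesis
    using sphere_area_pos[where 'n='n] by (simp add: sphere_mean_def sphere_area_def)
qed

lemma sphere_mean_cmult [simp]: "sphere_mean (\<lambda>x. c * g x) = c * sphere_mean g"
  by (simp add: sphere_mean_def)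

lemma sphere_mean_add:
  "integrable sphere_measure f \<Longrightarrow> integrable sphere_measure g \<Longrightarrow>
    sphere_mean (\<lambda>x. f x + g x) = sphere_mean f + sphere_mean g"
  by (simp add: sphere_mean_def add_divide_distrib)

lemma sphere_mean_diff:
  "integrable sphere_measure f \<Longrightarrow> integrable sphere_measure g \<Longrightarrow>
    sphere_mean (\<lambda>x. f x - g x) = sphere_mean f - sphere_mean g"
  by (simp add: sphere_mean_def diff_divide_distrib)

lemma sphere_mean_sum:
  "(\<And>i. i \<in> I \<Longrightarrow> integrable sphere_measure (f i)) \<Longrightarrow>
    sphere_mean (\<lambda>x. \<Sum>i\<in>I. f i x) = (\<Sum>i\<in>I. sphere_mean (f i))"
  by (simp add: sphere_mean_def sum_divide_distrib)

lemma sphere_mean_mono: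
  fixes f :: "real^'n::finite \<Rightarrow> real"
  assumes "integrable sphere_measure f" "integrable sphere_measure g"
    "\<And>x. x \<in> sphere 0 1 \<Longrightarrow> f x \<le> g x"
  shows "sphere_mean f \<le> sphere_mean g"
  unfolding sphere_mean_def using sphere_area_pos[where 'n='n] assms
  by (intro divide_right_mono integral_mono) auto

lemma sphere_mean_abs_le:
  fixes f :: "real^'n::finite \<Rightarrow> real"
  assumes f: "integrable sphere_measure f" and B: "\<And>x. x \<in> sphere 0 1 \<Longrightarrow> \<bar>f x\<bar> \<le> B"
  shows "\<bar>sphere_mean f\<bar> \<le> B"
proof -
  have c: "integrable sphere_measure (\<lambda>x::real^'n. c::real)" for c
    by (rule sphere_continuous_integrable) simp
  have "f x \<le> B" "- B \<le> f x" if "x \<in> sphere 0 1" for x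
    using B[OF that] by (auto simp: abs_le_iff)
  then have "sphere_mean f \<le> B" "- B \<le> sphere_mean f"
    using sphere_mean_mono[OF f c, of B] sphere_mean_mono[OF c f, of "- B"] by auto
  then show ?thesis by simp
qed

lemma sphere_mean_orthogonal:
  fixes g :: "real^'n::finite \<Rightarrow> real" and f :: "real^'n \<Rightarrow> real^'n"
  assumes "orthogonal_transformation f" "g \<in> borel_measurable sphere_measure"
  shows "sphere_mean (\<lambda>x. g (f x)) = sphere_mean g"
  by (simp add: sphere_mean_def integral_sphere_orthogonal[OF assms])

lemma sphere_inner_range:
  "x \<in> sphere 0 1 \<Longrightarrow> y \<in> sphere 0 1 \<Longrightarrow> x \<bullet> y \<in> {-1..1}" for x y :: "'a::real_inner"
  using Cauchy_Schwarz_ineq2[of x y] by (auto simp: abs_le_iff)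

lemma sphere_component_range: "x \<in> sphere 0 1 \<Longrightarrow> x $ p \<in> {-1..1}" for x :: "real^'n::finite"
  using component_le_norm_cart[of x p] by (auto simp: abs_le_iff)

lemma continuous_on_sphere_inner:
  assumes "continuous_on {-1..1} g" "e \<in> sphere 0 1"
  shows "continuous_on (sphere 0 1) (\<lambda>x::real^'n::finite. g (x \<bullet> e) :: real)"
  using sphere_inner_range[OF _ assms(2)]
  by (intro continuous_on_compose2[OF assms(1)] continuous_intros) blast

lemma continuous_on_sphere_component:
  assumes "continuous_on {-1..1} g"
  shows "continuous_on (sphere 0 1) (\<lambda>x::real^'n::finite. g (x $ p) :: real)"
  using sphere_component_range[of _ p]
  by (intro continuous_on_compose2[OF assms] continuous_intros) blast

text \<open>
  The reflection that swaps the axis \<open>p\<close> with \<open>e\<close> replaces one coordinate by the other.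
\<close>

lemma sphere_mean_inner:
  fixes e :: "real^'n::finite" and g :: "real \<Rightarrow> real" and p :: 'n
  assumes g: "continuous_on {-1..1} g" and e: "e \<in> sphere 0 1"
  shows "sphere_mean (\<lambda>x. g (x \<bullet> e)) = sphere_mean (\<lambda>x. g (x $ p))"
proof -
  define f where "f = reflect (axis p 1 - e)"
  have f: "orthogonal_transformation f" by (simp add: f_def orthogonal_transformation_reflect)
  have fa: "f (axis p 1) = e" using e by (simp add: f_def reflect_swap)
  have "f x \<bullet> e = x $ p" for x
  proof -
    have "f x \<bullet> e = f x \<bullet> f (axis p 1)" by (simp add: fa)
    also have "\<dots> = x \<bullet> axis p 1" using f by (simp add: orthogonal_transformation_def)
    finally show ?thesis by (simp add: inner_axis)
  qed
  then show ?thesis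
    using sphere_mean_orthogonal[OF f sphere_continuous_measurable[OF continuous_on_sphere_inner[OF g e]]]
    by simp
qed

definition moment :: "'n::finite \<Rightarrow> nat \<Rightarrow> real" where
  "moment p m = sphere_mean (\<lambda>x::real^'n. (x $ p) ^ m)"

lemma sphere_mean_odd:
  fixes g :: "real^'n::finite \<Rightarrow> real"
  assumes f: "orthogonal_transformation f" and g: "continuous_on (sphere 0 1) g"
    and odd: "\<And>x. g (f x) = - g x"
  shows "sphere_mean g = 0"
proof -
  have "sphere_mean g = sphere_mean (\<lambda>x. -1 * g x)"
    using sphere_mean_orthogonal[OF f sphere_continuous_measurable[OF g]] odd by simp
  then show ?thesis unfolding sphere_mean_cmult by simp
qed

lemma reflect_axis: "reflect (axis q 1) x $ i = (if i = q then - x $ q else x $ i)"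
  for x :: "real^'n::finite"
  by (simp add: reflect_def inner_axis inner_axis') (simp add: axis_def)

lemma moment_odd: "odd m \<Longrightarrow> moment p m = 0"
  unfolding moment_def
  by (rule sphere_mean_odd[OF orthogonal_transformation_reflect[of "axis p 1"]])
    (auto intro!: continuous_intros simp: reflect_axis power_minus_odd)

lemma coeff_one_plus_square_power: "coeff ([:1, 0, 1:] ^ j) 2 = real j"
proof -
  have "coeff ([:1, 0, 1:] ^ j) 0 = (1::real) \<and> coeff ([:1, 0, 1:] ^ j) (Suc (Suc 0)) = real j"
    by (induction j) (auto simp: mult_pCons_left)
  then show ?thesis by (auto simp: numeral_2_eq_2)
qed

text \<open>
  For every \<open>b\<close> the function \<open>x $ p + b * x $ q\<close> is \<open>sqrt (1 + b\<^sup>2)\<close> times the coordinate in a unit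
  direction, so by rotation invariance the mean of its power \<open>2 * j\<close> is \<open>(1 + b\<^sup>2) ^ j\<close> times the
  moment of one coordinate. Both sides are polynomials in \<open>b\<close>; the claim compares the coefficients
  of \<open>b\<^sup>2\<close>.
\<close>

lemma mixed_moment:
  fixes p q :: "'n::finite"
  assumes "p \<noteq> q" "j > 0"
  shows "real (2 * j - 1) * sphere_mean (\<lambda>x::real^'n. (x $ q)\<^sup>2 * (x $ p) ^ (2 * j - 2)) = moment p (2 * j)"
proof -
  define c where "c i = real (2 * j choose i) * sphere_mean (\<lambda>x::real^'n. (x $ q) ^ i * (x $ p) ^ (2 * j - i))" for i
  define P where "P = (\<Sum>i\<le>2 * j. monom (c i) i)"
  have "poly P b = poly (smult (moment p (2 * j)) ([:1, 0, 1:] ^ j)) b" for b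
  proof -
    define s where "s = sqrt (1 + b\<^sup>2)"
    define e where "e = (1 / s) *\<^sub>R (axis p 1 + b *\<^sub>R axis q 1 :: real^'n)"
    have s: "s > 0" "s\<^sup>2 = 1 + b\<^sup>2" by (auto simp: s_def add_pos_nonneg)
    have "(axis p 1 + b *\<^sub>R axis q 1 :: real^'n) \<bullet> (axis p 1 + b *\<^sub>R axis q 1) = s\<^sup>2"
      using assms by (simp add: inner_add_left inner_add_right inner_axis_axis s(2)) (simp add: power2_eq_square)
    then have "norm (axis p 1 + b *\<^sub>R axis q 1 :: real^'n) = s"
      using s(1) by (simp add: norm_eq_sqrt_inner)
    then have e: "e \<in> sphere 0 1" using s by (simp add: e_def)
    have xe: "x $ p + b * x $ q = s * (x \<bullet> e)" for x
      using s by (simp add: e_def inner_add_right inner_axis)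
    have "poly P b = (\<Sum>i\<le>2 * j. c i * b ^ i)"
      by (simp add: P_def poly_sum poly_monom)
    also have "\<dots> = (\<Sum>i\<le>2 * j. sphere_mean (\<lambda>x::real^'n. real (2 * j choose i) * (b * x $ q) ^ i * (x $ p) ^ (2 * j - i)))"
    proof (rule sum.cong[OF refl])
      fix i
      have "(\<lambda>x::real^'n. real (2 * j choose i) * (b * x $ q) ^ i * (x $ p) ^ (2 * j - i))
        = (\<lambda>x. (real (2 * j choose i) * b ^ i) * ((x $ q) ^ i * (x $ p) ^ (2 * j - i)))"
        by (simp add: power_mult_distrib mult_ac)
      then show "c i * b ^ i = sphere_mean (\<lambda>x::real^'n. real (2 * j choose i) * (b * x $ q) ^ i * (x $ p) ^ (2 * j - i))"
        by (simp only: sphere_mean_cmult c_def) simp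
    qed
    also have "\<dots> = sphere_mean (\<lambda>x::real^'n. \<Sum>i\<le>2 * j. real (2 * j choose i) * (b * x $ q) ^ i * (x $ p) ^ (2 * j - i))"
      by (rule sphere_mean_sum[symmetric])
        (auto intro!: sphere_continuous_integrable continuous_intros)
    also have "\<dots> = sphere_mean (\<lambda>x::real^'n. (b * x $ q + x $ p) ^ (2 * j))"
      by (simp add: binomial_ring)
    also have "\<dots> = sphere_mean (\<lambda>x. s ^ (2 * j) * (x \<bullet> e) ^ (2 * j))"
      by (simp add: xe add.commute power_mult_distrib)
    also have "\<dots> = s ^ (2 * j) * moment p (2 * j)"
      unfolding sphere_mean_cmult moment_def
      by (subst sphere_mean_inner[OF _ e, of "\<lambda>t. t ^ (2 * j)" p]) (auto intro!: continuous_intros)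
    finally show ?thesis
      by (simp add: power_mult s(2) poly_power) (simp add: power2_eq_square)
  qed
  then have "P = smult (moment p (2 * j)) ([:1, 0, 1:] ^ j)"
    by (simp add: poly_eq_poly_eq_iff[symmetric] fun_eq_iff)
  then have "coeff P 2 = real j * moment p (2 * j)"
    by (simp add: coeff_one_plus_square_power)
  moreover have "coeff P 2 = c 2"
    using assms by (simp add: P_def coeff_sum sum.delta)
  moreover have "real (2 * j choose 2) = real j * real (2 * j - 1)"
    using assms by (simp add: choose_two)
  ultimately have "real j * (real (2 * j - 1) * sphere_mean (\<lambda>x::real^'n. (x $ q)\<^sup>2 * (x $ p) ^ (2 * j - 2)))
     = real j * moment p (2 * j)"
    by (simp add: c_def)
  then show ?thesis using assms by simp
qed

text \<open>
  Sum \<open>mixed_moment\<close> over all \<open>q \<noteq> p\<close> and use that the squares of the coordinates add up to 1.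
\<close>

lemma moment_recurrence:
  fixes p :: "'n::finite"
  shows "(real m + real CARD('n)) * moment p (m + 2) = (real m + 1) * moment p m"
proof (cases "even m")
  case False then show ?thesis by (simp add: moment_odd)
next
  case True
  then obtain j where m: "m = 2 * j" by auto
  have "(\<Sum>q\<in>UNIV - {p}. sphere_mean (\<lambda>x::real^'n. (x $ q)\<^sup>2 * (x $ p) ^ m))
      = sphere_mean (\<lambda>x::real^'n. \<Sum>q\<in>UNIV - {p}. (x $ q)\<^sup>2 * (x $ p) ^ m)"
    by (rule sphere_mean_sum[symmetric]) (auto intro!: sphere_continuous_integrable continuous_intros)
  also have "\<dots> = sphere_mean (\<lambda>x::real^'n. (x $ p) ^ m - (x $ p) ^ (m + 2))"
  proof (rule sphere_mean_cong)
    fix x :: "real^'n" assume "x \<in> sphere 0 1"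
    then have "x \<bullet> x = 1" by (simp add: dot_square_norm)
    then have "(\<Sum>q\<in>UNIV. (x $ q)\<^sup>2) = 1" by (simp add: inner_vec_def power2_eq_square)
    then have h: "(\<Sum>q\<in>UNIV - {p}. (x $ q)\<^sup>2) = 1 - (x $ p)\<^sup>2" by (simp add: sum_diff)
    show "(\<Sum>q\<in>UNIV - {p}. (x $ q)\<^sup>2 * (x $ p) ^ m) = (x $ p) ^ m - (x $ p) ^ (m + 2)"
      unfolding sum_distrib_right[symmetric] h by (simp add: algebra_simps power_add power2_eq_square)
  qed
  also have "\<dots> = moment p m - moment p (m + 2)"
    unfolding moment_def
    by (rule sphere_mean_diff) (auto intro!: sphere_continuous_integrable continuous_intros)
  finally have 1: "(\<Sum>q\<in>UNIV - {p}. sphere_mean (\<lambda>x::real^'n. (x $ q)\<^sup>2 * (x $ p) ^ m))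
     = moment p m - moment p (m + 2)" .
  have "(real m + 1) * (\<Sum>q\<in>UNIV - {p}. sphere_mean (\<lambda>x::real^'n. (x $ q)\<^sup>2 * (x $ p) ^ m))
      = (\<Sum>q\<in>UNIV - {p}. moment p (m + 2))"
    unfolding sum_distrib_left
    using mixed_moment[of p _ "Suc j"] by (intro sum.cong) (auto simp: m add.commute)
  also have "\<dots> = (real CARD('n) - 1) * moment p (m + 2)"
    by (simp add: card_Diff_singleton of_nat_diff)
  finally show ?thesis unfolding 1 by (simp add: algebra_simps)
qed

section \<open>Orthogonality of Gegenbauer polynomials\<close>

text \<open>
  The function \<open>gegenbauer\<close> as an element of the polynomial ring, where degrees and coefficients
  are available.
\<close>

fun gegenbauer_poly :: "real \<Rightarrow> nat \<Rightarrow> real poly" where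
  "gegenbauer_poly l 0 = 1"
| "gegenbauer_poly l (Suc 0) = [:0, 2 * l:]"
| "gegenbauer_poly l (Suc (Suc k)) = smult (1 / (real k + 2))
     (smult (2 * (l + real k + 1)) (pCons 0 (gegenbauer_poly l (Suc k)))
       - smult (2 * l + real k) (gegenbauer_poly l k))"

lemma poly_gegenbauer_poly: "poly (gegenbauer_poly l k) t = gegenbauer l k t"
  by (induction l k rule: gegenbauer_poly.induct) (auto simp: field_simps)

lemma gegenbauer_poly_recurrence:
  "smult (2 * (l + real k + 1)) (pCons 0 (gegenbauer_poly l (Suc k)))
    = smult (real k + 2) (gegenbauer_poly l (Suc (Suc k))) + smult (2 * l + real k) (gegenbauer_poly l k)"
proof -
  have "smult (real k + 2) (gegenbauer_poly l (Suc (Suc k)))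
      = smult (2 * (l + real k + 1)) (pCons 0 (gegenbauer_poly l (Suc k)))
        - smult (2 * l + real k) (gegenbauer_poly l k)"
    by (simp only: gegenbauer_poly.simps smult_smult) simp
  then show ?thesis by simp
qed

lemma degree_gegenbauer_poly: "degree (gegenbauer_poly l k) \<le> k"
proof (induction l k rule: gegenbauer_poly.induct)
  case (3 l k)
  have "degree (gegenbauer_poly l (Suc (Suc k))) \<le> degree (smult (2 * (l + real k + 1)) (pCons 0 (gegenbauer_poly l (Suc k)))
       - smult (2 * l + real k) (gegenbauer_poly l k))"
    by (simp add: degree_smult_le)
  also have "\<dots> \<le> Suc (Suc k)"
    using 3 by (intro degree_diff_le order_trans[OF degree_smult_le]) (auto simp: degree_pCons_eq_if)
  finally show ?case .
qed auto

lemma coeff_gegenbauer_poly_pos: "l > 0 \<Longrightarrow> coeff (gegenbauer_poly l k) k > 0"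
proof (induction l k rule: gegenbauer_poly.induct)
  case (3 l k)
  have "coeff (gegenbauer_poly l k) (Suc (Suc k)) = 0"
    using degree_gegenbauer_poly[of l k] by (intro coeff_eq_0) simp
  then show ?case using 3 by simp
qed auto

lemma gegenbauer_one_pos:
  assumes "l > 0" shows "gegenbauer l k 1 > 0"
proof -
  have "gegenbauer l k 1 > 0 \<and> (real k + 1) * gegenbauer l (Suc k) 1 = (2 * l + real k) * gegenbauer l k 1"
  proof (induction k)
    case 0 then show ?case by simp
  next
    case (Suc k)
    then have "(2 * l + real k) * gegenbauer l k 1 > 0"
      using assms by (simp add: add_pos_nonneg)
    then have 1: "(real k + 1) * gegenbauer l (Suc k) 1 > 0"
      using Suc by simp
    have "(real k + 2) * gegenbauer l (Suc (Suc k)) 1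
        = 2 * (l + real k + 1) * gegenbauer l (Suc k) 1 - (2 * l + real k) * gegenbauer l k 1"
      by simp
    moreover have "gegenbauer l (Suc k) 1 > 0"
      using 1 by (simp add: zero_less_mult_iff)
    moreover have "(2 * l + real k) * gegenbauer l k 1 = (real k + 1) * gegenbauer l (Suc k) 1"
      using Suc by simp
    ultimately show ?case
      by (simp add: algebra_simps del: gegenbauer.simps(3))
  qed
  then show ?thesis by simp
qed

lemma real_poly_eqI: "(\<And>t::real. poly p t = poly q t) \<Longrightarrow> p = q"
  by (simp add: poly_eq_poly_eq_iff[symmetric] fun_eq_iff)

text \<open>
  The two structure relations express \<open>(1 - t\<^sup>2) C'\<close> through neighbouring polynomials. They are
  proved together: the three-term recurrence turns the first relation for \<open>k\<close> into the second one
  for \<open>k + 1\<close>, and its derivative gives the first relation for \<open>k + 1\<close> from both relations for \<open>k\<close>.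
\<close>

lemma gegenbauer_poly_deriv:
  defines "c \<equiv> \<lambda>l k t. poly (gegenbauer_poly l k) t"
    and "d \<equiv> \<lambda>l k t. poly (pderiv (gegenbauer_poly l k)) t"
  shows "(1 - t^2) * d l (Suc k) t = - (real k + 1) * t * c l (Suc k) t + (real k + 2 * l) * c l k t"
    and "(1 - t^2) * d l k t = (real k + 2 * l) * t * c l k t - (real k + 1) * c l (Suc k) t"
proof -
  have rec: "(real k + 2) * c l (Suc (Suc k)) t
      = 2 * (l + real k + 1) * t * c l (Suc k) t - (2 * l + real k) * c l k t" for k
    by (simp add: c_def)
  have drec: "(real k + 2) * d l (Suc (Suc k)) t
      = 2 * (l + real k + 1) * (c l (Suc k) t + t * d l (Suc k) t) - (2 * l + real k) * d l k t" for k
    using arg_cong[OF gegenbauer_poly_recurrence[of l k], of "\<lambda>p. poly (pderiv p) t"]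
    by (simp add: c_def d_def pderiv_smult pderiv_add pderiv_pCons algebra_simps del: gegenbauer_poly.simps)
  have "(1 - t^2) * d l (Suc k) t = - (real k + 1) * t * c l (Suc k) t + (real k + 2 * l) * c l k t
     \<and> (1 - t^2) * d l k t = (real k + 2 * l) * t * c l k t - (real k + 1) * c l (Suc k) t"
  proof (induction k)
    case 0 then show ?case
      by (simp add: c_def d_def pderiv_pCons power2_eq_square algebra_simps)
  next
    case (Suc k)
    note A = Suc.IH[THEN conjunct1] and A' = Suc.IH[THEN conjunct2]
    have "(real k + 2) * ((1 - t^2) * d l (Suc (Suc k)) t)
        = (real k + 2) * (- (real k + 2) * t * c l (Suc (Suc k)) t + (real k + 1 + 2 * l) * c l (Suc k) t)"
      using A A' rec[of k] drec[of k] by algebra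
    then have 1: "(1 - t^2) * d l (Suc (Suc k)) t
        = - (real k + 2) * t * c l (Suc (Suc k)) t + (real k + 1 + 2 * l) * c l (Suc k) t"
      by (simp only: mult_cancel_left) simp
    have 2: "(1 - t^2) * d l (Suc k) t = (real k + 1 + 2 * l) * t * c l (Suc k) t - (real k + 2) * c l (Suc (Suc k)) t"
      using A rec[of k] by algebra
    show ?case using 1 2 by (simp add: add.commute add.left_commute)
  qed
  then show "(1 - t^2) * d l (Suc k) t = - (real k + 1) * t * c l (Suc k) t + (real k + 2 * l) * c l k t"
    and "(1 - t^2) * d l k t = (real k + 2 * l) * t * c l k t - (real k + 1) * c l (Suc k) t"
    by auto
qed

lemma additive_poly_expand:
  fixes L :: "real poly \<Rightarrow> real"
  assumes add: "\<And>p q. L (p + q) = L p + L q" and scale: "\<And>c p. L (smult c p) = c * L p"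
  shows "L (q * r) = (\<Sum>i\<le>degree q. coeff q i * L (monom 1 i * r))"
proof -
  have L0: "L 0 = 0" using scale[of 0 0] by simp
  have "L (sum f A) = (\<Sum>i\<in>A. L (f i))" if "finite A" for f :: "nat \<Rightarrow> real poly" and A
    using that by induction (auto simp: L0 add)
  moreover have "q * r = (\<Sum>i\<le>degree q. smult (coeff q i) (monom 1 i * r))"
  proof -
    have "q * r = (\<Sum>i\<le>degree q. monom (coeff q i) i) * r"
      by (simp add: poly_as_sum_of_monoms)
    also have "\<dots> = (\<Sum>i\<le>degree q. monom (coeff q i) i * r)" by (rule sum_distrib_right)
    also have "\<dots> = (\<Sum>i\<le>degree q. smult (coeff q i) (monom 1 i * r))"
    proof (rule sum.cong[OF refl])
      fix i
      have "monom (coeff q i) i = smult (coeff q i) (monom 1 i)" by (simp add: smult_monom)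
      then show "monom (coeff q i) i * r = smult (coeff q i) (monom 1 i * r)" by simp
    qed
    finally show ?thesis .
  qed
  ultimately show ?thesis by (simp add: scale)
qed

text \<open>
  The weight enters only through integration by parts: \<open>L\<close> vanishes on
  \<open>(1 - X\<^sup>2) q' - (2 l + 1) X q\<close> for every polynomial \<open>q\<close>. For \<open>q = C\<^sub>k\<close> the structure relations
  express this by \<open>L (X C\<^sub>k)\<close>, \<open>L (C\<^sub>k\<^sub>+\<^sub>1)\<close> and \<open>L (C\<^sub>k\<^sub>-\<^sub>1)\<close>, which forces \<open>L\<close> to vanish on all \<open>C\<^sub>k\<close>
  with \<open>k \<ge> 1\<close>. The three-term recurrence then extends this to \<open>X\<^sup>m C\<^sub>k\<close> with \<open>m < k\<close>, as
  in Favard's theorem.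
\<close>

lemma gegenbauer_poly_orthogonal:
  fixes L :: "real poly \<Rightarrow> real"
  assumes l: "l > 0"
    and add: "\<And>p q. L (p + q) = L p + L q" and scale: "\<And>c p. L (smult c p) = c * L p"
    and parts: "\<And>q. L ([:1, 0, -1:] * pderiv q - smult (2 * l + 1) (pCons 0 q)) = 0"
    and deg: "degree q < k"
  shows "L (q * gegenbauer_poly l k) = 0"
proof -
  have diff: "L (p - q) = L p - L q" for p q
    using add[of "p - q" q] by simp
  let ?C = "gegenbauer_poly l"
  have D1: "[:1, 0, -1:] * pderiv (?C k) - smult (2 * l + 1) (pCons 0 (?C k))
      = smult (real k - 1) (pCons 0 (?C k)) - smult (real k + 1) (?C (Suc k))" for k
  proof -
    have "poly ([:1, 0, -1:] * pderiv (?C k) - smult (2 * l + 1) (pCons 0 (?C k))) t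
      = poly (smult (real k - 1) (pCons 0 (?C k)) - smult (real k + 1) (?C (Suc k))) t" for t
      using gegenbauer_poly_deriv(2)[of t l k]
      by (simp add: algebra_simps power2_eq_square del: gegenbauer_poly.simps)
    then show ?thesis by (rule real_poly_eqI)
  qed
  have D2: "[:1, 0, -1:] * pderiv (?C (Suc k)) - smult (2 * l + 1) (pCons 0 (?C (Suc k)))
      = smult (real k + 2 * l) (?C k) - smult (real k + 2 * l + 2) (pCons 0 (?C (Suc k)))" for k
  proof -
    have "poly ([:1, 0, -1:] * pderiv (?C (Suc k)) - smult (2 * l + 1) (pCons 0 (?C (Suc k)))) t
      = poly (smult (real k + 2 * l) (?C k) - smult (real k + 2 * l + 2) (pCons 0 (?C (Suc k)))) t" for t
      using gegenbauer_poly_deriv(1)[of t l k]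
      by (simp add: algebra_simps power2_eq_square del: gegenbauer_poly.simps)
    then show ?thesis by (rule real_poly_eqI)
  qed
  define x where "x k = L (pCons 0 (?C k))" for k
  define y where "y k = L (?C k)" for k
  have E1: "(real k - 1) * x k = (real k + 1) * y (Suc k)" for k
    using parts[of "?C k"] by (simp only: D1 diff scale x_def y_def)
  have E2: "(real k + 2 * l + 2) * x (Suc k) = (real k + 2 * l) * y k" for k
    using parts[of "?C (Suc k)"] by (simp only: D2 diff scale x_def y_def)
  have y: "y (Suc k) = 0" for k
  proof (induction k rule: less_induct)
    case (less k)
    consider "k = 0" | "k = 1" | m where "k = Suc (Suc m)"
      by (metis One_nat_def not0_implies_Suc)
    then show ?case
    proof cases
      case 1
      have "?C (Suc 0) = smult (2 * l) (pCons 0 (?C 0))" by simp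
      then have "y (Suc 0) = 2 * l * x 0" unfolding y_def x_def by (simp only: scale)
      moreover have "- x 0 = y (Suc 0)" using E1[of 0] by simp
      ultimately have "(2 * l + 1) * x 0 = 0" by (simp add: algebra_simps)
      with l \<open>- x 0 = y (Suc 0)\<close> 1 show ?thesis by simp
    next
      case 2 then show ?thesis using E1[of 1] by simp
    next
      case 3
      then have "y (Suc m) = 0" using less[of m] by simp
      then have "x (Suc (Suc m)) = 0" using E2[of "Suc m"] l by simp
      then show ?thesis using E1[of "Suc (Suc m)"] 3 by simp
    qed
  qed
  have XC: "L (monom 1 m * ?C k) = 0" if "m < k" for m k
    using that
  proof (induction m arbitrary: k)
    case 0 then obtain j where "k = Suc j" by (cases k) auto
    then show ?case using y[of j] by (simp add: y_def monom_0 del: gegenbauer_poly.simps)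
  next
    case (Suc m)
    then obtain j where j: "k = Suc j" "m < j" by (cases k) auto
    have "smult (2 * (l + real j + 1)) (monom 1 (Suc m) * ?C k)
        = monom 1 m * smult (2 * (l + real j + 1)) (pCons 0 (?C (Suc j)))"
      by (simp add: monom_Suc j del: gegenbauer_poly.simps)
    also have "\<dots> = smult (real j + 2) (monom 1 m * ?C (Suc (Suc j)))
        + smult (2 * l + real j) (monom 1 m * ?C j)"
      by (subst gegenbauer_poly_recurrence)
        (simp only: distrib_left[of "monom 1 m"] mult_smult_right)
    finally have "L (smult (2 * (l + real j + 1)) (monom 1 (Suc m) * ?C k))
        = L (smult (real j + 2) (monom 1 m * ?C (Suc (Suc j))) + smult (2 * l + real j) (monom 1 m * ?C j))"
      by (rule arg_cong)
    then have "2 * (l + real j + 1) * L (monom 1 (Suc m) * ?C k)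
        = (real j + 2) * L (monom 1 m * ?C (Suc (Suc j))) + (2 * l + real j) * L (monom 1 m * ?C j)"
      by (simp only: add scale)
    then show ?case using Suc.IH[of j] Suc.IH[of "Suc (Suc j)"] j l by simp
  qed
  show ?thesis
    by (subst additive_poly_expand[OF add scale]) (use deg in \<open>auto intro!: sum.neutral simp: XC\<close>)
qed

section \<open>The distribution of a coordinate on the sphere\<close>

definition weighted_integral :: "real \<Rightarrow> (real \<Rightarrow> real) \<Rightarrow> real" where
  "weighted_integral a f = (LINT t:{-1..1}|lborel. f t * (1 - t\<^sup>2) powr a)"

text \<open>
  For \<open>a = 0\<close> the weight is discontinuous at the endpoints, where it is \<open>0 powr 0 = 0\<close>; so
  integrability comes from boundedness and measurability.
\<close>

lemma weighted_integrable:
  assumes a: "a \<ge> 0" and f: "continuous_on {-1..1} f"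
  shows "set_integrable lborel {-1..1} (\<lambda>t::real. f t * (1 - t\<^sup>2) powr a)"
proof -
  have "bounded (f ` {-1..1})"
    by (intro compact_imp_bounded compact_continuous_image f) auto
  then obtain B where B: "\<And>t. t \<in> {-1..1} \<Longrightarrow> \<bar>f t\<bar> \<le> B"
    by (force simp: bounded_iff)
  have [measurable]: "(\<lambda>t. indicat_real {-1..1} t * f t) \<in> borel_measurable borel"
    using borel_measurable_continuous_on_indicator[OF _ f] by simp
  have "integrable lborel (\<lambda>t::real. indicator {-1..1} t *\<^sub>R ((indicator {-1..1} t *\<^sub>R f t) * (1 - t\<^sup>2) powr a))"
  proof (rule integrableI_bounded_set_indicator[where B=B])
    have "\<bar>f t * (1 - t\<^sup>2) powr a\<bar> \<le> B" if "t \<in> {-1..1}" for t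
    proof -
      have "0 \<le> 1 - t\<^sup>2" "1 - t\<^sup>2 \<le> 1" using that by (auto simp: abs_square_le_1)
      then have "(1 - t\<^sup>2) powr a \<le> 1" using powr_le1[OF a] by simp
      then have "\<bar>f t\<bar> * (1 - t\<^sup>2) powr a \<le> B * 1"
        using B[OF that] by (intro mult_mono) auto
      then show ?thesis by (simp add: abs_mult)
    qed
    then show "AE t in lborel. t \<in> {-1..1} \<longrightarrow> norm ((indicator {-1..1} t *\<^sub>R f t) * (1 - t\<^sup>2) powr a) \<le> B"
      by (intro AE_I2) auto
  qed (auto simp: emeasure_lborel_Icc_eq)
  then show ?thesis
    unfolding set_integrable_def
    by (rule Bochner_Integration.integrable_cong[THEN iffD1, rotated -1]) (auto simp: indicator_def)
qed

lemma weighted_integral_eq_integral: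
  assumes "a \<ge> 0" "continuous_on {-1..1} f"
  shows "((\<lambda>t. f t * (1 - t\<^sup>2) powr a) has_integral weighted_integral a f) {-1..1}"
  using set_borel_integral_eq_integral[OF weighted_integrable[OF assms]]
  by (metis weighted_integral_def integrable_integral)

lemma weighted_integral_add:
  assumes "a \<ge> 0" "continuous_on {-1..1} f" "continuous_on {-1..1} g"
  shows "weighted_integral a (\<lambda>t. f t + g t) = weighted_integral a f + weighted_integral a g"
  using set_integral_add(2)[OF weighted_integrable[OF assms(1,2)] weighted_integrable[OF assms(1,3)]]
  by (simp add: weighted_integral_def distrib_right)

lemma weighted_integral_cmult: "weighted_integral a (\<lambda>t. c * f t) = c * weighted_integral a f"
  by (simp add: weighted_integral_def mult.assoc)

lemma weighted_integral_add_const: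
  assumes "a \<ge> 0" "continuous_on {-1..1} f"
  shows "weighted_integral a (\<lambda>t. f t + c) = weighted_integral a f + c * weighted_integral a (\<lambda>_. 1)"
  using weighted_integral_add[OF assms continuous_on_const, of c] weighted_integral_cmult[of a c "\<lambda>_. 1"]
  by simp

lemma weighted_integral_sum:
  assumes "a \<ge> 0" "finite I" "\<And>i. i \<in> I \<Longrightarrow> continuous_on {-1..1} (f i)"
  shows "weighted_integral a (\<lambda>t. \<Sum>i\<in>I. f i t) = (\<Sum>i\<in>I. weighted_integral a (f i))"
  using assms(2,3)
proof (induction I)
  case empty then show ?case by (simp add: weighted_integral_def)
next
  case (insert i I)
  then show ?case
    by (simp add: weighted_integral_add assms continuous_on_sum)
qed

lemma weighted_integral_mono:
  assumes "a \<ge> 0" "continuous_on {-1..1} f" "continuous_on {-1..1} g"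
    and "\<And>t. t \<in> {-1..1} \<Longrightarrow> f t \<le> g t"
  shows "weighted_integral a f \<le> weighted_integral a g"
  unfolding weighted_integral_def
  using weighted_integrable[OF assms(1,2)] weighted_integrable[OF assms(1,3)] assms(4)
  by (intro set_integral_mono mult_right_mono) auto

text \<open>
  The substitution \<open>t = 2 s - 1\<close> gives a Beta integral, and Legendre's duplication formula brings its
  value into the form of the normalising constant of \<open>spherical_component\<close>.
\<close>

lemma weighted_integral_one:
  assumes "a \<ge> 0"
  shows "Gamma (a + 3/2) / (sqrt pi * Gamma (a + 1)) * weighted_integral a (\<lambda>_. 1) = 1"
proof -
  let ?f = "\<lambda>t::real. t powr (a + 1 - 1) * (1 - t) powr (a + 1 - 1)"
  have "(?f has_integral Beta (a + 1) (a + 1)) (cbox 0 1)"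
    using has_integral_Beta_real[of "a + 1" "a + 1"] assms by simp
  from has_integral_affinity[OF this, of "1/2" "1/2"]
  have "((\<lambda>x. ?f (x / 2 + 1 / 2)) has_integral 2 * Beta (a + 1) (a + 1))
      ((\<lambda>x. 2 * x - 1) ` {0..1})"
    by simp
  also have "(\<lambda>x. 2 * x - 1) ` {0..1} = {-1..1::real}"
    using image_affinity_atLeastAtMost[of 2 "-1" "0::real" 1] by simp
  finally have 1: "((\<lambda>x. ?f (x / 2 + 1 / 2)) has_integral 2 * Beta (a + 1) (a + 1)) {-1..1}" .
  have "((\<lambda>x. (1/4) powr a * (1 * (1 - x\<^sup>2) powr a)) has_integral 2 * Beta (a + 1) (a + 1)) {-1..1}"
  proof (rule has_integral_eq[OF _ 1])
    fix x :: real assume x: "x \<in> {-1..1}"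
    then have "?f (x / 2 + 1 / 2) = ((x / 2 + 1 / 2) * (1 - (x / 2 + 1 / 2))) powr a"
      by (simp add: powr_mult)
    also have "(x / 2 + 1 / 2) * (1 - (x / 2 + 1 / 2)) = (1/4) * (1 - x\<^sup>2)"
      by (simp add: field_simps power2_eq_square)
    also have "\<dots> powr a = (1/4) powr a * (1 * (1 - x\<^sup>2) powr a)"
      using x by (subst powr_mult) (auto simp: abs_square_le_1)
    finally show "?f (x / 2 + 1 / 2) = (1/4) powr a * (1 * (1 - x\<^sup>2) powr a)" .
  qed
  moreover have "((\<lambda>x. (1/4) powr a * (1 * (1 - x\<^sup>2) powr a)) has_integral
      (1/4) powr a * weighted_integral a (\<lambda>_. 1)) {-1..1}"
    by (intro has_integral_mult_right weighted_integral_eq_integral assms) simp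
  ultimately have eq: "(1/4) powr a * weighted_integral a (\<lambda>_. 1) = 2 * Beta (a + 1) (a + 1)"
    by (rule has_integral_unique[symmetric])
  have q: "(1/4) powr a = exp (- 2 * a * ln 2)"
  proof -
    have "ln (1/4 :: real) = - 2 * ln 2" using ln_realpow[of 2 2] by (simp add: ln_div)
    then show ?thesis by (simp add: powr_def)
  qed
  have pos: "Gamma (a + 1) > 0" "Gamma (a + 3/2) > 0" "Gamma (2 * a + 2) > 0"
    using assms by (auto intro!: Gamma_real_pos)
  have dup: "Gamma (a + 1) * Gamma (a + 3/2) = exp ((1 - 2 * (a + 1)) * ln 2) * sqrt pi * Gamma (2 * a + 2)"
  proof -
    have n: "complex_of_real z \<notin> \<int>\<^sub>\<le>\<^sub>0" if "z > 0" for z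
      using that nonpos_Ints_nonpos[of z] by (auto simp: of_real_in_nonpos_Ints_iff)
    have n1: "complex_of_real (a + 1) \<notin> \<int>\<^sub>\<le>\<^sub>0" "complex_of_real (a + 1) + 1/2 \<notin> \<int>\<^sub>\<le>\<^sub>0"
      using n[of "a + 1"] n[of "a + 1 + 1/2"] assms by auto
    have "complex_of_real (Gamma (a + 1) * Gamma (a + 3/2))
        = Gamma (complex_of_real (a + 1)) * Gamma (complex_of_real (a + 1) + 1/2)"
    proof -
      have "complex_of_real (a + 1) + 1/2 = complex_of_real (a + 3/2)" by simp
      then show ?thesis by (simp only: Gamma_complex_of_real of_real_mult)
    qed
    also have "\<dots> = exp ((1 - 2 * complex_of_real (a + 1)) * of_real (ln 2)) * of_real (sqrt pi) * Gamma (2 * complex_of_real (a + 1))"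
      by (rule Gamma_legendre_duplication[OF n1])
    also have "2 * complex_of_real (a + 1) = complex_of_real (2 * a + 2)" by simp
    also have "(1 - complex_of_real (2 * a + 2)) * of_real (ln 2) = of_real ((1 - 2 * (a + 1)) * ln 2)" by simp
    also have "exp (of_real ((1 - 2 * (a + 1)) * ln 2)) * of_real (sqrt pi) * Gamma (complex_of_real (2 * a + 2))
       = complex_of_real (exp ((1 - 2 * (a + 1)) * ln 2) * sqrt pi * Gamma (2 * a + 2))"
      by (simp only: Gamma_complex_of_real exp_of_real) (simp only: of_real_mult)
    finally show ?thesis by (simp only: of_real_eq_iff)
  qed
  have e: "exp ((1 - 2 * (a + 1)) * ln 2) = exp (- 2 * a * ln 2) / (2::real)"
  proof -
    have "(1 - 2 * (a + 1)) * ln 2 = - 2 * a * ln 2 - ln (2::real)" by (simp add: algebra_simps)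
    then show ?thesis by (simp only: exp_diff) simp
  qed
  define X where "X = exp (- 2 * a * ln (2::real))"
  have h1: "X * (Gamma (2 * a + 2) * weighted_integral a (\<lambda>_. 1)) = 2 * (Gamma (a + 1) * Gamma (a + 1))"
  proof -
    have "X * weighted_integral a (\<lambda>_. 1) = 2 * (Gamma (a + 1) * Gamma (a + 1) / Gamma (2 * a + 2))"
      using eq unfolding q X_def[symmetric] Beta_def by (simp add: add.assoc)
    then show ?thesis using pos by (simp add: field_simps)
  qed
  have h2: "Gamma (a + 1) * Gamma (a + 3/2) = X / 2 * (sqrt pi * Gamma (2 * a + 2))"
    using dup unfolding e X_def[symmetric] by simp
  have "(X * Gamma (2 * a + 2) * Gamma (a + 1)) * (Gamma (a + 3/2) * weighted_integral a (\<lambda>_. 1))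
      = (X * (Gamma (2 * a + 2) * weighted_integral a (\<lambda>_. 1))) * (Gamma (a + 1) * Gamma (a + 3/2))"
    by (simp only: mult_ac)
  also have "\<dots> = (X * Gamma (2 * a + 2) * Gamma (a + 1)) * (sqrt pi * Gamma (a + 1))"
    unfolding h1 h2 by simp
  finally have "(X * Gamma (2 * a + 2) * Gamma (a + 1)) * (Gamma (a + 3/2) * weighted_integral a (\<lambda>_. 1))
      = (X * Gamma (2 * a + 2) * Gamma (a + 1)) * (sqrt pi * Gamma (a + 1))" .
  moreover have "X * Gamma (2 * a + 2) * Gamma (a + 1) \<noteq> 0" using pos by (simp add: X_def)
  ultimately have "Gamma (a + 3/2) * weighted_integral a (\<lambda>_. 1) = sqrt pi * Gamma (a + 1)"
    by (metis mult_left_cancel)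
  then show ?thesis using pos by (simp add: field_simps)
qed

text \<open>
  The fundamental theorem of calculus for \<open>t ^ m * (1 - t\<^sup>2) powr (a + 1)\<close>, which takes the same value
  at both endpoints, namely 0.
\<close>

lemma weighted_integral_moment_boundary:
  assumes a: "a \<ge> 0"
  shows "real m * weighted_integral a (\<lambda>t. t ^ (m - 1)) = (real m + 2 * a + 2) * weighted_integral a (\<lambda>t. t ^ (m + 1))"
proof -
  let ?F = "\<lambda>t::real. t ^ m * (1 - t\<^sup>2) powr (a + 1)"
  have "((\<lambda>t. (real m * t ^ (m - 1) + - (real m + 2 * a + 2) * t ^ (m + 1)) * (1 - t\<^sup>2) powr a) has_integral ?F 1 - ?F (-1)) {-1..1}"
  proof (rule fundamental_theorem_of_calculus_interior)
    have "\<forall>x\<in>{-1..1::real}. 0 \<le> 1 - x\<^sup>2" by (auto simp: abs_square_le_1)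
    then show "continuous_on {-1..1} ?F"
      using a by (intro continuous_intros continuous_on_powr') auto
    fix t :: real assume t: "t \<in> {-1<..<1}"
    then have p: "1 - t\<^sup>2 > 0" by (auto simp: abs_square_less_1 abs_less_iff)
    have "(?F has_real_derivative (real m * t ^ (m - 1)) * (1 - t\<^sup>2) powr (a + 1)
        + ((a + 1) * (1 - t\<^sup>2) powr (a + 1 - 1) * (- (2 * t))) * t ^ m) (at t)"
      using p by (auto intro!: derivative_eq_intros)
    also have "(real m * t ^ (m - 1)) * (1 - t\<^sup>2) powr (a + 1)
        + ((a + 1) * (1 - t\<^sup>2) powr (a + 1 - 1) * (- (2 * t))) * t ^ m
      = (real m * t ^ (m - 1) + - (real m + 2 * a + 2) * t ^ (m + 1)) * (1 - t\<^sup>2) powr a"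
      using p by (cases m) (simp_all add: powr_add algebra_simps power2_eq_square)
    finally show "(?F has_vector_derivative (real m * t ^ (m - 1) + - (real m + 2 * a + 2) * t ^ (m + 1)) * (1 - t\<^sup>2) powr a) (at t)"
      by (simp only: has_real_derivative_iff_has_vector_derivative)
  qed auto
  moreover have "((\<lambda>t. (real m * t ^ (m - 1) + - (real m + 2 * a + 2) * t ^ (m + 1)) * (1 - t\<^sup>2) powr a) has_integral
      weighted_integral a (\<lambda>t. real m * t ^ (m - 1) + - (real m + 2 * a + 2) * t ^ (m + 1))) {-1..1}"
    by (intro weighted_integral_eq_integral a continuous_intros)
  ultimately have "?F 1 - ?F (-1) = weighted_integral a (\<lambda>t. real m * t ^ (m - 1) + - (real m + 2 * a + 2) * t ^ (m + 1))"
    by (rule has_integral_unique)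
  then have "weighted_integral a (\<lambda>t. real m * t ^ (m - 1) + - (real m + 2 * a + 2) * t ^ (m + 1)) = 0"
    by simp
  then have "real m * weighted_integral a (\<lambda>t. t ^ (m - 1)) + - (real m + 2 * a + 2) * weighted_integral a (\<lambda>t. t ^ (m + 1)) = 0"
    by (subst (asm) weighted_integral_add) (auto simp: a weighted_integral_cmult intro!: continuous_intros)
  then show ?thesis by (simp add: algebra_simps)
qed

text \<open>
  Both sides are positive functionals with total mass 1 whose moments satisfy the same two-step
  recurrence and whose first moments vanish. So they agree on polynomials, and by the
  Weierstrass theorem on continuous functions.
\<close>

lemma sphere_mean_eq_weighted_integral:
  fixes p :: "'n::finite"
  assumes dim: "3 \<le> CARD('n)" and f: "continuous_on {-1..1} f"
  shows "sphere_mean (\<lambda>x::real^'n. f (x $ p)) =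
    Gamma (real CARD('n) / 2) / (sqrt pi * Gamma ((real CARD('n) - 1) / 2)) *
      weighted_integral ((real CARD('n) - 3) / 2) f"
proof -
  define a where "a = (real CARD('n) - 3) / 2"
  define c where "c = Gamma (real CARD('n) / 2) / (sqrt pi * Gamma ((real CARD('n) - 1) / 2))"
  have a: "a \<ge> 0" using dim by (simp add: a_def)
  have c1: "c * weighted_integral a (\<lambda>_. 1) = 1"
  proof -
    have e: "a + 3/2 = real CARD('n) / 2" "a + 1 = (real CARD('n) - 1) / 2"
      by (simp_all add: a_def field_simps)
    show ?thesis using weighted_integral_one[OF a] unfolding c_def e .
  qed
  have c0: "c \<ge> 0"
    using dim unfolding c_def by (intro divide_nonneg_nonneg mult_nonneg_nonneg less_imp_le[OF Gamma_real_pos]) auto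
  have mom: "moment p m = c * weighted_integral a (\<lambda>t. t ^ m)" for m
  proof (induction m rule: less_induct)
    case (less m)
    consider "m = 0" | "m = 1" | j where "m = j + 2"
      by (metis One_nat_def add_2_eq_Suc' not0_implies_Suc)
    then show ?case
    proof cases
      case 1 then show ?thesis using c1 by (simp add: moment_def)
    next
      case 2
      then show ?thesis
        using weighted_integral_moment_boundary[OF a, of 0] a by (simp add: moment_odd)
    next
      case 3
      have "(real j + real CARD('n)) * moment p m = (real j + 1) * moment p j"
        unfolding 3 by (rule moment_recurrence)
      also have "\<dots> = c * ((real j + 1) * weighted_integral a (\<lambda>t. t ^ j))"
        using less[of j] 3 by simp
      also have "(real j + 1) * weighted_integral a (\<lambda>t. t ^ j)
          = (real j + real CARD('n)) * weighted_integral a (\<lambda>t. t ^ m)"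
        using weighted_integral_moment_boundary[OF a, of "j + 1"] 3
        by (simp add: a_def field_simps)
      finally show ?thesis by (simp add: dim add_nonneg_eq_0_iff)
    qed
  qed
  have cont_int: "integrable sphere_measure (\<lambda>x::real^'n. g (x $ p))" if "continuous_on {-1..1} g" for g :: "real \<Rightarrow> real"
    by (intro sphere_continuous_integrable continuous_on_sphere_component that)
  have "\<bar>sphere_mean (\<lambda>x::real^'n. f (x $ p)) - c * weighted_integral a f\<bar> \<le> e" if e: "e > 0" for e
  proof -
    obtain g where g: "real_polynomial_function g" "\<And>t. t \<in> {-1..1} \<Longrightarrow> \<bar>f t - g t\<bar> < e / 2"
      using Stone_Weierstrass_real_polynomial_function[OF _ f, of "e / 2"] e by auto
    then obtain b n where gb: "g = (\<lambda>t. \<Sum>i\<le>n. b i * t ^ i)"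
      using real_polynomial_function_iff_sum by blast
    have gc: "continuous_on {-1..1} g" unfolding gb by (intro continuous_intros)
    have "sphere_mean (\<lambda>x::real^'n. g (x $ p)) = (\<Sum>i\<le>n. b i * moment p i)"
      unfolding gb by (subst sphere_mean_sum)
        (auto simp: moment_def intro!: sphere_continuous_integrable continuous_intros)
    also have "\<dots> = c * weighted_integral a g"
      unfolding gb by (subst weighted_integral_sum)
        (auto simp: a mom weighted_integral_cmult sum_distrib_left mult_ac intro!: continuous_intros)
    finally have eq: "sphere_mean (\<lambda>x::real^'n. g (x $ p)) = c * weighted_integral a g" .
    have "\<bar>sphere_mean (\<lambda>x::real^'n. f (x $ p)) - sphere_mean (\<lambda>x::real^'n. g (x $ p))\<bar> \<le> e / 2"
      unfolding sphere_mean_diff[OF cont_int[OF f] cont_int[OF gc], symmetric]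
    proof (intro sphere_mean_abs_le Bochner_Integration.integrable_diff cont_int f gc)
      fix x :: "real^'n" assume "x \<in> sphere 0 1"
      from g(2)[OF sphere_component_range[OF this]] show "\<bar>f (x $ p) - g (x $ p)\<bar> \<le> e / 2"
        by (rule less_imp_le)
    qed
    moreover have "\<bar>c * weighted_integral a f - c * weighted_integral a g\<bar> \<le> e / 2"
    proof -
      have "f t \<le> g t + e / 2" "g t \<le> f t + e / 2" if "t \<in> {-1..1}" for t
        using g(2)[OF that] by (auto simp: abs_if split: if_splits)
      then have "weighted_integral a f \<le> weighted_integral a (\<lambda>t. g t + e / 2)"
        "weighted_integral a g \<le> weighted_integral a (\<lambda>t. f t + e / 2)"
        by (intro weighted_integral_mono a f gc continuous_intros; simp)+
      then have "weighted_integral a f \<le> weighted_integral a g + e / 2 * weighted_integral a (\<lambda>t. 1)"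
        "weighted_integral a g \<le> weighted_integral a f + e / 2 * weighted_integral a (\<lambda>t. 1)"
        unfolding weighted_integral_add_const[OF a gc] weighted_integral_add_const[OF a f] .
      from this[THEN mult_left_mono[OF _ c0]]
      have "c * weighted_integral a f \<le> c * weighted_integral a g + e / 2 * (c * weighted_integral a (\<lambda>t. 1))"
        "c * weighted_integral a g \<le> c * weighted_integral a f + e / 2 * (c * weighted_integral a (\<lambda>t. 1))"
        by (simp_all add: distrib_left mult.left_commute)
      then show ?thesis unfolding c1 by linarith
    qed
    ultimately show ?thesis unfolding eq by linarith
  qed
  then have "\<bar>sphere_mean (\<lambda>x::real^'n. f (x $ p)) - c * weighted_integral a f\<bar> \<le> 0"
    by (rule field_le_epsilon) simp
  then show ?thesis by (simp add: a_def c_def)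
qed

section \<open>The Funk--Hecke formula for zonal functions\<close>

lemma kernel_measurable:
  fixes W :: "real^'n::finite \<Rightarrow> real^'n \<Rightarrow> real"
  assumes cont: "continuous_on (sphere 0 1 \<times> sphere 0 1) (\<lambda>(x, y). W x y)"
  shows "(\<lambda>(x, y). W x y) \<in> borel_measurable (sphere_measure \<Otimes>\<^sub>M sphere_measure)"
proof -
  let ?S = "sphere 0 1 :: (real^'n) set"
  have id: "(\<lambda>x. x) \<in> sphere_measure \<rightarrow>\<^sub>M (borel :: (real^'n) measure)"
    unfolding measurable_cong_sets[OF sets_sphere_measure refl]
    by (rule measurable_restrict_space1) simp
  have "(\<lambda>z. z) \<in> sphere_measure \<Otimes>\<^sub>M sphere_measure \<rightarrow>\<^sub>M restrict_space borel (?S \<times> ?S)"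
  proof (rule measurable_restrict_space2)
    show "(\<lambda>z. z) \<in> space (sphere_measure \<Otimes>\<^sub>M sphere_measure) \<rightarrow> ?S \<times> ?S"
      by (auto simp: space_pair_measure)
    have "(\<lambda>z. (fst z, snd z)) \<in> sphere_measure \<Otimes>\<^sub>M sphere_measure \<rightarrow>\<^sub>M
        (borel \<Otimes>\<^sub>M borel :: ((real^'n) \<times> (real^'n)) measure)"
      by (intro measurable_Pair measurable_compose[OF measurable_fst id]
          measurable_compose[OF measurable_snd id])
    then show "(\<lambda>z. z) \<in> sphere_measure \<Otimes>\<^sub>M sphere_measure \<rightarrow>\<^sub>M
        (borel :: ((real^'n) \<times> (real^'n)) measure)"
      by (simp add: borel_prod)
  qed
  from measurable_compose[OF this borel_measurable_continuous_on_restrict[OF cont]]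
  show ?thesis .
qed

lemma sphere_mean_swap:
  fixes W :: "real^'n::finite \<Rightarrow> real^'n \<Rightarrow> real"
  assumes cont: "continuous_on (sphere 0 1 \<times> sphere 0 1) (\<lambda>(x, y). W x y)"
  shows "sphere_mean (\<lambda>x. sphere_mean (\<lambda>y. W x y)) = sphere_mean (\<lambda>y. sphere_mean (\<lambda>x. W x y))"
proof -
  interpret finite_measure "sphere_measure :: (real^'n) measure"
    by (rule finite_measure_sphere_measure)
  interpret P: pair_sigma_finite "sphere_measure :: (real^'n) measure" "sphere_measure :: (real^'n) measure"
    by unfold_locales
  interpret F: finite_measure "(sphere_measure :: (real^'n) measure) \<Otimes>\<^sub>M (sphere_measure :: (real^'n) measure)"
    by (rule finite_measure_pair_measure) unfold_locales
  have "bounded ((\<lambda>(x, y). W x y) ` (sphere 0 1 \<times> sphere 0 1))"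
    by (intro compact_imp_bounded compact_continuous_image cont compact_Times) auto
  then obtain B where B: "\<And>x y. x \<in> sphere 0 1 \<Longrightarrow> y \<in> sphere 0 1 \<Longrightarrow> \<bar>W x y\<bar> \<le> B"
    by (force simp: bounded_iff)
  have "integrable (sphere_measure \<Otimes>\<^sub>M sphere_measure) (\<lambda>(x, y). W x y)"
    by (rule F.integrable_const_bound[where B=B, OF _ kernel_measurable[OF cont]])
      (use B in \<open>auto intro!: AE_I2 simp: space_pair_measure\<close>)
  from P.Fubini_integral[OF this] show ?thesis
    by (simp add: sphere_mean_def)
qed

lemma sphere_mean_poly_add:
  "sphere_mean (\<lambda>x::real^'n::finite. poly (q + r) (x $ p))
    = sphere_mean (\<lambda>x::real^'n. poly q (x $ p)) + sphere_mean (\<lambda>x::real^'n. poly r (x $ p))"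
  by (subst sphere_mean_add[symmetric]) (auto intro!: sphere_continuous_integrable continuous_intros)

text \<open>
  By linearity it suffices to insert monomials, for which this is \<open>moment_recurrence\<close>.
\<close>

lemma sphere_mean_poly_by_parts:
  fixes p :: "'n::finite"
  shows "sphere_mean (\<lambda>x::real^'n.
    poly ([:1, 0, -1:] * pderiv q - smult (real CARD('n) - 1) (pCons 0 q)) (x $ p)) = 0"
proof -
  define L where "L q = sphere_mean (\<lambda>x::real^'n.
    poly ([:1, 0, -1:] * pderiv q - smult (real CARD('n) - 1) (pCons 0 q)) (x $ p))" for q
  have add: "L (q + r) = L q + L r" for q r
    unfolding L_def sphere_mean_poly_add[symmetric]
    by (simp add: pderiv_add algebra_simps smult_add_right)
  have scale: "L (smult c q) = c * L q" for c q
    unfolding L_def sphere_mean_cmult[symmetric] by (simp add: pderiv_smult algebra_simps)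
  have "L (monom 1 i) = 0" for i
  proof (cases i)
    case 0
    have "L 1 = sphere_mean (\<lambda>x::real^'n. (1 - real CARD('n)) * (x $ p) ^ 1)"
      unfolding L_def by (simp add: algebra_simps)
    then show ?thesis using moment_odd[of 1 p] 0 by (simp add: moment_def monom_0 one_pCons)
  next
    case (Suc j)
    have "L (monom 1 i) = sphere_mean (\<lambda>x::real^'n. (real j + 1) * (x $ p) ^ j - (real j + real CARD('n)) * (x $ p) ^ (j + 2))"
      unfolding L_def Suc by (simp add: pderiv_monom poly_monom algebra_simps)
    also have "\<dots> = (real j + 1) * moment p j - (real j + real CARD('n)) * moment p (j + 2)"
      unfolding moment_def sphere_mean_cmult[symmetric]
      by (rule sphere_mean_diff) (auto intro!: sphere_continuous_integrable continuous_intros)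
    finally show ?thesis by (simp only: moment_recurrence)
  qed
  then have "L (q * 1) = 0"
    by (subst additive_poly_expand[OF add scale]) simp
  then show ?thesis by (simp add: L_def)
qed

lemma sphere_mean_gegenbauer_orthogonal:
  fixes p :: "'n::finite"
  assumes "3 \<le> CARD('n)" "degree q < k"
  shows "sphere_mean (\<lambda>x::real^'n. poly (q * gegenbauer_poly ((real CARD('n) - 2) / 2) k) (x $ p)) = 0"
proof (rule gegenbauer_poly_orthogonal[where L="\<lambda>q. sphere_mean (\<lambda>x::real^'n. poly q (x $ p))"])
  show "0 < (real CARD('n) - 2) / 2" using assms by simp
  have "2 * ((real CARD('n) - 2) / 2) + 1 = real CARD('n) - 1" by (simp add: field_simps)
  then show "sphere_mean (\<lambda>x::real^'n. poly ([:1, 0, - 1:] * pderiv q - smult (2 * ((real CARD('n) - 2) / 2) + 1) (pCons 0 q)) (x $ p)) = 0" for q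
    by (simp only: sphere_mean_poly_by_parts)
qed (use assms in \<open>auto simp only: sphere_mean_poly_add poly_smult sphere_mean_cmult\<close>)

text \<open>
  The weight is positive inside the interval, so a polynomial whose square has mean 0 vanishes almost
  everywhere there, which is impossible for one with finitely many roots.
\<close>

lemma sphere_mean_poly_square_eq_0:
  fixes p :: "'n::finite"
  assumes dim: "3 \<le> CARD('n)" and z: "sphere_mean (\<lambda>x::real^'n. (poly h (x $ p))\<^sup>2) = 0"
  shows "h = 0"
proof (rule ccontr)
  assume h: "h \<noteq> 0"
  let ?a = "(real CARD('n) - 3) / 2"
  let ?g = "\<lambda>t. indicator {-1..1} t *\<^sub>R ((poly h t)\<^sup>2 * (1 - t\<^sup>2) powr ?a)"
  have a: "?a \<ge> 0" using dim by simp
  have pos: "Gamma (real CARD('n) / 2) > 0" "Gamma ((real CARD('n) - 1) / 2) > 0"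
    using dim by (auto intro!: Gamma_real_pos)
  have c: "continuous_on {-1..1} (\<lambda>t. (poly h t)\<^sup>2)" by (intro continuous_intros)
  have "weighted_integral ?a (\<lambda>t. (poly h t)\<^sup>2) = 0"
    using z pos by (simp add: sphere_mean_eq_weighted_integral[OF dim c])
  then have "integral\<^sup>L lborel ?g = 0"
    by (simp add: weighted_integral_def set_lebesgue_integral_def)
  moreover have "integrable lborel ?g"
    using weighted_integrable[OF a c] by (simp add: set_integrable_def)
  ultimately have "AE t in lborel. ?g t = 0"
    by (subst (asm) integral_nonneg_eq_0_iff_AE) (auto simp: indicator_def)
  moreover have "AE t in lborel. t \<notin> {t. poly h t = 0}"
    by (intro AE_not_in finite_imp_null_set_lborel poly_roots_finite h)
  ultimately have "AE t in lborel. t \<notin> {-1<..<1::real}"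
    by eventually_elim (auto simp: indicator_def abs_square_eq_1)
  then have "{-1<..<1::real} \<in> null_sets lborel"
    by (subst AE_iff_null_sets) auto
  then show False using null_setsD1 emeasure_lborel_Ioo[of "-1::real" 1] by fastforce
qed

lemma ex_other_index:
  fixes p :: "'n::finite"
  assumes "2 \<le> CARD('n)"
  shows "\<exists>q. q \<noteq> p"
proof (rule ccontr)
  assume "\<not> ?thesis"
  then have "(UNIV :: 'n set) = {p}" by auto
  then have "CARD('n) = card {p}" by simp
  then show False using assms by simp
qed

text \<open>
  A reflection that swaps \<open>x\<close> with the axis \<open>p\<close> moves the kernel to the axis, and a second one, which
  fixes the axis, moves \<open>x\<close> into the plane of the axes \<open>p\<close> and \<open>q\<close>. There
  \<open>x = a e\<^sub>p + b e\<^sub>q\<close> with \<open>a = x $ p\<close>, and the mean is a polynomial in \<open>a\<close> and \<open>b\<close>, homogeneous of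
  degree \<open>m\<close>. Odd powers of \<open>b\<close> drop out by the symmetry \<open>y $ q \<mapsto> - y $ q\<close>, and the even ones are
  powers of \<open>b\<^sup>2 = 1 - a\<^sup>2\<close>.
\<close>

lemma zonal_convolution_monomial:
  fixes p :: "'n::finite"
  assumes dim: "2 \<le> CARD('n)" and w: "continuous_on {-1..1} w"
  shows "\<exists>T. degree T \<le> m \<and>
    (\<forall>x\<in>sphere 0 1. sphere_mean (\<lambda>y::real^'n. w (x \<bullet> y) * (y $ p) ^ m) = poly T (x $ p))"
proof -
  obtain q where q: "q \<noteq> p" using ex_other_index[OF dim] by blast
  define c where "c i = real (m choose i) * sphere_mean (\<lambda>y::real^'n. w (y $ p) * ((y $ q) ^ i * (y $ p) ^ (m - i)))" for i
  define T where "T = (\<Sum>i\<le>m. smult (c i) ([:1, 0, -1:] ^ (i div 2) * monom 1 (m - i)))"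
  have cw: "continuous_on (sphere 0 1) (\<lambda>y::real^'n. w (y $ p))"
    by (rule continuous_on_sphere_component[OF w])
  have c_odd: "c i = 0" if "odd i" for i
  proof -
    have "sphere_mean (\<lambda>y::real^'n. w (y $ p) * ((y $ q) ^ i * (y $ p) ^ (m - i))) = 0"
      by (rule sphere_mean_odd[OF orthogonal_transformation_reflect[of "axis q 1"]])
        (use q that in \<open>auto intro!: continuous_intros cw simp: reflect_axis power_minus_odd\<close>)
    then show ?thesis by (simp add: c_def)
  qed
  have "degree T \<le> m"
    unfolding T_def
  proof (rule degree_sum_le)
    fix i assume i: "i \<in> {..m}"
    have "degree ([:1, 0, -1::real:] ^ (i div 2)) \<le> 2 * (i div 2)"
      by (rule order_trans[OF degree_power_le]) simp
    then have "degree ([:1, 0, -1::real:] ^ (i div 2) * monom 1 (m - i)) \<le> 2 * (i div 2) + (m - i)"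
      by (intro order_trans[OF degree_mult_le] add_mono degree_monom_le)
    then show "degree (smult (c i) ([:1, 0, -1:] ^ (i div 2) * monom 1 (m - i))) \<le> m"
      using i by (intro order_trans[OF degree_smult_le]) auto
  qed simp
  moreover have "sphere_mean (\<lambda>y::real^'n. w (x \<bullet> y) * (y $ p) ^ m) = poly T (x $ p)"
    if x: "x \<in> sphere 0 1" for x
  proof -
    define a where "a = x $ p"
    define v where "v = x - a *\<^sub>R axis p 1"
    define b where "b = norm v"
    have xx: "x \<bullet> x = 1" using x by (simp add: dot_square_norm)
    have vp: "axis p 1 \<bullet> v = 0" by (simp add: v_def inner_diff_right inner_axis inner_axis' a_def)
    have b2: "b\<^sup>2 = 1 - a\<^sup>2"
      unfolding b_def power2_norm_eq_inner
      using xx by (simp add: v_def inner_diff_right inner_diff_left inner_axis inner_axis' a_def power2_eq_square)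
    \<comment> \<open>R swaps x with the axis p, which moves the kernel to the axis.\<close>
    define R where "R = reflect (x - axis p 1)"
    have R: "orthogonal_transformation R" "R x = axis p 1"
      using x by (auto simp: R_def orthogonal_transformation_reflect reflect_swap)
    have Rp: "R (axis p 1) = x"
    proof -
      have "R = reflect (axis p 1 - x)"
        unfolding R_def using reflect_minus[of "axis p 1 - x"] by simp
      then show ?thesis using x by (simp add: reflect_swap)
    qed
    have R1: "x \<bullet> R y = y $ p" "R y $ p = x \<bullet> y" for y
    proof -
      have "x \<bullet> R y = R (axis p 1) \<bullet> R y" by (simp add: Rp)
      then show "x \<bullet> R y = y $ p" using R by (simp add: orthogonal_transformation_def inner_axis')
      have "R y $ p = R y \<bullet> R x" by (simp add: R inner_axis)
      also have "\<dots> = y \<bullet> x" using R(1) by (simp add: orthogonal_transformation_def)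
      finally show "R y $ p = x \<bullet> y" by (simp add: inner_commute)
    qed
    have cx: "continuous_on (sphere 0 1) (\<lambda>y. w (x \<bullet> y))"
      using continuous_on_sphere_inner[OF w x] by (simp add: inner_commute)
    have 1: "sphere_mean (\<lambda>y. w (x \<bullet> y) * (y $ p) ^ m) = sphere_mean (\<lambda>y. w (y $ p) * (x \<bullet> y) ^ m)"
      using sphere_mean_orthogonal[OF R(1), of "\<lambda>y. w (x \<bullet> y) * (y $ p) ^ m"]
      by (simp add: R1 sphere_continuous_measurable continuous_intros cx)
    \<comment> \<open>Q turns v, the part of x orthogonal to the axis p, into the direction of the axis q and fixes the axis p.\<close>
    define Q where "Q = reflect (b *\<^sub>R axis q 1 - v)"
    have Q: "orthogonal_transformation Q" "Q (b *\<^sub>R axis q 1) = v"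
      by (auto simp: Q_def orthogonal_transformation_reflect b_def intro!: reflect_swap)
    have Qp: "Q (axis p 1) = axis p 1"
      unfolding Q_def using q vp by (intro reflect_orthogonal) (simp add: inner_diff_right inner_axis_axis)
    have Q1: "Q y $ p = y $ p" "x \<bullet> Q y = a * y $ p + b * y $ q" for y
    proof -
      have "Q y $ p = Q y \<bullet> Q (axis p 1)" by (simp add: Qp inner_axis)
      then show Qyp: "Q y $ p = y $ p" using Q by (simp add: orthogonal_transformation_def inner_axis)
      have "v \<bullet> Q y = Q (b *\<^sub>R axis q 1) \<bullet> Q y" by (simp add: Q)
      also have "\<dots> = b * y $ q" using Q(1) by (simp add: orthogonal_transformation_def inner_axis')
      finally have "v \<bullet> Q y = b * y $ q" .
      moreover have "x \<bullet> Q y = a * (Q y $ p) + v \<bullet> Q y"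
        by (simp add: v_def inner_diff_left inner_axis')
      ultimately show "x \<bullet> Q y = a * y $ p + b * y $ q" by (simp add: Qyp)
    qed
    have 2: "sphere_mean (\<lambda>y. w (y $ p) * (x \<bullet> y) ^ m)
        = sphere_mean (\<lambda>y. w (y $ p) * (b * y $ q + a * y $ p) ^ m)"
      using sphere_mean_orthogonal[OF Q(1), of "\<lambda>y. w (y $ p) * (x \<bullet> y) ^ m"]
      by (simp add: Q1 sphere_continuous_measurable continuous_intros cw add.commute)
    have "sphere_mean (\<lambda>y. w (y $ p) * (b * y $ q + a * y $ p) ^ m)
        = sphere_mean (\<lambda>y. \<Sum>i\<le>m. (b ^ i * a ^ (m - i) * real (m choose i)) * (w (y $ p) * ((y $ q) ^ i * (y $ p) ^ (m - i))))"
      by (simp add: binomial_ring sum_distrib_left power_mult_distrib mult_ac)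
    also have "\<dots> = (\<Sum>i\<le>m. b ^ i * a ^ (m - i) * c i)"
      unfolding c_def mult.assoc[symmetric, of _ "real (m choose _)"]
      by (subst sphere_mean_sum)
        (auto intro!: sphere_continuous_integrable continuous_intros cw)
    also have "\<dots> = (\<Sum>i\<le>m. c i * ((1 - a\<^sup>2) ^ (i div 2) * a ^ (m - i)))"
    proof (rule sum.cong[OF refl])
      fix i show "b ^ i * a ^ (m - i) * c i = c i * ((1 - a\<^sup>2) ^ (i div 2) * a ^ (m - i))"
      proof (cases "even i")
        case True
        then have "b ^ i = (b\<^sup>2) ^ (i div 2)" by (simp flip: power_mult)
        then show ?thesis by (simp add: b2)
      qed (simp add: c_odd)
    qed
    also have "\<dots> = poly T a"
      by (simp add: T_def poly_sum poly_monom power2_eq_square)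
    finally show ?thesis using 1 2 by (simp add: a_def)
  qed
  ultimately show ?thesis by blast
qed

lemma zonal_convolution_poly:
  fixes p :: "'n::finite"
  assumes dim: "2 \<le> CARD('n)" and w: "continuous_on {-1..1} w"
  shows "\<exists>T. degree T \<le> degree q \<and>
    (\<forall>x\<in>sphere 0 1. sphere_mean (\<lambda>y::real^'n. w (x \<bullet> y) * poly q (y $ p)) = poly T (x $ p))"
proof -
  have "\<forall>m. \<exists>T. degree T \<le> m \<and>
      (\<forall>x\<in>sphere 0 1. sphere_mean (\<lambda>y::real^'n. w (x \<bullet> y) * (y $ p) ^ m) = poly T (x $ p))"
    using zonal_convolution_monomial[OF dim w] by blast
  from choice[OF this] obtain T where T: "\<And>m. degree (T m) \<le> m"
    "\<And>m x. x \<in> sphere 0 1 \<Longrightarrow> sphere_mean (\<lambda>y::real^'n. w (x \<bullet> y) * (y $ p) ^ m) = poly (T m) (x $ p)"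
    by blast
  define S where "S = (\<Sum>i\<le>degree q. smult (coeff q i) (T i))"
  have "degree S \<le> degree q"
    unfolding S_def
  proof (rule degree_sum_le)
    fix i assume "i \<in> {..degree q}"
    then show "degree (smult (coeff q i) (T i)) \<le> degree q"
      using order_trans[OF degree_smult_le T(1), of "coeff q i" i] by (simp del: degree_smult_eq)
  qed simp
  moreover have "sphere_mean (\<lambda>y::real^'n. w (x \<bullet> y) * poly q (y $ p)) = poly S (x $ p)"
    if x: "x \<in> sphere 0 1" for x
  proof -
    have cx: "continuous_on (sphere 0 1) (\<lambda>y. w (x \<bullet> y))"
      using continuous_on_sphere_inner[OF w x] by (simp add: inner_commute)
    have "sphere_mean (\<lambda>y::real^'n. w (x \<bullet> y) * poly q (y $ p))
        = sphere_mean (\<lambda>y. \<Sum>i\<le>degree q. coeff q i * (w (x \<bullet> y) * (y $ p) ^ i))"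
      unfolding poly_altdef sum_distrib_left by (simp only: mult.left_commute)
    also have "\<dots> = poly S (x $ p)"
      by (subst sphere_mean_sum)
        (auto intro!: sphere_continuous_integrable continuous_intros cx simp: T(2)[OF x] S_def poly_sum)
    finally show ?thesis .
  qed
  ultimately show ?thesis by blast
qed

lemma continuous_on_inner_kernel:
  assumes w: "continuous_on {-1..1} w"
  shows "continuous_on (sphere 0 1 \<times> sphere 0 1) (\<lambda>z::(real^'n::finite) \<times> (real^'n). w (fst z \<bullet> snd z) :: real)"
proof (rule continuous_on_compose2[OF w])
  show "(\<lambda>z. fst z \<bullet> snd z) ` (sphere 0 1 \<times> sphere (0::real^'n) 1) \<subseteq> {-1..1}"
    using sphere_inner_range by (auto simp del: atLeastAtMost_iff)
qed (intro continuous_intros)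

text \<open>
  Convolution with the kernel maps the Gegenbauer polynomial \<open>C\<close> of degree \<open>k\<close> to a polynomial \<open>T\<close> of
  degree at most \<open>k\<close> in the same coordinate. It is symmetric and does not raise degrees, so \<open>T\<close> is, like
  \<open>C\<close>, orthogonal to all polynomials of degree less than \<open>k\<close>. Hence \<open>T\<close> is a multiple of \<open>C\<close>, and the
  evaluation at the pole identifies the factor as the integral that defines \<open>spherical_component\<close>.
\<close>

theorem Funk_Hecke_zonal:
  fixes p :: "'n::finite"
  assumes dim: "3 \<le> CARD('n)" and w: "continuous_on {-1..1} w" and x: "x \<in> sphere 0 1"
  shows "sphere_mean (\<lambda>y::real^'n. w (x \<bullet> y) * sphere_gegenbauer TYPE('n) k (y $ p))
    = spherical_component TYPE('n) w k * sphere_gegenbauer TYPE('n) k (x $ p)"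
proof -
  define l where "l = (real CARD('n) - 2) / 2"
  define C where "C = gegenbauer_poly l k"
  have l: "l > 0" using dim by (simp add: l_def)
  have G: "sphere_gegenbauer TYPE('n) k t = poly C t" for t
    by (simp add: sphere_gegenbauer_def C_def l_def poly_gegenbauer_poly)
  have dC: "degree C \<le> k" "coeff C k > 0"
    using degree_gegenbauer_poly coeff_gegenbauer_poly_pos[OF l] by (auto simp: C_def)
  have C1: "poly C 1 > 0"
    using gegenbauer_one_pos[OF l] by (simp add: C_def poly_gegenbauer_poly)
  define L where "L q = sphere_mean (\<lambda>x::real^'n. poly q (x $ p))" for q
  have LC: "L (q * C) = 0" if "degree q < k" for q
    using sphere_mean_gegenbauer_orthogonal[OF dim that, of p] by (simp add: L_def C_def l_def)
  have dim2: "2 \<le> CARD('n)" using dim by simp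
  obtain T where T: "degree T \<le> k"
    "\<And>x. x \<in> sphere 0 1 \<Longrightarrow> sphere_mean (\<lambda>y::real^'n. w (x \<bullet> y) * poly C (y $ p)) = poly T (x $ p)"
    using zonal_convolution_poly[OF dim2 w, of C] dC by (metis order_trans)
  define c where "c = coeff T k / coeff C k"
  define h where "h = T - smult c C"
  have "h = 0"
  proof (cases "k = 0")
    case True
    then show ?thesis using T(1) dC
      by (auto simp: h_def c_def poly_eq_iff elim!: degree_eq_zeroE split: nat.split simp: coeff_pCons)
  next
    case False
    have "degree h \<le> k" using T dC by (auto simp: h_def intro!: degree_diff_le order_trans[OF degree_smult_le])
    moreover have "coeff h k = 0" using dC by (simp add: h_def c_def)
    ultimately have dh: "degree h < k"
      using False by (metis le_neq_implies_less leading_coeff_0_iff degree_0 gr0I)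
    obtain U where U: "degree U \<le> degree h"
      "\<And>x. x \<in> sphere 0 1 \<Longrightarrow> sphere_mean (\<lambda>y::real^'n. w (x \<bullet> y) * poly h (y $ p)) = poly U (x $ p)"
      using zonal_convolution_poly[OF dim2 w, of h] by blast
    \<comment> \<open>Symmetry of the kernel moves the convolution from C to h, whose convolution has degree less than k.\<close>
    have "L (h * T) = sphere_mean (\<lambda>x::real^'n. sphere_mean (\<lambda>y::real^'n. poly h (x $ p) * (w (x \<bullet> y) * poly C (y $ p))))"
      unfolding L_def by (intro sphere_mean_cong) (simp add: T(2))
    also have "\<dots> = sphere_mean (\<lambda>y::real^'n. sphere_mean (\<lambda>x::real^'n. poly h (x $ p) * (w (x \<bullet> y) * poly C (y $ p))))"
      by (rule sphere_mean_swap)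
        (auto simp: split_beta intro!: continuous_intros continuous_on_inner_kernel[OF w])
    also have "\<dots> = sphere_mean (\<lambda>y::real^'n. poly C (y $ p) * sphere_mean (\<lambda>x::real^'n. w (y \<bullet> x) * poly h (x $ p)))"
      unfolding sphere_mean_cmult[symmetric] by (simp add: inner_commute mult_ac)
    also have "\<dots> = L (U * C)"
      unfolding L_def by (intro sphere_mean_cong) (simp add: U(2))
    also have "\<dots> = 0" using LC[of U] U(1) dh by simp
    finally have hT: "L (h * T) = 0" .
    have "L (h * h) + c * L (h * C) = L (h * T)"
    proof -
      have "T = h + smult c C" by (simp add: h_def)
      then have "h * T = h * h + smult c (h * C)" by (simp only: distrib_left mult_smult_right)
      then show ?thesis by (simp only: L_def sphere_mean_poly_add poly_smult sphere_mean_cmult)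
    qed
    then have "L (h * h) = 0" using hT LC[OF dh] by simp
    then show ?thesis
      by (intro sphere_mean_poly_square_eq_0[OF dim, of _ p]) (simp add: L_def power2_eq_square)
  qed
  then have T_eq: "poly T t = c * poly C t" for t by (simp add: h_def)
  have "spherical_component TYPE('n) w k = c"
  proof -
    have "sphere_mean (\<lambda>y::real^'n. w (y $ p) * (poly C (y $ p) / poly C 1)) = spherical_component TYPE('n) w k"
      using sphere_mean_eq_weighted_integral[OF dim, of "\<lambda>t. w t * (poly C t / poly C 1)" p] w C1
      by (simp add: continuous_intros spherical_component_def weighted_integral_def G)
    moreover have "sphere_mean (\<lambda>y::real^'n. w (axis p 1 \<bullet> y) * poly C (y $ p)) = c * poly C 1"
      using T(2)[of "axis p 1"] by (simp add: T_eq)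
    then have "sphere_mean (\<lambda>y::real^'n. (1 / poly C 1) * (w (y $ p) * poly C (y $ p))) = c"
      unfolding sphere_mean_cmult using C1 by (simp add: inner_axis')
    ultimately show ?thesis by simp
  qed
  then show ?thesis using T(2)[OF x] by (simp add: G T_eq)
qed

section \<open>Completeness of $L_2$ of the sphere\<close>

lemma L2_of_eq_iff:
  "square_integrable f \<Longrightarrow> square_integrable g \<Longrightarrow>
    L2_of f = L2_of g \<longleftrightarrow> (AE x in sphere_measure. f x = g x)"
  by transfer (auto simp: L2_eq_def)

lemma L2_of_rep: "L2_of (rep_sphere_L2 u) = u"
proof -
  have "L2_of f = abs_sphere_L2 f" if "square_integrable f" for f :: "(real^'a) \<Rightarrow> real"
    using that by (simp add: L2_of_def)
  then show ?thesis
    by (simp add: square_integrable_rep Quotient3_abs_rep[OF Quotient3_sphere_L2])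
qed

lemma L2_of_add:
  "square_integrable f \<Longrightarrow> square_integrable g \<Longrightarrow> L2_of f + L2_of g = L2_of (\<lambda>x. f x + g x)"
  by transfer (auto simp: L2_eq_def square_integrable_add)

lemma L2_of_diff:
  "square_integrable f \<Longrightarrow> square_integrable g \<Longrightarrow> L2_of f - L2_of g = L2_of (\<lambda>x. f x - g x)"
  by transfer (auto simp: L2_eq_def square_integrable_diff)

lemma L2_of_scaleR:
  "square_integrable f \<Longrightarrow> c *\<^sub>R L2_of f = L2_of (\<lambda>x. c * f x)"
  by transfer (auto simp: L2_eq_def square_integrable_scale)

lemma inner_L2_of:
  "square_integrable f \<Longrightarrow> square_integrable g \<Longrightarrow>
    L2_of f \<bullet> L2_of g = sphere_mean (\<lambda>x. f x * g x)"
  unfolding sphere_mean_def by transfer auto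

lemma norm_L2_of_power2:
  "square_integrable f \<Longrightarrow> (norm (L2_of f))\<^sup>2 = sphere_mean (\<lambda>x. (f x)\<^sup>2)"
  unfolding power2_norm_eq_inner by (simp add: inner_L2_of power2_eq_square)

text \<open>
  Classes depend only on the values on the sphere; outside of it two representatives may differ, so
  square integrability has to be transferred as well.
\<close>

lemma L2_of_cong:
  assumes "\<And>x. x \<in> sphere 0 1 \<Longrightarrow> f x = g x"
  shows "L2_of f = L2_of g"
proof -
  have "f \<in> borel_measurable sphere_measure \<longleftrightarrow> g \<in> borel_measurable sphere_measure"
    by (rule measurable_cong) (simp add: assms)
  moreover have "integrable sphere_measure (\<lambda>x. (f x)\<^sup>2) \<longleftrightarrow> integrable sphere_measure (\<lambda>x. (g x)\<^sup>2)"
    by (rule Bochner_Integration.integrable_cong) (auto simp: assms)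
  ultimately have sq: "square_integrable f \<longleftrightarrow> square_integrable g"
    by (simp add: square_integrable_def)
  show ?thesis
  proof (cases "square_integrable f")
    case True
    then show ?thesis using sq by (subst L2_of_eq_iff) (auto intro!: AE_I2 simp: assms)
  next
    case False
    then show ?thesis using sq by transfer (simp add: L2_eq_def square_integrable_zero)
  qed
qed

lemma square_integrable_continuous:
  "continuous_on (sphere 0 1) f \<Longrightarrow> square_integrable f"
  unfolding square_integrable_def
  by (auto intro!: sphere_continuous_measurable sphere_continuous_integrable continuous_intros)

lemma norm_L2_of_le:
  fixes f :: "real^'n::finite \<Rightarrow> real"
  assumes f: "f \<in> borel_measurable sphere_measure" and B: "\<And>x. x \<in> sphere 0 1 \<Longrightarrow> \<bar>f x\<bar> \<le> B"
  shows "norm (L2_of f) \<le> B"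
proof -
  have sq: "square_integrable f" by (rule square_integrable_bounded[OF f B])
  have "norm (axis undefined 1 :: real^'n) = 1" by simp
  then have "B \<ge> 0" using B[of "axis undefined 1"] by (auto intro: order_trans[OF abs_ge_zero])
  have "(norm (L2_of f))\<^sup>2 = sphere_mean (\<lambda>x. (f x)\<^sup>2)" by (rule norm_L2_of_power2[OF sq])
  also have "\<dots> \<le> sphere_mean (\<lambda>x::real^'n. B\<^sup>2)"
  proof (rule sphere_mean_mono)
    show "integrable sphere_measure (\<lambda>x. (f x)\<^sup>2)" using sq by (simp add: square_integrable_def)
    show "integrable sphere_measure (\<lambda>x::real^'n. B\<^sup>2)" by (rule sphere_continuous_integrable) simp
    show "(f x)\<^sup>2 \<le> B\<^sup>2" if "x \<in> sphere 0 1" for x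
      using B[OF that] by (simp add: abs_le_square_iff[symmetric])
  qed
  finally show ?thesis using \<open>B \<ge> 0\<close> by (simp add: power2_le_iff_abs_le)
qed

lemma norm_L2_one: "norm (L2_of (\<lambda>_::real^'n::finite. 1)) = 1"
proof (rule power2_eq_imp_eq)
  show "(norm (L2_of (\<lambda>_::real^'n. 1)))\<^sup>2 = 1\<^sup>2"
    by (subst norm_L2_of_power2[OF square_integrable_const]) simp
qed auto

lemma integral_eq_sphere_mean:
  "(LINT x|sphere_measure. f x) = sphere_area TYPE('n) * sphere_mean (f :: real^'n::finite \<Rightarrow> real)"
  using sphere_area_pos[where 'n='n] by (simp add: sphere_mean_def)

lemma nn_integral_square_L2:
  fixes f :: "real^'n::finite \<Rightarrow> real"
  assumes f: "square_integrable f"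
  shows "(\<integral>\<^sup>+x. ennreal ((f x)\<^sup>2) \<partial>sphere_measure) = ennreal (sphere_area TYPE('n) * (norm (L2_of f))\<^sup>2)"
  using f by (subst nn_integral_eq_integral)
    (auto simp: square_integrable_def integral_eq_sphere_mean norm_L2_of_power2)

text \<open>
  The Cauchy--Schwarz inequality against the constant function, which has norm 1 in the normalised
  inner product.
\<close>

lemma nn_integral_abs_L2_le:
  fixes f :: "real^'n::finite \<Rightarrow> real"
  assumes f: "square_integrable f"
  shows "(\<integral>\<^sup>+x. ennreal \<bar>f x\<bar> \<partial>sphere_measure) \<le> ennreal (sphere_area TYPE('n) * norm (L2_of f))"
proof -
  have sq: "square_integrable (\<lambda>x. \<bar>f x\<bar>)" using f by (auto simp: square_integrable_def)
  have int: "integrable sphere_measure (\<lambda>x. \<bar>f x\<bar>)"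
    using square_integrable_mult[OF sq square_integrable_const[of 1]] by simp
  have "sphere_mean (\<lambda>x. \<bar>f x\<bar>) = L2_of (\<lambda>x. \<bar>f x\<bar>) \<bullet> L2_of (\<lambda>_. 1)"
    by (simp add: inner_L2_of sq square_integrable_const)
  also have "\<dots> \<le> norm (L2_of (\<lambda>x. \<bar>f x\<bar>))"
    using norm_cauchy_schwarz[of "L2_of (\<lambda>x. \<bar>f x\<bar>)" "L2_of (\<lambda>_. 1)"] by (simp add: norm_L2_one)
  also have "\<dots> = norm (L2_of f)"
    by (rule power2_eq_imp_eq) (simp_all add: norm_L2_of_power2 f sq)
  finally show ?thesis
    using int sphere_area_pos[where 'n='n]
    by (subst nn_integral_eq_integral) (auto simp: integral_eq_sphere_mean intro!: ennreal_leI)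
qed

text \<open>
  The Riesz--Fischer argument: along indices \<open>r k\<close> with geometrically small differences the
  representatives converge almost everywhere, because the series of the absolute differences has a
  finite integral, and Fatou's lemma bounds the distance to the limit.
\<close>

theorem complete_sphere_L2: "complete (UNIV :: 'n::finite sphere_L2 set)"
  unfolding complete_def
proof (intro allI impI)
  fix X :: "nat \<Rightarrow> 'n sphere_L2" assume "(\<forall>n. X n \<in> UNIV) \<and> Cauchy X"
  then have X: "Cauchy X" by simp
  let ?M = "sphere_measure :: (real^'n) measure"
  define \<omega> where "\<omega> = sphere_area TYPE('n)"
  have \<omega>: "\<omega> > 0" by (simp add: \<omega>_def sphere_area_pos)
  have "\<forall>k. \<exists>N. \<forall>m\<ge>N. \<forall>n\<ge>N. dist (X m) (X n) < (1/2) ^ k"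
  proof
    fix k :: nat
    have "(1/2 :: real) ^ k > 0" by simp
    with X show "\<exists>N. \<forall>m\<ge>N. \<forall>n\<ge>N. dist (X m) (X n) < (1/2) ^ k"
      unfolding Cauchy_def by blast
  qed
  from choice[OF this] obtain N where N: "\<And>k m n. m \<ge> N k \<Longrightarrow> n \<ge> N k \<Longrightarrow> dist (X m) (X n) < (1/2) ^ k"
    by blast
  \<comment> \<open>The partial sums of N dominate N and are monotone.\<close>
  define r where "r k = (\<Sum>i\<le>k. N i)" for k
  have r: "N k \<le> r m" if "k \<le> m" for k m
    unfolding r_def using that by (intro member_le_sum) auto
  define F where "F k = rep_sphere_L2 (X (r k))" for k
  have sqF: "square_integrable (F k)" for k by (simp add: F_def square_integrable_rep)
  then have [measurable]: "F k \<in> borel_measurable ?M" for k by (simp add: square_integrable_def)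
  have nF: "norm (L2_of (\<lambda>x. F m x - F k x)) < (1/2) ^ j" if "j \<le> m" "j \<le> k" for j m k
    using N[OF r r, of j m k] that
    by (simp add: L2_of_diff[symmetric] sqF) (simp add: F_def L2_of_rep dist_norm)
  have "(\<integral>\<^sup>+x. (\<Sum>k. ennreal \<bar>F (Suc k) x - F k x\<bar>) \<partial>?M) = (\<Sum>k. \<integral>\<^sup>+x. ennreal \<bar>F (Suc k) x - F k x\<bar> \<partial>?M)"
    by (rule nn_integral_suminf) measurable
  also have "\<dots> \<le> (\<Sum>k. ennreal (\<omega> * (1/2) ^ k))"
  proof (rule suminf_le)
    fix k
    have "(\<integral>\<^sup>+x. ennreal \<bar>F (Suc k) x - F k x\<bar> \<partial>?M) \<le> ennreal (\<omega> * norm (L2_of (\<lambda>x. F (Suc k) x - F k x)))"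
      unfolding \<omega>_def by (intro nn_integral_abs_L2_le square_integrable_diff sqF)
    also have "\<dots> \<le> ennreal (\<omega> * (1/2) ^ k)"
      using nF[of k "Suc k" k] \<omega> by (intro ennreal_leI mult_left_mono) auto
    finally show "(\<integral>\<^sup>+x. ennreal \<bar>F (Suc k) x - F k x\<bar> \<partial>?M) \<le> ennreal (\<omega> * (1/2) ^ k)" .
  qed (auto intro: summableI)
  also have "\<dots> < \<infinity>"
  proof -
    have "summable (\<lambda>k. \<omega> * (1/2) ^ k)" by (intro summable_mult summable_geometric) simp
    then have "(\<Sum>k. ennreal (\<omega> * (1/2) ^ k)) \<noteq> top"
      using \<omega> by (intro ennreal_suminf_neq_top) auto
    then show ?thesis by (simp add: less_top)
  qed
  finally have "AE x in ?M. (\<Sum>k. ennreal \<bar>F (Suc k) x - F k x\<bar>) \<noteq> \<infinity>"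
    by (intro nn_integral_PInf_AE) auto
  then have conv: "AE x in ?M. convergent (\<lambda>k. F k x)"
  proof eventually_elim
    fix x assume "(\<Sum>k. ennreal \<bar>F (Suc k) x - F k x\<bar>) \<noteq> \<infinity>"
    then have "summable (\<lambda>k. \<bar>F (Suc k) x - F k x\<bar>)" by (intro summable_suminf_not_top) auto
    then have "summable (\<lambda>k. F (Suc k) x - F k x)" by (rule summable_rabs_cancel)
    then have "convergent (\<lambda>n. F 0 x + (\<Sum>k<n. F (Suc k) x - F k x))"
      by (intro convergent_add) (auto simp: summable_iff_convergent convergent_const)
    then show "convergent (\<lambda>k. F k x)" unfolding sum_lessThan_telescope[of "\<lambda>k. F k x"] by simp
  qed
  define g where "g x = lim (\<lambda>k. F k x)" for x
  have g[measurable]: "g \<in> borel_measurable ?M" unfolding g_def by measurable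
  have lim: "AE x in ?M. (\<lambda>k. F k x) \<longlonglongrightarrow> g x"
    using conv by eventually_elim (simp add: g_def convergent_LIMSEQ_iff)
  have fatou: "(\<integral>\<^sup>+x. ennreal ((g x - F k x)\<^sup>2) \<partial>?M) \<le> ennreal (\<omega> * ((1/2) ^ k)\<^sup>2)" for k
  proof -
    have "(\<integral>\<^sup>+x. ennreal ((g x - F k x)\<^sup>2) \<partial>?M) = (\<integral>\<^sup>+x. liminf (\<lambda>m. ennreal ((F m x - F k x)\<^sup>2)) \<partial>?M)"
    proof (rule nn_integral_cong_AE)
      show "AE x in ?M. ennreal ((g x - F k x)\<^sup>2) = liminf (\<lambda>m. ennreal ((F m x - F k x)\<^sup>2))"
        using lim
      proof eventually_elim
        fix x assume "(\<lambda>k. F k x) \<longlonglongrightarrow> g x"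
        then have "(\<lambda>m. ennreal ((F m x - F k x)\<^sup>2)) \<longlonglongrightarrow> ennreal ((g x - F k x)\<^sup>2)"
          by (intro tendsto_intros)
        then show "ennreal ((g x - F k x)\<^sup>2) = liminf (\<lambda>m. ennreal ((F m x - F k x)\<^sup>2))"
          by (rule lim_imp_Liminf[OF trivial_limit_sequentially, symmetric])
      qed
    qed
    also have "\<dots> \<le> liminf (\<lambda>m. \<integral>\<^sup>+x. ennreal ((F m x - F k x)\<^sup>2) \<partial>?M)"
      by (rule nn_integral_liminf) measurable
    also have "\<dots> \<le> ennreal (\<omega> * ((1/2) ^ k)\<^sup>2)"
    proof (rule Liminf_le)
      show "\<forall>\<^sub>F m in sequentially. (\<integral>\<^sup>+x. ennreal ((F m x - F k x)\<^sup>2) \<partial>?M) \<le> ennreal (\<omega> * ((1/2) ^ k)\<^sup>2)"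
        using eventually_ge_at_top[of k]
      proof eventually_elim
        fix m assume "k \<le> m"
        then have "(norm (L2_of (\<lambda>x. F m x - F k x)))\<^sup>2 \<le> ((1/2) ^ k)\<^sup>2"
          using nF[of k m k] by (intro power_mono) auto
        then show "(\<integral>\<^sup>+x. ennreal ((F m x - F k x)\<^sup>2) \<partial>?M) \<le> ennreal (\<omega> * ((1/2) ^ k)\<^sup>2)"
          using \<omega> by (simp add: nn_integral_square_L2 square_integrable_diff sqF \<omega>_def[symmetric] ennreal_leI)
      qed
    qed simp
    finally show ?thesis .
  qed
  have sqd: "square_integrable (\<lambda>x. g x - F k x)" for k
    unfolding square_integrable_def
  proof
    show "integrable ?M (\<lambda>x. (g x - F k x)\<^sup>2)"
      by (rule integrableI_nonneg) (auto intro: le_less_trans[OF fatou])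
  qed measurable
  have sqg: "square_integrable g"
    using square_integrable_add[OF sqd[of 0] sqF[of 0]] by simp
  have close: "dist (X (r k)) (L2_of g) \<le> (1/2) ^ k" for k
  proof -
    have "ennreal (\<omega> * (norm (L2_of (\<lambda>x. g x - F k x)))\<^sup>2) \<le> ennreal (\<omega> * ((1/2) ^ k)\<^sup>2)"
      using fatou[of k] by (simp add: nn_integral_square_L2 sqd \<omega>_def)
    then have "(norm (L2_of (\<lambda>x. g x - F k x)))\<^sup>2 \<le> ((1/2) ^ k)\<^sup>2"
      using \<omega> by (subst (asm) ennreal_le_iff) auto
    then have "norm (L2_of (\<lambda>x. g x - F k x)) \<le> (1/2) ^ k"
      by (rule power2_le_imp_le) simp
    then show ?thesis
      by (simp add: L2_of_diff[symmetric] sqg sqF) (simp add: F_def L2_of_rep dist_norm norm_minus_commute)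
  qed
  have "X \<longlonglongrightarrow> L2_of g"
  proof (rule metric_LIMSEQ_I)
    fix e :: real assume "e > 0"
    then obtain k where k: "(1/2 :: real) ^ k < e / 2" using real_arch_pow_inv[of "e / 2" "1/2"] by auto
    have "dist (X n) (L2_of g) < e" if "n \<ge> N k" for n
      using dist_triangle[of "X n" "L2_of g" "X (r k)"] N[of k n "r k"] r[of k k] that close[of k] k by simp
    then show "\<exists>no. \<forall>n\<ge>no. dist (X n) (L2_of g) < e" by blast
  qed
  then show "\<exists>l\<in>UNIV. X \<longlonglongrightarrow> l" by blast
qed

section \<open>Diagonal operators and their small nonlinear perturbations\<close>

text \<open>
  Banach's fixed point theorem with a parameter. The distance of two fixed points is at most twice the
  distance of the values of the two maps at one of them, whence continuity.
\<close>

lemma parametric_contraction: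
  fixes T :: "'b::metric_space \<Rightarrow> 'a::metric_space \<Rightarrow> 'a"
  assumes S: "complete S" "S \<noteq> {}"
    and self: "\<And>t x. t \<in> I \<Longrightarrow> x \<in> S \<Longrightarrow> T t x \<in> S"
    and contr: "\<And>t x y. t \<in> I \<Longrightarrow> x \<in> S \<Longrightarrow> y \<in> S \<Longrightarrow> dist (T t x) (T t y) \<le> 1/2 * dist x y"
    and cont: "\<And>x. x \<in> S \<Longrightarrow> continuous_on I (\<lambda>t. T t x)"
  obtains \<xi> where "continuous_on I \<xi>" "\<And>t. t \<in> I \<Longrightarrow> \<xi> t \<in> S" "\<And>t. t \<in> I \<Longrightarrow> T t (\<xi> t) = \<xi> t"
    "\<And>t x. t \<in> I \<Longrightarrow> x \<in> S \<Longrightarrow> T t x = x \<Longrightarrow> \<xi> t = x"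
proof -
  have ex: "\<exists>!x\<in>S. T t x = x" if "t \<in> I" for t
    by (rule Banach_fix[OF S, of "1/2"]) (use self[OF that] contr[OF that] in auto)
  define \<xi> where "\<xi> t = (THE x. x \<in> S \<and> T t x = x)" for t
  have \<xi>: "\<xi> t \<in> S \<and> T t (\<xi> t) = \<xi> t" if "t \<in> I" for t
    unfolding \<xi>_def by (rule theI') (use ex[OF that] in blast)
  have uniq: "\<xi> t = x" if "t \<in> I" "x \<in> S" "T t x = x" for t x
    using ex[OF that(1)] \<xi>[OF that(1)] that by blast
  have lip: "dist (\<xi> s) (\<xi> t) \<le> 2 * dist (T s (\<xi> t)) (T t (\<xi> t))" if "s \<in> I" "t \<in> I" for s t
  proof -
    have "dist (\<xi> s) (\<xi> t) = dist (T s (\<xi> s)) (T t (\<xi> t))" using \<xi> that by simp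
    also have "\<dots> \<le> dist (T s (\<xi> s)) (T s (\<xi> t)) + dist (T s (\<xi> t)) (T t (\<xi> t))"
      by (rule dist_triangle)
    also have "\<dots> \<le> 1/2 * dist (\<xi> s) (\<xi> t) + dist (T s (\<xi> t)) (T t (\<xi> t))"
      using contr[OF that(1), of "\<xi> s" "\<xi> t"] \<xi>[OF that(1)] \<xi>[OF that(2)] by simp
    finally show ?thesis by simp
  qed
  have "continuous_on I \<xi>"
    unfolding continuous_on_iff
  proof (intro ballI allI impI)
    fix t and e :: real assume t: "t \<in> I" and e: "0 < e"
    have "continuous_on I (\<lambda>s. T s (\<xi> t))" using cont \<xi> t by blast
    then obtain d where d: "d > 0" "\<And>s. s \<in> I \<Longrightarrow> dist s t < d \<Longrightarrow> dist (T s (\<xi> t)) (T t (\<xi> t)) < e / 2"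
      using t e unfolding continuous_on_iff by (meson half_gt_zero)
    then have "\<forall>s\<in>I. dist s t < d \<longrightarrow> dist (\<xi> s) (\<xi> t) < e"
      using lip[OF _ t] by fastforce
    then show "\<exists>d>0. \<forall>s\<in>I. dist s t < d \<longrightarrow> dist (\<xi> s) (\<xi> t) < e" using d(1) by blast
  qed
  then show thesis using that \<xi> uniq by blast
qed

definition orthonormal :: "(nat \<Rightarrow> 'a::real_inner) \<Rightarrow> bool" where
  "orthonormal e \<longleftrightarrow> (\<forall>i j. e i \<bullet> e j = (if i = j then 1 else 0))"

lemma inner_orthonormal_sum:
  assumes "orthonormal e" "finite F"
  shows "(\<Sum>i\<in>F. a i *\<^sub>R e i) \<bullet> (\<Sum>i\<in>F. b i *\<^sub>R e i) = (\<Sum>i\<in>F. a i * b i)"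
proof -
  have d: "e i \<bullet> e j = (if i = j then 1 else 0)" for i j
    using assms(1) by (simp add: orthonormal_def)
  have "(\<Sum>i\<in>F. a i *\<^sub>R e i) \<bullet> (\<Sum>i\<in>F. b i *\<^sub>R e i) = (\<Sum>i\<in>F. \<Sum>j\<in>F. (a i * b j) * (e i \<bullet> e j))"
    unfolding inner_sum_left unfolding inner_sum_right by (intro sum.cong refl) (simp add: ac_simps)
  also have "\<dots> = (\<Sum>i\<in>F. a i * b i)"
  proof (rule sum.cong[OF refl])
    fix i assume "i \<in> F"
    have "(\<Sum>j\<in>F. (a i * b j) * (e i \<bullet> e j)) = (\<Sum>j\<in>F. if i = j then a i * b j else 0)"
      by (rule sum.cong) (auto simp: d)
    then show "(\<Sum>j\<in>F. (a i * b j) * (e i \<bullet> e j)) = a i * b i"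
      using assms(2) \<open>i \<in> F\<close> by simp
  qed
  finally show ?thesis .
qed

lemma Bessel_inequality:
  assumes e: "orthonormal e" and F: "finite F"
  shows "(\<Sum>j\<in>F. (v \<bullet> e j)\<^sup>2) \<le> (norm v)\<^sup>2"
proof -
  define s where "s = (\<Sum>j\<in>F. (v \<bullet> e j) *\<^sub>R e j)"
  have ss: "s \<bullet> s = (\<Sum>j\<in>F. (v \<bullet> e j)\<^sup>2)"
    unfolding s_def inner_orthonormal_sum[OF e F] by (simp add: power2_eq_square)
  have vs: "v \<bullet> s = (\<Sum>j\<in>F. (v \<bullet> e j)\<^sup>2)"
    by (simp add: s_def inner_sum_right power2_eq_square)
  have "0 \<le> (v - s) \<bullet> (v - s)" by simp
  also have "\<dots> = v \<bullet> v - 2 * (v \<bullet> s) + s \<bullet> s"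
    by (simp add: inner_diff_left inner_diff_right inner_commute[of s v])
  also have "\<dots> = v \<bullet> v - (\<Sum>j\<in>F. (v \<bullet> e j)\<^sup>2)"
    unfolding vs ss by simp
  finally show ?thesis by (simp add: power2_norm_eq_inner)
qed

lemma span_orthonormal_range:
  assumes e: "orthonormal e" and y: "y \<in> span (range e)"
  obtains F a where "finite F" "y = (\<Sum>j\<in>F. a j *\<^sub>R e j)"
proof -
  have "inj e"
  proof (rule injI)
    fix i j assume "e i = e j"
    moreover have "e j \<bullet> e j = 1" "i \<noteq> j \<Longrightarrow> e i \<bullet> e j = 0"
      using e unfolding orthonormal_def by auto
    ultimately show "i = j" by (metis \<open>e i = e j\<close> zero_neq_one)
  qed
  obtain t r where t: "finite t" "t \<subseteq> range e" "y = (\<Sum>a\<in>t. r a *\<^sub>R a)"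
  proof -
    from y have "\<exists>t r. finite t \<and> t \<subseteq> range e \<and> y = (\<Sum>a\<in>t. r a *\<^sub>R a)"
      unfolding span_explicit mem_Collect_eq by fast
    then show thesis using that by blast
  qed
  obtain F where F: "finite F" "t = e ` F" using finite_subset_image[OF t(1,2)] by auto
  have "inj_on e F" using \<open>inj e\<close> by (rule inj_on_subset) simp
  then have "y = (\<Sum>j\<in>F. r (e j) *\<^sub>R e j)" unfolding t(3) F(2) by (simp add: sum.reindex)
  with F(1) show thesis by (rule that)
qed

lemma subspace_closure:
  fixes S :: "'a::real_normed_vector set"
  assumes S: "subspace S"
  shows "subspace (closure S)"
proof (rule subspaceI)
  show "0 \<in> closure S" using subspace_0[OF S] closure_subset by blast
  fix x y :: 'a and c :: real assume "x \<in> closure S"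
  then obtain a where a: "\<And>n. a n \<in> S" "a \<longlonglongrightarrow> x" unfolding closure_sequential by blast
  have "(\<lambda>n. c *\<^sub>R a n) \<longlonglongrightarrow> c *\<^sub>R x" by (intro tendsto_intros a)
  then show "c *\<^sub>R x \<in> closure S"
    unfolding closure_sequential
    using subspace_scale[OF S a(1)] by (intro exI[of _ "\<lambda>n. c *\<^sub>R a n"]) simp
  assume "y \<in> closure S"
  then obtain b where b: "\<And>n. b n \<in> S" "b \<longlonglongrightarrow> y" unfolding closure_sequential by blast
  have "(\<lambda>n. a n + b n) \<longlonglongrightarrow> x + y" by (intro tendsto_intros a b)
  then show "x + y \<in> closure S"
    unfolding closure_sequential
    using subspace_add[OF S a(1) b(1)] by (intro exI[of _ "\<lambda>n. a n + b n"]) simp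
qed

text \<open>
  On finite linear combinations of the eigenvectors the lower bound is Pythagoras' theorem, and it
  persists on the closure. A complete subspace has a complete image under a map that is bounded below;
  the image is thus closed, and it contains all eigenvectors.
\<close>

lemma
  fixes B :: "'a::real_inner \<Rightarrow> 'a"
  defines "X e \<equiv> closure (span (range e))"
  assumes e: "orthonormal e" and B: "bounded_linear B" and Be: "\<And>j. B (e j) = \<beta> j *\<^sub>R e j"
    and c: "0 < c" "\<And>j. c \<le> \<bar>\<beta> j\<bar>"
  shows diagonal_operator_lower: "\<And>y. y \<in> X e \<Longrightarrow> c * norm y \<le> norm (B y)"
    and diagonal_operator_surj: "\<And>x. complete (X e) \<Longrightarrow> x \<in> X e \<Longrightarrow> \<exists>y\<in>X e. B y = x"
proof -
  interpret B: bounded_linear B by (rule B)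
  have span: "c * norm y \<le> norm (B y)" if y: "y \<in> span (range e)" for y
  proof -
    obtain F a where F: "finite F" "y = (\<Sum>j\<in>F. a j *\<^sub>R e j)"
      using span_orthonormal_range[OF e y] by blast
    have By: "B y = (\<Sum>j\<in>F. (\<beta> j * a j) *\<^sub>R e j)" by (simp add: F B.sum B.scaleR Be mult.commute)
    have "(c * norm y)\<^sup>2 = (\<Sum>j\<in>F. c\<^sup>2 * (a j)\<^sup>2)"
      unfolding power_mult_distrib power2_norm_eq_inner F(2) inner_orthonormal_sum[OF e F(1)]
      by (simp add: sum_distrib_left power2_eq_square)
    also have "\<dots> \<le> (\<Sum>j\<in>F. (\<beta> j)\<^sup>2 * (a j)\<^sup>2)"
    proof (intro sum_mono mult_right_mono)
      fix j show "c\<^sup>2 \<le> (\<beta> j)\<^sup>2" using c by (simp add: abs_le_square_iff[symmetric])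
    qed simp
    also have "\<dots> = (norm (B y))\<^sup>2"
      unfolding power2_norm_eq_inner By inner_orthonormal_sum[OF e F(1)]
      by (simp add: power2_eq_square mult_ac)
    finally show ?thesis by (rule power2_le_imp_le) simp
  qed
  show lower: "c * norm y \<le> norm (B y)" if "y \<in> X e" for y
  proof -
    have "closed {y. c * norm y \<le> norm (B y)}"
      by (intro closed_Collect_le continuous_intros B.continuous_on)
    then have "closure (span (range e)) \<subseteq> {y. c * norm y \<le> norm (B y)}"
      using span by (intro closure_minimal) auto
    then show ?thesis using that by (auto simp: X_def)
  qed
  show "\<exists>y\<in>X e. B y = x" if compl: "complete (X e)" and x: "x \<in> X e" for x
  proof -
    have sub: "subspace (X e)" unfolding X_def by (intro subspace_closure subspace_span)
    have "complete (B ` X e)"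
      by (rule complete_isometric_image[OF c(1) sub B _ compl]) (use lower in blast)
    then have "closed (B ` X e)" by (rule complete_imp_closed)
    moreover have "span (range e) \<subseteq> B ` X e"
    proof (rule span_minimal)
      show "range e \<subseteq> B ` X e"
      proof
        fix y assume "y \<in> range e"
        then obtain j where j: "y = e j" by auto
        have "\<beta> j \<noteq> 0" using c(1) c(2)[of j] by auto
        then have "B ((1 / \<beta> j) *\<^sub>R e j) = y" by (simp add: B.scaleR Be j)
        moreover have "(1 / \<beta> j) *\<^sub>R e j \<in> X e"
          unfolding X_def by (intro subsetD[OF closure_subset] span_mul span_base) auto
        ultimately show "y \<in> B ` X e" by blast
      qed
      show "subspace (B ` X e)" by (rule linear_subspace_image[OF B.linear sub])
    qed
    ultimately have "X e \<subseteq> B ` X e" unfolding X_def by (intro closure_minimal) auto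
    then show ?thesis using x by auto
  qed
qed

text \<open>
  Rewrite the equation as \<open>\<xi> = G (Q t \<xi>)\<close>, where \<open>G\<close> inverts \<open>B\<close> on \<open>X\<close> and has Lipschitz constant
  \<open>1 / c\<close>. On a ball of small radius \<open>r\<close> and for \<open>\<bar>t\<bar> \<le> r\<close> this is a contraction; it maps the ball to
  itself because \<open>Q t 0\<close> is small for small \<open>t\<close>.
\<close>

lemma small_nonlinear_perturbation:
  fixes B :: "'a::real_normed_vector \<Rightarrow> 'a" and Q :: "real \<Rightarrow> 'a \<Rightarrow> 'a"
  assumes X: "complete X" "subspace X"
    and B: "bounded_linear B" and surj: "\<And>x. x \<in> X \<Longrightarrow> \<exists>y\<in>X. B y = x"
    and c: "0 < c" and low: "\<And>y. y \<in> X \<Longrightarrow> c * norm y \<le> norm (B y)"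
    and Qin: "\<And>t \<xi>. \<xi> \<in> X \<Longrightarrow> Q t \<xi> \<in> X"
    and Qlip: "\<And>t r \<xi> \<eta>. \<bar>t\<bar> \<le> 1 \<Longrightarrow> r \<le> 1 \<Longrightarrow> \<xi> \<in> X \<Longrightarrow> \<eta> \<in> X \<Longrightarrow> norm \<xi> \<le> r \<Longrightarrow> norm \<eta> \<le> r \<Longrightarrow>
        norm (Q t \<xi> - Q t \<eta>) \<le> C * (\<bar>t\<bar> + r) * norm (\<xi> - \<eta>)"
    and Qcont: "\<And>\<xi>. \<xi> \<in> X \<Longrightarrow> norm \<xi> \<le> 1 \<Longrightarrow> continuous_on {-1..1} (\<lambda>t. Q t \<xi>)"
    and Q0: "Q 0 0 = 0" and \<epsilon>: "0 < \<epsilon>"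
  shows "\<exists>\<delta>>0. \<exists>\<xi>. continuous_on {-\<delta><..<\<delta>} \<xi> \<and> \<xi> 0 = 0 \<and>
    (\<forall>t\<in>{-\<delta><..<\<delta>}. \<xi> t \<in> X \<and> norm (\<xi> t) \<le> \<epsilon> \<and> B (\<xi> t) = Q t (\<xi> t))"
proof -
  interpret B: bounded_linear B by (rule B)
  have X0: "0 \<in> X" using X(2) by (rule subspace_0)
  have "\<forall>x\<in>X. \<exists>y. y \<in> X \<and> B y = x" using surj by blast
  from bchoice[OF this] obtain G where G: "\<And>x. x \<in> X \<Longrightarrow> G x \<in> X" "\<And>x. x \<in> X \<Longrightarrow> B (G x) = x" by blast
  have Glip: "norm (G x - G y) \<le> norm (x - y) / c" if "x \<in> X" "y \<in> X" for x y
  proof -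
    have "c * norm (G x - G y) \<le> norm (B (G x - G y))"
      by (intro low subspace_diff[OF X(2)] G that)
    also have "\<dots> = norm (x - y)" by (simp add: B.diff G that)
    finally show ?thesis using c by (simp add: field_simps)
  qed
  have G0: "G 0 = 0"
  proof -
    have "c * norm (G 0) \<le> 0" using low[OF G(1)[OF X0]] G(2)[OF X0] by simp
    then show ?thesis using c by (simp add: mult_le_0_iff)
  qed
  define C' where "C' = max C 1"
  \<comment> \<open>With \<open>\<bar>t\<bar> \<le> r\<close> the Lipschitz constant \<open>C' (\<bar>t\<bar> + r) / c\<close> of the fixed point map is at most 1/2.\<close>
  define r where "r = min \<epsilon> (min 1 (c / (4 * C')))"
  have C': "C' \<ge> C" "C' > 0" by (auto simp: C'_def)
  have r: "0 < r" "r \<le> 1" "r \<le> \<epsilon>" using \<epsilon> c C' by (auto simp: r_def)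
  have rc: "C' * (2 * r) \<le> c / 2"
  proof -
    have "r \<le> c / (4 * C')" by (simp add: r_def)
    then have "r * (4 * C') \<le> c" using C' by (simp add: pos_le_divide_eq)
    then show ?thesis by (simp add: algebra_simps)
  qed
  have "continuous_on {-1..1} (\<lambda>t. Q t 0)" using Qcont X0 by simp
  from this[unfolded continuous_on_iff, rule_format, of 0 "c * r / 2"]
  obtain d where d: "d > 0" "\<And>t. t \<in> {-1..1} \<Longrightarrow> \<bar>t\<bar> < d \<Longrightarrow> norm (Q t 0) < c * r / 2"
    using c r by (auto simp: dist_norm Q0)
  define \<delta> where "\<delta> = min r d"
  have \<delta>: "0 < \<delta>" "\<delta> \<le> 1" "\<delta> \<le> r" "\<delta> \<le> d" using r d by (auto simp: \<delta>_def)
  define S where "S = X \<inter> cball 0 r"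
  define T where "T t \<xi> = G (Q t \<xi>)" for t \<xi>
  have contr: "dist (T t x) (T t y) \<le> 1/2 * dist x y" if "t \<in> {-\<delta><..<\<delta>}" "x \<in> S" "y \<in> S" for t x y
  proof -
    have t: "\<bar>t\<bar> \<le> r" "\<bar>t\<bar> \<le> 1" using that \<delta> by auto
    have xy: "x \<in> X" "y \<in> X" "norm x \<le> r" "norm y \<le> r" using that by (auto simp: S_def)
    have "norm (Q t x - Q t y) \<le> C * (\<bar>t\<bar> + r) * norm (x - y)"
      by (rule Qlip) (use t xy r in auto)
    also have "\<dots> \<le> C' * (2 * r) * norm (x - y)"
      using t C' r by (intro mult_right_mono mult_mono) auto
    also have "\<dots> \<le> c / 2 * norm (x - y)" using rc by (intro mult_right_mono) auto
    finally have "norm (Q t x - Q t y) / c \<le> 1/2 * norm (x - y)" using c by (simp add: field_simps)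
    from order_trans[OF Glip[OF Qin[OF xy(1)] Qin[OF xy(2)]] this] show ?thesis
      by (simp add: T_def dist_norm)
  qed
  have S0: "0 \<in> S" using X0 r by (simp add: S_def)
  have self: "T t x \<in> S" if "t \<in> {-\<delta><..<\<delta>}" "x \<in> S" for t x
  proof -
    have "t \<in> {-1..1}" "\<bar>t\<bar> < d" using that \<delta> by auto
    then have "norm (Q t 0) < c * r / 2" by (rule d(2))
    then have q: "norm (Q t 0) / c \<le> r / 2" using c by (simp add: field_simps)
    have "norm (T t 0) \<le> norm (Q t 0) / c"
      using Glip[OF Qin[OF X0] X0] by (simp add: T_def G0)
    from order_trans[OF this q] have "norm (T t 0) \<le> r / 2" .
    moreover have "norm (T t x - T t 0) \<le> r / 2"
      using contr[OF that(1,2) S0] that(2) by (simp add: dist_norm S_def)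
    ultimately have "norm (T t x) \<le> r"
      using norm_triangle_ineq[of "T t x - T t 0" "T t 0"] by simp
    moreover have "T t x \<in> X" using G Qin that by (simp add: T_def S_def)
    ultimately show ?thesis by (simp add: S_def)
  qed
  have "complete S" unfolding S_def by (intro complete_Int_closed X) simp
  moreover have "continuous_on {-\<delta><..<\<delta>} (\<lambda>t. T t x)" if "x \<in> S" for x
  proof -
    have x: "x \<in> X" "norm x \<le> 1" using that r by (auto simp: S_def)
    have Qc: "continuous_on {-\<delta><..<\<delta>} (\<lambda>t. Q t x)"
      by (rule continuous_on_subset[OF Qcont[OF x]]) (use \<delta> in auto)
    have Gc: "continuous_on X G"
      unfolding continuous_on_iff
    proof (intro ballI allI impI)
      fix a and e :: real assume a: "a \<in> X" "0 < e"
      have "dist (G b) (G a) < e" if "b \<in> X" "dist b a < c * e" for b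
      proof -
        have "dist (G b) (G a) \<le> dist b a / c" using Glip[OF that(1) a(1)] by (simp add: dist_norm)
        also have "\<dots> < e" using that(2) c by (simp add: divide_less_eq mult.commute)
        finally show ?thesis .
      qed
      moreover have "c * e > 0" using a c by simp
      ultimately show "\<exists>d>0. \<forall>b\<in>X. dist b a < d \<longrightarrow> dist (G b) (G a) < e" by blast
    qed
    show ?thesis unfolding T_def
      by (rule continuous_on_compose2[OF Gc Qc]) (use Qin x in auto)
  qed
  ultimately obtain \<xi> where \<xi>: "continuous_on {-\<delta><..<\<delta>} \<xi>" "\<And>t. t \<in> {-\<delta><..<\<delta>} \<Longrightarrow> \<xi> t \<in> S"
    "\<And>t. t \<in> {-\<delta><..<\<delta>} \<Longrightarrow> T t (\<xi> t) = \<xi> t"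
    "\<And>t x. t \<in> {-\<delta><..<\<delta>} \<Longrightarrow> x \<in> S \<Longrightarrow> T t x = x \<Longrightarrow> \<xi> t = x"
    using parametric_contraction[of S "{-\<delta><..<\<delta>}" T] S0 self contr by blast
  show ?thesis
  proof (intro exI[of _ \<delta>] exI[of _ \<xi>] conjI ballI \<delta>(1) \<xi>(1))
    show "\<xi> 0 = 0" by (rule \<xi>(4)) (use \<delta> S0 in \<open>auto simp: T_def Q0 G0\<close>)
    fix t assume t: "t \<in> {-\<delta><..<\<delta>}"
    have "\<xi> t \<in> X" "norm (\<xi> t) \<le> \<epsilon>" using \<xi>(2)[OF t] r by (auto simp: S_def)
    moreover have "B (\<xi> t) = Q t (\<xi> t)"
      using \<xi>(3)[OF t] G(2)[OF Qin[OF \<open>\<xi> t \<in> X\<close>], of t] by (simp add: T_def)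
    ultimately show "\<xi> t \<in> X" "norm (\<xi> t) \<le> \<epsilon>" "B (\<xi> t) = Q t (\<xi> t)" by blast+
  qed
qed

section \<open>Convolution with a rotationally symmetric kernel\<close>

abbreviation zonal_poly :: "'n::finite \<Rightarrow> real poly \<Rightarrow> 'n sphere_L2" where
  "zonal_poly p q \<equiv> L2_of (\<lambda>x. poly q (x $ p))"

abbreviation sphere_gegenbauer_poly :: "'n::finite itself \<Rightarrow> nat \<Rightarrow> real poly" where
  "sphere_gegenbauer_poly N k \<equiv> gegenbauer_poly ((real CARD('n) - 2) / 2) k"

lemma square_integrable_zonal_poly: "square_integrable (\<lambda>x::real^'n::finite. poly q (x $ p))"
  by (intro square_integrable_continuous continuous_intros)

lemma zonal_poly_add: "zonal_poly p (q + r) = zonal_poly p q + zonal_poly p r"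
  by (simp add: L2_of_add square_integrable_zonal_poly)

lemma zonal_poly_smult: "zonal_poly p (smult c q) = c *\<^sub>R zonal_poly p q"
  by (simp add: L2_of_scaleR square_integrable_zonal_poly)

lemma inner_zonal_poly:
  "zonal_poly p q \<bullet> zonal_poly p r = sphere_mean (\<lambda>x::real^'n::finite. poly (q * r) (x $ p))"
  by (simp add: inner_L2_of square_integrable_zonal_poly)

lemma norm_zonal_poly_pos:
  fixes p :: "'n::finite"
  assumes "3 \<le> CARD('n)" "q \<noteq> 0"
  shows "norm (zonal_poly p q) > 0"
proof -
  have "zonal_poly p q \<noteq> 0"
  proof
    assume "zonal_poly p q = 0"
    then have "sphere_mean (\<lambda>x::real^'n. (poly q (x $ p))\<^sup>2) = 0"
      using norm_L2_of_power2[OF square_integrable_zonal_poly, of q p] by simp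
    then show False using sphere_mean_poly_square_eq_0[OF assms(1)] assms(2) by blast
  qed
  then show ?thesis by simp
qed

lemma gegenbauer_poly_nonzero:
  assumes "3 \<le> CARD('n::finite)" shows "sphere_gegenbauer_poly TYPE('n) k \<noteq> 0"
proof -
  have "(real CARD('n) - 2) / 2 > 0" using assms by simp
  then have "coeff (sphere_gegenbauer_poly TYPE('n) k) k > 0" by (rule coeff_gegenbauer_poly_pos)
  then show ?thesis by auto
qed

definition zonal_coeff :: "'n::finite \<Rightarrow> nat \<Rightarrow> real" where
  "zonal_coeff p k = 1 / norm (zonal_poly p (sphere_gegenbauer_poly TYPE('n) k))"

lemma zonal_harmonic_eq:
  fixes p :: "'n::finite"
  assumes dim: "3 \<le> CARD('n)"
  shows "zonal_harmonic p k = zonal_coeff p k *\<^sub>R zonal_poly p (sphere_gegenbauer_poly TYPE('n) k)"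
    and "zonal_coeff p k > 0"
proof -
  let ?g = "zonal_poly p (sphere_gegenbauer_poly TYPE('n) k)"
  have g: "L2_of (\<lambda>x. sphere_gegenbauer TYPE('n) k (x $ p)) = ?g"
    by (simp add: sphere_gegenbauer_def poly_gegenbauer_poly)
  have pos: "norm ?g > 0" by (rule norm_zonal_poly_pos[OF dim gegenbauer_poly_nonzero[OF dim]])
  have "(THE A. 0 < A \<and> norm (A *\<^sub>R ?g) = 1) = 1 / norm ?g"
    by (rule the_equality) (use pos in \<open>auto simp: field_simps\<close>)
  then show "zonal_harmonic p k = zonal_coeff p k *\<^sub>R ?g"
    unfolding zonal_harmonic_def Let_def g zonal_coeff_def by simp
  show "zonal_coeff p k > 0" using pos by (simp add: zonal_coeff_def)
qed

lemma orthonormal_zonal_harmonic: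
  fixes p :: "'n::finite"
  assumes dim: "3 \<le> CARD('n)"
  shows "orthonormal (zonal_harmonic p)"
  unfolding orthonormal_def
proof (intro allI)
  fix i j
  let ?C = "sphere_gegenbauer_poly TYPE('n)"
  have z: "zonal_poly p (?C i) \<bullet> zonal_poly p (?C j) = 0" if "i < j" for i j
    unfolding inner_zonal_poly
    by (rule sphere_mean_gegenbauer_orthogonal[OF dim le_less_trans[OF degree_gegenbauer_poly that]])
  show "zonal_harmonic p i \<bullet> zonal_harmonic p j = (if i = j then 1 else 0)"
  proof (cases "i = j")
    case True
    have "norm (zonal_poly p (?C i)) > 0"
      by (rule norm_zonal_poly_pos[OF dim gegenbauer_poly_nonzero[OF dim]])
    then show ?thesis using True
      by (simp add: zonal_harmonic_eq[OF dim] zonal_coeff_def power2_norm_eq_inner[symmetric] power2_eq_square)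
  next
    case False
    then consider "i < j" | "j < i" by linarith
    then show ?thesis
      using z[of i j] z[of j i] by cases (simp_all add: zonal_harmonic_eq[OF dim] inner_commute)
  qed
qed

lemma zonal_harmonic_0:
  fixes p :: "'n::finite"
  assumes dim: "3 \<le> CARD('n)"
  shows "zonal_harmonic p 0 = L2_of (\<lambda>_. 1)"
  by (simp add: zonal_harmonic_eq[OF dim] zonal_coeff_def norm_L2_one)

text \<open>
  Subtracting a multiple of the Gegenbauer polynomial of the same degree lowers the degree.
\<close>

lemma zonal_poly_in_span:
  fixes p :: "'n::finite"
  assumes dim: "3 \<le> CARD('n)"
  shows "zonal_poly p q \<in> span (range (zonal_harmonic p))"
proof (induction "degree q" arbitrary: q rule: less_induct)
  case less
  let ?C = "sphere_gegenbauer_poly TYPE('n)" and ?d = "degree q"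
  let ?V = "span (range (zonal_harmonic p))"
  have l: "(real CARD('n) - 2) / 2 > 0" using dim by simp
  have C: "zonal_poly p (?C k) \<in> ?V" for k
  proof -
    have "zonal_poly p (?C k) = (1 / zonal_coeff p k) *\<^sub>R zonal_harmonic p k"
      using zonal_harmonic_eq(2)[OF dim, of p k] by (simp add: zonal_harmonic_eq(1)[OF dim])
    then show ?thesis by (simp add: span_mul span_base)
  qed
  define c where "c = lead_coeff q / coeff (?C ?d) ?d"
  define r where "r = q - smult c (?C ?d)"
  have Cd: "coeff (?C ?d) ?d > 0" by (rule coeff_gegenbauer_poly_pos[OF l])
  have q: "q = r + smult c (?C ?d)" by (simp add: r_def)
  have r: "zonal_poly p r \<in> ?V"
  proof (cases "r = 0")
    case True
    then have "zonal_poly p r = 0 *\<^sub>R zonal_poly p (?C 0)" by (simp only: zonal_poly_smult[symmetric]) simp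
    then show ?thesis by (simp add: span_zero)
  next
    case False
    have "degree r \<le> ?d" unfolding r_def
      using degree_gegenbauer_poly by (intro degree_diff_le order_trans[OF degree_smult_le]) auto
    moreover have "coeff r ?d = 0" using Cd by (simp add: r_def c_def)
    ultimately have "degree r < ?d" using False by (metis le_neq_implies_less leading_coeff_0_iff)
    then show ?thesis by (rule less)
  qed
  have "zonal_poly p q = zonal_poly p r + c *\<^sub>R zonal_poly p (?C ?d)"
    by (subst q) (simp only: zonal_poly_add zonal_poly_smult)
  then show ?case using span_add[OF r span_mul[OF C]] by simp
qed

text \<open>
  By the Weierstrass theorem a continuous function of the coordinate is a uniform limit of polynomials
  in it, and these are combinations of zonal harmonics.
\<close>

lemma zonal_continuous_in_symmetric_L2:
  fixes p :: "'n::finite"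
  assumes dim: "3 \<le> CARD('n)" and f: "continuous_on {-1..1} f"
  shows "L2_of (\<lambda>x. f (x $ p)) \<in> symmetric_L2 p"
  unfolding symmetric_L2_def closure_approachable
proof (intro allI impI)
  fix e :: real assume e: "0 < e"
  obtain g where g: "real_polynomial_function g" "\<And>t. t \<in> {-1..1} \<Longrightarrow> \<bar>f t - g t\<bar> < e / 2"
    using Stone_Weierstrass_real_polynomial_function[OF _ f, of "e / 2"] e by auto
  then obtain b n where gb: "g = (\<lambda>t. \<Sum>i\<le>n. b i * t ^ i)"
    using real_polynomial_function_iff_sum by blast
  define q where "q = (\<Sum>i\<le>n. monom (b i) i)"
  have q: "g t = poly q t" for t by (simp add: gb q_def poly_sum poly_monom)
  have fc: "continuous_on (sphere 0 1) (\<lambda>x::real^'n. f (x $ p))"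
    by (rule continuous_on_sphere_component[OF f])
  have "norm (zonal_poly p q - L2_of (\<lambda>x. f (x $ p))) = norm (L2_of (\<lambda>x. poly q (x $ p) - f (x $ p)))"
    by (subst L2_of_diff[OF square_integrable_zonal_poly square_integrable_continuous[OF fc]]) simp
  also have "\<dots> \<le> e / 2"
  proof (rule norm_L2_of_le)
    show "(\<lambda>x. poly q (x $ p) - f (x $ p)) \<in> borel_measurable sphere_measure"
      by (intro sphere_continuous_measurable continuous_intros fc)
    fix x :: "real^'n" assume "x \<in> sphere 0 1"
    from g(2)[OF sphere_component_range[OF this, of p]] show "\<bar>poly q (x $ p) - f (x $ p)\<bar> \<le> e / 2"
      unfolding q by (simp add: abs_minus_commute)
  qed
  finally have "dist (zonal_poly p q) (L2_of (\<lambda>x. f (x $ p))) < e"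
    using e by (simp add: dist_norm)
  then show "\<exists>y\<in>span (range (zonal_harmonic p)). dist y (L2_of (\<lambda>x. f (x $ p))) < e"
    using zonal_poly_in_span[OF dim] by blast
qed

lemma subspace_symmetric_L2: "subspace (symmetric_L2 p)"
  unfolding symmetric_L2_def by (intro subspace_closure subspace_span)

lemma complete_symmetric_L2: "complete (symmetric_L2 p)"
  using complete_Int_closed[OF complete_sphere_L2, of "symmetric_L2 p"]
  by (simp add: symmetric_L2_def)

text \<open>
  The coordinate \<open>p\<close> is the axis of symmetry of the solutions, not a property of the kernel.
\<close>

locale rotational_kernel =
  fixes W :: "real^'n::finite \<Rightarrow> real^'n \<Rightarrow> real" and w :: "real \<Rightarrow> real" and p :: 'n
  assumes dim: "3 \<le> CARD('n)"
    and cont: "continuous_on (sphere 0 1 \<times> sphere 0 1) (\<lambda>(x, y). W x y)"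
    and rot: "rotationally_symmetric W w"
begin

definition \<omega> where "\<omega> = sphere_area TYPE('n)"

lemma \<omega>_pos: "\<omega> > 0" by (simp add: \<omega>_def sphere_area_pos)

definition W_max where "W_max = (SOME B. B > 0 \<and> (\<forall>x\<in>sphere 0 1. \<forall>y\<in>sphere 0 1. \<bar>W x y\<bar> \<le> B))"

lemma W_max: "W_max > 0" "\<And>x y. x \<in> sphere 0 1 \<Longrightarrow> y \<in> sphere 0 1 \<Longrightarrow> \<bar>W x y\<bar> \<le> W_max"
proof -
  have "bounded ((\<lambda>(x, y). W x y) ` (sphere 0 1 \<times> sphere 0 1))"
    by (intro compact_imp_bounded compact_continuous_image cont compact_Times) auto
  then have "\<exists>B>0. \<forall>z\<in>(\<lambda>(x, y). W x y) ` (sphere 0 1 \<times> sphere 0 1). norm z \<le> B"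
    by (simp only: bounded_pos)
  then have "\<exists>B. B > 0 \<and> (\<forall>x\<in>sphere 0 1. \<forall>y\<in>sphere 0 1. \<bar>W x y\<bar> \<le> B)" by force
  from someI_ex[OF this] show "W_max > 0" "\<And>x y. x \<in> sphere 0 1 \<Longrightarrow> y \<in> sphere 0 1 \<Longrightarrow> \<bar>W x y\<bar> \<le> W_max"
    unfolding W_max_def by blast+
qed

lemma kernel_profile: "x \<in> sphere 0 1 \<Longrightarrow> y \<in> sphere 0 1 \<Longrightarrow> W x y = w (x \<bullet> y)"
  using rot by (simp add: rotationally_symmetric_def)

lemma kernel_profile_continuous: "continuous_on {-1..1} w"
proof -
  obtain q where q: "q \<noteq> p" using ex_other_index[of p] dim by auto
  let ?y = "\<lambda>t. t *\<^sub>R axis p 1 + sqrt (1 - t\<^sup>2) *\<^sub>R axis q 1 :: real^'n"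
  have nonneg: "0 \<le> 1 - t\<^sup>2" if "t \<in> {-1..1}" for t :: real
    using that by (auto simp: abs_square_le_1)
  have y: "?y t \<in> sphere 0 1" "axis p 1 \<bullet> ?y t = t" if "t \<in> {-1..1}" for t
  proof -
    have "?y t \<bullet> ?y t = 1"
      using q nonneg[OF that] by (simp add: inner_add_left inner_add_right inner_axis_axis power2_eq_square[symmetric])
    then show "?y t \<in> sphere 0 1" by (simp add: norm_eq_sqrt_inner)
    show "axis p 1 \<bullet> ?y t = t" using q by (simp add: inner_add_right inner_axis_axis)
  qed
  have "continuous_on {-1..1} (\<lambda>t. (\<lambda>(x, y). W x y) (axis p 1, ?y t))"
    by (rule continuous_on_compose2[OF cont])
      (use y(1) in \<open>auto intro!: continuous_intros\<close>)
  then have "continuous_on {-1..1} (\<lambda>t. W (axis p 1) (?y t))" by simp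
  then show ?thesis
    by (rule continuous_on_eq) (use y kernel_profile in auto)
qed

lemma kernel_section: "x \<in> sphere 0 1 \<Longrightarrow> W x \<in> borel_measurable sphere_measure"
  using measurable_Pair2[OF kernel_measurable[OF cont], of x] by simp

lemma kernel_section_sq: "x \<in> sphere 0 1 \<Longrightarrow> square_integrable (W x)"
  by (rule square_integrable_bounded[OF kernel_section W_max(2)])

text \<open>
  Convolution with respect to the normalised surface measure, written as an inner product so that it is
  linear and bounded in \<open>u\<close> at every single point \<open>x\<close>.
\<close>

definition conv :: "'n sphere_L2 \<Rightarrow> real^'n \<Rightarrow> real" where
  "conv u x = L2_of (W x) \<bullet> u"

lemma conv_eq_mean:
  assumes x: "x \<in> sphere 0 1" and f: "square_integrable f"
  shows "conv (L2_of f) x = sphere_mean (\<lambda>y. W x y * f y)"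
  unfolding conv_def by (rule inner_L2_of[OF kernel_section_sq[OF x] f])

lemma sphere_conv_eq: "x \<in> sphere 0 1 \<Longrightarrow> sphere_conv W u x = \<omega> * conv u x"
  using conv_eq_mean[OF _ square_integrable_rep, of x u]
  by (simp add: sphere_conv_def L2_of_rep integral_eq_sphere_mean \<omega>_def)

lemma conv_add: "conv (u + v) x = conv u x + conv v x"
  and conv_diff: "conv (u - v) x = conv u x - conv v x"
  and conv_scaleR: "conv (c *\<^sub>R u) x = c * conv u x"
  by (simp_all add: conv_def inner_add_right inner_diff_right)

lemma conv_bound: "x \<in> sphere 0 1 \<Longrightarrow> \<bar>conv u x\<bar> \<le> W_max * norm u"
  unfolding conv_def
  by (rule order_trans[OF Cauchy_Schwarz_ineq2])
    (intro mult_right_mono norm_L2_of_le kernel_section W_max norm_ge_zero)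

lemma conv_measurable: "conv u \<in> borel_measurable sphere_measure"
proof -
  interpret finite_measure "sphere_measure :: (real^'n) measure"
    by (rule finite_measure_sphere_measure)
  have f: "rep_sphere_L2 u \<in> borel_measurable sphere_measure"
    using square_integrable_rep[of u] by (simp add: square_integrable_def)
  note W = kernel_measurable[OF cont]
  have "sphere_conv W u \<in> borel_measurable sphere_measure"
    unfolding sphere_conv_def
    by (rule borel_measurable_lebesgue_integral) (use W f in measurable)
  then have "(\<lambda>x. sphere_conv W u x / \<omega>) \<in> borel_measurable sphere_measure" by simp
  moreover have "sphere_conv W u x / \<omega> = conv u x" if "x \<in> space sphere_measure" for x
    using sphere_conv_eq[of x u] that \<omega>_pos by simp
  ultimately show ?thesis by (subst measurable_cong[of _ _ "\<lambda>x. sphere_conv W u x / \<omega>"]) auto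
qed

lemma conv_zonal_harmonic:
  assumes x: "x \<in> sphere 0 1"
  shows "conv (zonal_harmonic p k) x
    = spherical_component TYPE('n) w k * (zonal_coeff p k * poly (sphere_gegenbauer_poly TYPE('n) k) (x $ p))"
proof -
  have "conv (zonal_poly p (sphere_gegenbauer_poly TYPE('n) k)) x
      = sphere_mean (\<lambda>y. w (x \<bullet> y) * sphere_gegenbauer TYPE('n) k (y $ p))"
    unfolding conv_eq_mean[OF x square_integrable_zonal_poly]
    by (rule sphere_mean_cong) (simp only: kernel_profile[OF x] sphere_gegenbauer_def poly_gegenbauer_poly)
  also have "\<dots> = spherical_component TYPE('n) w k * sphere_gegenbauer TYPE('n) k (x $ p)"
    by (rule Funk_Hecke_zonal[OF dim kernel_profile_continuous x])
  finally show ?thesis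
    by (simp add: zonal_harmonic_eq[OF dim] conv_scaleR sphere_gegenbauer_def poly_gegenbauer_poly)
qed

lemma conv_one: "x \<in> sphere 0 1 \<Longrightarrow> conv (L2_of (\<lambda>_. 1)) x = spherical_component TYPE('n) w 0"
  using conv_zonal_harmonic[of x 0] by (simp add: zonal_harmonic_0[OF dim] zonal_coeff_def norm_L2_one)

lemma superposition_sq:
  assumes \<psi>: "continuous_on UNIV \<psi>"
  shows "square_integrable (\<lambda>x. \<psi> (conv u x))"
proof -
  have "bounded (\<psi> ` {- (W_max * norm u)..W_max * norm u})"
    by (intro compact_imp_bounded compact_continuous_image continuous_on_subset[OF \<psi>]) auto
  then obtain M where M: "\<And>s. s \<in> {- (W_max * norm u)..W_max * norm u} \<Longrightarrow> \<bar>\<psi> s\<bar> \<le> M"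
    by (force simp: bounded_iff)
  show ?thesis
  proof (rule square_integrable_bounded)
    show "(\<lambda>x. \<psi> (conv u x)) \<in> borel_measurable sphere_measure"
      by (rule measurable_compose[OF conv_measurable borel_measurable_continuous_onI[OF \<psi>]])
    show "\<bar>\<psi> (conv u x)\<bar> \<le> M" if "x \<in> sphere 0 1" for x
      using conv_bound[OF that, of u] by (intro M) (auto simp: abs_le_iff)
  qed
qed

lemma conv_span:
  assumes "v \<in> span (range (zonal_harmonic p))"
  shows "\<exists>q. \<forall>x\<in>sphere 0 1. conv v x = poly q (x $ p)"
proof -
  let ?P = "{v. \<exists>q. \<forall>x\<in>sphere 0 1. conv v x = poly q (x $ p)}"
  have "subspace ?P"
  proof (rule subspaceI)
    show "0 \<in> ?P" by (auto simp: conv_def intro!: exI[of _ 0])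
    fix u v assume "u \<in> ?P" "v \<in> ?P"
    then obtain q r where "\<forall>x\<in>sphere 0 1. conv u x = poly q (x $ p)" "\<forall>x\<in>sphere 0 1. conv v x = poly r (x $ p)"
      by blast
    then show "u + v \<in> ?P" by (auto simp: conv_add intro!: exI[of _ "q + r"])
  next
    fix c u assume "u \<in> ?P"
    then obtain q where "\<forall>x\<in>sphere 0 1. conv u x = poly q (x $ p)" by blast
    then show "c *\<^sub>R u \<in> ?P" by (auto simp: conv_scaleR intro!: exI[of _ "smult c q"])
  qed
  moreover have "range (zonal_harmonic p) \<subseteq> ?P"
  proof
    fix v assume "v \<in> range (zonal_harmonic p)"
    then obtain k where "v = zonal_harmonic p k" by auto
    then show "v \<in> ?P"
      using conv_zonal_harmonic[of _ k]
      by (auto intro!: exI[of _ "smult (spherical_component TYPE('n) w k * zonal_coeff p k) (sphere_gegenbauer_poly TYPE('n) k)"])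
  qed
  ultimately show ?thesis using span_minimal[of "range (zonal_harmonic p)" ?P] assms by blast
qed

text \<open>
  For a finite combination of zonal harmonics the convolution is a polynomial in \<open>x $ p\<close>, so the
  superposition is a continuous function of \<open>x $ p\<close>. The general case follows by approximation: closeness
  in the norm makes the convolutions uniformly close, and \<open>\<psi>\<close> is uniformly continuous on bounded sets.
\<close>

lemma superposition_symmetric:
  assumes \<psi>: "continuous_on UNIV \<psi>" and u: "u \<in> symmetric_L2 p"
  shows "L2_of (\<lambda>x. \<psi> (conv u x)) \<in> symmetric_L2 p"
proof -
  have "L2_of (\<lambda>x. \<psi> (conv u x)) \<in> closure (symmetric_L2 p)"
    unfolding closure_approachable
  proof (intro allI impI)
    fix e :: real assume e: "0 < e"
    define R where "R = W_max * (norm u + 1)"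
    have "uniformly_continuous_on {-R..R} \<psi>"
      by (intro compact_uniformly_continuous continuous_on_subset[OF \<psi>]) auto
    then obtain d where d: "d > 0" "\<And>s s'. s \<in> {-R..R} \<Longrightarrow> s' \<in> {-R..R} \<Longrightarrow> \<bar>s' - s\<bar> < d \<Longrightarrow> \<bar>\<psi> s' - \<psi> s\<bar> < e / 2"
      unfolding uniformly_continuous_on_def dist_real_def using e by (meson half_gt_zero)
    have "min 1 (d / W_max) > 0" using d W_max by simp
    then obtain v where v: "v \<in> span (range (zonal_harmonic p))" "dist v u < min 1 (d / W_max)"
      using u unfolding symmetric_L2_def closure_approachable by blast
    then have vu: "norm (v - u) < 1" "W_max * norm (v - u) < d"
      using W_max by (auto simp: dist_norm pos_less_divide_eq mult.commute)
    have "norm v \<le> norm u + 1" using norm_triangle_ineq[of "v - u" u] vu by simp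
    then have vR: "W_max * norm v \<le> R" "W_max * norm u \<le> R" using W_max by (auto simp: R_def)
    have inR: "conv v x \<in> {-R..R}" "conv u x \<in> {-R..R}" if "x \<in> sphere 0 1" for x
      using conv_bound[OF that, of v] conv_bound[OF that, of u] vR by (auto simp: abs_le_iff)
    have "norm (L2_of (\<lambda>x. \<psi> (conv v x)) - L2_of (\<lambda>x. \<psi> (conv u x))) = norm (L2_of (\<lambda>x. \<psi> (conv v x) - \<psi> (conv u x)))"
      by (simp add: L2_of_diff superposition_sq[OF \<psi>])
    also have "\<dots> \<le> e / 2"
    proof (rule norm_L2_of_le)
      show "(\<lambda>x. \<psi> (conv v x) - \<psi> (conv u x)) \<in> borel_measurable sphere_measure"
        using superposition_sq[OF \<psi>, of u] superposition_sq[OF \<psi>, of v]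
        by (auto simp: square_integrable_def)
      fix x :: "real^'n" assume x: "x \<in> sphere 0 1"
      have "\<bar>conv v x - conv u x\<bar> < d"
        using conv_bound[OF x, of "v - u"] vu(2) by (simp add: conv_diff)
      then show "\<bar>\<psi> (conv v x) - \<psi> (conv u x)\<bar> \<le> e / 2"
        using d(2)[OF inR(2)[OF x] inR(1)[OF x]] by simp
    qed
    finally have "dist (L2_of (\<lambda>x. \<psi> (conv v x))) (L2_of (\<lambda>x. \<psi> (conv u x))) < e"
      using e by (simp add: dist_norm)
    moreover have "L2_of (\<lambda>x. \<psi> (conv v x)) \<in> symmetric_L2 p"
    proof -
      obtain q where "\<forall>x\<in>sphere 0 1. conv v x = poly q (x $ p)" using conv_span[OF v(1)] by blast
      then have "L2_of (\<lambda>x. \<psi> (conv v x)) = L2_of (\<lambda>x. \<psi> (poly q (x $ p)))"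
        by (intro L2_of_cong) simp
      moreover have "continuous_on {-1..1} (\<lambda>t. \<psi> (poly q t))"
        by (rule continuous_on_compose2[OF \<psi>]) (auto intro!: continuous_intros)
      ultimately show ?thesis using zonal_continuous_in_symmetric_L2[OF dim] by simp
    qed
    ultimately show "\<exists>y\<in>symmetric_L2 p. dist y (L2_of (\<lambda>x. \<psi> (conv u x))) < e" by blast
  qed
  then show ?thesis by (simp add: symmetric_L2_def)
qed

end

section \<open>The Gibbs equation after division by the amplitude\<close>

text \<open>
  The difference quotient \<open>(exp (t s) - 1) / t\<close>, continued by its limit \<open>s\<close> at \<open>t = 0\<close>. It allows the
  nonlinearity to be divided by the amplitude \<open>t\<close>.
\<close>

definition exp_quotient :: "real \<Rightarrow> real \<Rightarrow> real" where
  "exp_quotient t s = (if t = 0 then s else (exp (t * s) - 1) / t)"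

lemma exp_quotient_0 [simp]: "exp_quotient 0 s = s" "exp_quotient t 0 = 0"
  by (simp_all add: exp_quotient_def)

lemma exp_quotient_mult: "t * exp_quotient t s = exp (t * s) - 1"
  by (simp add: exp_quotient_def)

lemma exp_quotient_deriv: "(exp_quotient t has_real_derivative exp (t * s)) (at s within S)"
proof (cases "t = 0")
  case True
  then have "exp_quotient t = (\<lambda>s. s)" by (simp add: fun_eq_iff)
  then show ?thesis using True by simp
next
  case False
  then have "exp_quotient t = (\<lambda>s. (exp (t * s) - 1) / t)" by (simp add: exp_quotient_def fun_eq_iff)
  then show ?thesis using False by (auto intro!: derivative_eq_intros)
qed

lemma exp_quotient_continuous: "continuous_on S (exp_quotient t)"
  using exp_quotient_deriv by (rule DERIV_continuous_on)

text \<open>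
  One inequality serves two purposes: for \<open>t' = 0\<close> it is the Lipschitz bound of order \<open>\<bar>t\<bar>\<close> for the
  nonlinear part \<open>exp_quotient t s - s\<close>, and for \<open>s' = 0\<close> it is continuity in \<open>t\<close>. It is the mean value
  theorem, applied first to the difference as a function of \<open>s\<close>, whose derivative is
  \<open>exp (t s) - exp (t' s)\<close>, and then to the exponential function.
\<close>

lemma exp_quotient_lipschitz:
  assumes t: "\<bar>t\<bar> \<le> 1" "\<bar>t'\<bar> \<le> 1" and s: "\<bar>s\<bar> \<le> M" "\<bar>s'\<bar> \<le> M"
  shows "\<bar>(exp_quotient t s - exp_quotient t' s) - (exp_quotient t s' - exp_quotient t' s')\<bar>
    \<le> M * exp M * \<bar>t - t'\<bar> * \<bar>s - s'\<bar>"
proof -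
  have M: "M \<ge> 0" using s by linarith
  have E: "\<bar>exp (t * x) - exp (t' * x)\<bar> \<le> M * exp M * \<bar>t - t'\<bar>" if x: "\<bar>x\<bar> \<le> M" for x
  proof -
    have in1: "\<bar>a * x\<bar> \<le> M" if "\<bar>a\<bar> \<le> 1" for a
      using mult_mono[OF that x] M by (simp add: abs_mult)
    have "norm (exp (t * x) - exp (t' * x)) \<le> exp M * norm (t * x - t' * x)"
    proof (rule field_differentiable_bound[of "{-M..M}"])
      show "(exp has_field_derivative exp z) (at z within {-M..M})" for z :: real
        by (auto intro!: derivative_eq_intros)
    qed (use in1[OF t(1)] in1[OF t(2)] in auto)
    also have "norm (t * x - t' * x) = \<bar>t - t'\<bar> * \<bar>x\<bar>"
      by (simp add: left_diff_distrib[symmetric] abs_mult)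
    also have "exp M * (\<bar>t - t'\<bar> * \<bar>x\<bar>) \<le> exp M * (\<bar>t - t'\<bar> * M)"
      using x by (intro mult_left_mono) auto
    finally show ?thesis by (simp add: mult_ac)
  qed
  have "norm ((exp_quotient t s - exp_quotient t' s) - (exp_quotient t s' - exp_quotient t' s'))
      \<le> (M * exp M * \<bar>t - t'\<bar>) * norm (s - s')"
  proof (rule field_differentiable_bound[of "{-M..M}"])
    show "((\<lambda>s. exp_quotient t s - exp_quotient t' s) has_field_derivative exp (t * z) - exp (t' * z)) (at z within {-M..M})" for z
      by (intro DERIV_diff exp_quotient_deriv)
    show "norm (exp (t * z) - exp (t' * z)) \<le> M * exp M * \<bar>t - t'\<bar>" if "z \<in> {-M..M}" for z
      using E[of z] that by auto
  qed (use s in auto)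
  then show ?thesis by simp
qed

lemma norm_scaleR_diff_le:
  "norm (\<alpha> *\<^sub>R x - \<beta> *\<^sub>R y) \<le> \<bar>\<alpha> - \<beta>\<bar> * norm x + \<bar>\<beta>\<bar> * norm (x - y)"
  for x y :: "'a::real_normed_vector"
proof -
  have "\<alpha> *\<^sub>R x - \<beta> *\<^sub>R y = (\<alpha> - \<beta>) *\<^sub>R x + \<beta> *\<^sub>R (x - y)" by (simp add: algebra_simps)
  then show ?thesis using norm_triangle_ineq[of "(\<alpha> - \<beta>) *\<^sub>R x" "\<beta> *\<^sub>R (x - y)"] by simp
qed

abbreviation L2_one :: "'n::finite sphere_L2" where "L2_one \<equiv> L2_of (\<lambda>_. 1)"

definition centred :: "'n::finite sphere_L2 \<Rightarrow> 'n sphere_L2" where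
  "centred v = v - (v \<bullet> L2_one) *\<^sub>R L2_one"

lemma inner_one_le: "\<bar>v \<bullet> L2_one\<bar> \<le> norm v"
  using Cauchy_Schwarz_ineq2[of v L2_one] by (simp add: norm_L2_one)

lemma norm_centred_le: "norm (centred v) \<le> 2 * norm v"
  using norm_triangle_ineq4[of v "(v \<bullet> L2_one) *\<^sub>R L2_one"] inner_one_le[of v]
  by (simp add: centred_def norm_L2_one)

lemma bounded_linear_centred: "bounded_linear centred"
proof (rule bounded_linear_intro[where K=2])
  show "centred (x + y) = centred x + centred y" for x y :: "'a sphere_L2"
    by (simp add: centred_def inner_add_left algebra_simps)
  show "centred (r *\<^sub>R x) = r *\<^sub>R centred x" for r and x :: "'a sphere_L2"
    by (simp add: centred_def algebra_simps)
  show "norm (centred x) \<le> norm x * 2" for x :: "'a sphere_L2"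
    using norm_centred_le[of x] by simp
qed

context rotational_kernel
begin

abbreviation "Y \<equiv> zonal_harmonic p"
abbreviation "X \<equiv> symmetric_L2 p"

lemma harmonic_in_X: "Y k \<in> X"
  unfolding symmetric_L2_def by (intro subsetD[OF closure_subset] span_base) simp

lemma one_in_X: "L2_one \<in> X"
  using harmonic_in_X[of 0] by (simp add: zonal_harmonic_0[OF dim])

lemma inner_harmonic: "Y i \<bullet> Y j = (if i = j then 1 else 0)"
  using orthonormal_zonal_harmonic[OF dim, of p] by (simp add: orthonormal_def)

lemma norm_harmonic [simp]: "norm (Y k) = 1"
  by (simp add: norm_eq_sqrt_inner inner_harmonic)

lemma harmonic_inner_one: "Y k \<bullet> L2_one = (if k = 0 then 1 else 0)"
  using inner_harmonic[of k 0] by (simp add: zonal_harmonic_0[OF dim])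

lemma centred_in_X: "v \<in> X \<Longrightarrow> centred v \<in> X"
  unfolding centred_def by (intro subspace_diff subspace_scale subspace_symmetric_L2 one_in_X)

lemma conv_sq: "square_integrable (conv u)"
  using superposition_sq[OF continuous_on_id, of u] by simp

text \<open>
  The derivative of the Gibbs map at \<open>0\<close> is the identity plus \<open>\<gamma>\<close> times this operator.
\<close>

definition centred_conv :: "'n sphere_L2 \<Rightarrow> 'n sphere_L2" where
  "centred_conv u = centred (L2_of (conv u))"

lemma bounded_linear_L2_of_conv: "bounded_linear (\<lambda>u. L2_of (conv u))"
proof (rule bounded_linear_intro[where K=W_max])
  show "L2_of (conv (u + v)) = L2_of (conv u) + L2_of (conv v)" for u v
    unfolding L2_of_add[OF conv_sq conv_sq] by (rule L2_of_cong) (rule conv_add)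
  show "L2_of (conv (c *\<^sub>R u)) = c *\<^sub>R L2_of (conv u)" for c u
    unfolding L2_of_scaleR[OF conv_sq] by (rule L2_of_cong) (rule conv_scaleR)
  show "norm (L2_of (conv u)) \<le> norm u * W_max" for u
    using norm_L2_of_le[OF conv_measurable conv_bound, of u] by (simp add: mult.commute)
qed

lemma bounded_linear_centred_conv: "bounded_linear centred_conv"
  unfolding centred_conv_def by (rule bounded_linear_compose[OF bounded_linear_centred bounded_linear_L2_of_conv])

lemma norm_centred_conv_le: "norm (centred_conv u) \<le> 2 * W_max * norm u"
  using norm_centred_le[of "L2_of (conv u)"] norm_L2_of_le[OF conv_measurable conv_bound, of u]
  unfolding centred_conv_def by simp

lemma centred_conv_in_X: "u \<in> X \<Longrightarrow> centred_conv u \<in> X"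
  unfolding centred_conv_def using superposition_symmetric[OF continuous_on_id, of u] by (intro centred_in_X) simp

lemma L2_of_conv_harmonic: "L2_of (conv (Y k)) = spherical_component TYPE('n) w k *\<^sub>R Y k"
proof -
  have "L2_of (conv (Y k)) = L2_of (\<lambda>x. poly (smult (spherical_component TYPE('n) w k * zonal_coeff p k) (sphere_gegenbauer_poly TYPE('n) k)) (x $ p))"
    by (rule L2_of_cong) (simp only: conv_zonal_harmonic poly_smult mult.assoc)
  then show ?thesis by (simp only: zonal_poly_smult zonal_harmonic_eq[OF dim] scaleR_scaleR)
qed

lemma centred_conv_harmonic: "centred_conv (Y k) = (if k = 0 then 0 else spherical_component TYPE('n) w k) *\<^sub>R Y k"
  by (simp add: centred_conv_def L2_of_conv_harmonic centred_def harmonic_inner_one zonal_harmonic_0[OF dim])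

text \<open>
  At every point \<open>x\<close> the values of the convolutions of the \<open>Y j\<close> are the Fourier coefficients of the
  section \<open>W x\<close>. Bessel's inequality bounds the sum of their squares, and taking the mean over \<open>x\<close> turns
  these squares into the squared components.
\<close>

lemma sum_component_squares_le:
  assumes F: "finite F"
  shows "(\<Sum>j\<in>F. (spherical_component TYPE('n) w j)\<^sup>2) \<le> W_max\<^sup>2"
proof -
  have int: "integrable sphere_measure (\<lambda>x. (conv u x)\<^sup>2)" for u
    using conv_sq[of u] by (simp add: square_integrable_def)
  have "(spherical_component TYPE('n) w j)\<^sup>2 = sphere_mean (\<lambda>x. (conv (Y j) x)\<^sup>2)" for j
    unfolding norm_L2_of_power2[OF conv_sq, symmetric] L2_of_conv_harmonic by simp
  then have "(\<Sum>j\<in>F. (spherical_component TYPE('n) w j)\<^sup>2) = sphere_mean (\<lambda>x. \<Sum>j\<in>F. (conv (Y j) x)\<^sup>2)"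
    by (simp add: sphere_mean_sum int)
  also have "\<dots> \<le> sphere_mean (\<lambda>x::real^'n. W_max\<^sup>2)"
  proof (rule sphere_mean_mono)
    fix x :: "real^'n" assume x: "x \<in> sphere 0 1"
    have "(\<Sum>j\<in>F. (conv (Y j) x)\<^sup>2) \<le> (norm (L2_of (W x)))\<^sup>2"
      unfolding conv_def by (rule Bessel_inequality[OF orthonormal_zonal_harmonic[OF dim] F])
    also have "\<dots> \<le> W_max\<^sup>2"
      by (intro power_mono norm_L2_of_le kernel_section x W_max norm_ge_zero)
    finally show "(\<Sum>j\<in>F. (conv (Y j) x)\<^sup>2) \<le> W_max\<^sup>2" .
  next
    show "integrable sphere_measure (\<lambda>x. \<Sum>j\<in>F. (conv (Y j) x)\<^sup>2)"
      by (intro Bochner_Integration.integrable_sum int)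
    show "integrable sphere_measure (\<lambda>x::real^'n. W_max\<^sup>2)"
      by (rule sphere_continuous_integrable) simp
  qed
  finally show ?thesis by simp
qed

text \<open>
  N components of size at least \<open>e\<close> would contribute \<open>N e\<^sup>2\<close> to the bounded sum of squares.
\<close>

lemma finite_large_components:
  assumes e: "0 < e"
  shows "finite {j. e \<le> \<bar>spherical_component TYPE('n) w j\<bar>}"
proof (rule ccontr)
  assume "infinite {j. e \<le> \<bar>spherical_component TYPE('n) w j\<bar>}"
  moreover obtain N where N: "W_max\<^sup>2 < real N * e\<^sup>2"
    using reals_Archimedean3[of "e\<^sup>2"] e by auto
  ultimately obtain F where F: "finite F" "card F = N" "F \<subseteq> {j. e \<le> \<bar>spherical_component TYPE('n) w j\<bar>}"
    using infinite_arbitrarily_large by blast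
  have "real N * e\<^sup>2 = (\<Sum>j\<in>F. e\<^sup>2)" using F by simp
  also have "\<dots> \<le> (\<Sum>j\<in>F. (spherical_component TYPE('n) w j)\<^sup>2)"
  proof (rule sum_mono)
    fix j assume "j \<in> F"
    then have "\<bar>e\<bar> \<le> \<bar>spherical_component TYPE('n) w j\<bar>" using F e by auto
    then show "e\<^sup>2 \<le> (spherical_component TYPE('n) w j)\<^sup>2" by (simp only: abs_le_square_iff)
  qed
  also have "\<dots> \<le> W_max\<^sup>2" by (rule sum_component_squares_le[OF F(1)])
  finally show False using N by simp
qed

definition gibbs_quot :: "real \<Rightarrow> real \<Rightarrow> 'n sphere_L2 \<Rightarrow> 'n sphere_L2" where
  "gibbs_quot t \<gamma> y = L2_of (\<lambda>x. exp_quotient t (- \<gamma> * \<omega> * conv y x))"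

lemma gibbs_quot_continuous: "continuous_on UNIV (\<lambda>s. exp_quotient t (- \<gamma> * \<omega> * s))"
  by (rule continuous_on_compose2[OF exp_quotient_continuous[of UNIV]]) (auto intro!: continuous_intros)

lemma gibbs_quot_sq: "square_integrable (\<lambda>x. exp_quotient t (- \<gamma> * \<omega> * conv y x))"
  by (rule superposition_sq[OF gibbs_quot_continuous])

lemma gibbs_quot_in_X: "y \<in> X \<Longrightarrow> gibbs_quot t \<gamma> y \<in> X"
  unfolding gibbs_quot_def by (rule superposition_symmetric[OF gibbs_quot_continuous])

lemma gibbs_quot_0: "gibbs_quot 0 \<gamma> y = (- \<gamma> * \<omega>) *\<^sub>R L2_of (conv y)"
  by (simp only: gibbs_quot_def exp_quotient_0 L2_of_scaleR[OF conv_sq])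

lemma gibbs_quot_at_0: "gibbs_quot t \<gamma> 0 = 0"
  using gibbs_quot_sq[of t \<gamma> 0] L2_of_scaleR[OF square_integrable_const, of 0 0]
  by (simp add: gibbs_quot_def conv_def)

text \<open>
  The pointwise inequality \<open>exp_quotient_lipschitz\<close> in the mean-square norm. For \<open>t' = 0\<close> it bounds the
  variation of the nonlinear part, and for \<open>y' = 0\<close> the dependence on \<open>t\<close>. The constant M bounds the
  exponent, since \<open>conv y\<close> is bounded by \<open>3 * W_max\<close>.
\<close>

lemma gibbs_quot_lipschitz:
  assumes t: "\<bar>t\<bar> \<le> 1" "\<bar>t'\<bar> \<le> 1" and g: "\<bar>\<gamma>\<bar> \<le> g" "\<bar>\<gamma>'\<bar> \<le> g"
    and y: "norm y \<le> 3" "norm y' \<le> 3"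
  defines "M \<equiv> g * \<omega> * W_max * 3"
  shows "norm ((gibbs_quot t \<gamma> y - gibbs_quot t' \<gamma> y) - (gibbs_quot t \<gamma>' y' - gibbs_quot t' \<gamma>' y'))
    \<le> M * exp M * \<bar>t - t'\<bar> * (\<omega> * W_max * (3 * \<bar>\<gamma> - \<gamma>'\<bar> + g * norm (y - y')))"
proof -
  have g0: "g \<ge> 0" using g by linarith
  have M0: "M \<ge> 0" unfolding M_def using g0 \<omega>_pos W_max by simp
  let ?v = "\<lambda>\<gamma> y x. - \<gamma> * \<omega> * conv y x"
  let ?e = "exp_quotient"
  have vM: "\<bar>?v \<gamma> y x\<bar> \<le> M" if "\<bar>\<gamma>\<bar> \<le> g" "norm y \<le> 3" "x \<in> sphere 0 1" for \<gamma> y x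
  proof -
    have "\<bar>conv y x\<bar> \<le> W_max * 3" by (rule order_trans[OF conv_bound[OF that(3)]]) (use W_max that in simp)
    then have "\<bar>\<gamma>\<bar> * \<omega> * \<bar>conv y x\<bar> \<le> g * \<omega> * (W_max * 3)"
      using that \<omega>_pos g0 by (intro mult_mono) auto
    then show ?thesis using \<omega>_pos by (simp add: abs_mult M_def mult.assoc)
  qed
  have vd: "\<bar>?v \<gamma> y x - ?v \<gamma>' y' x\<bar> \<le> \<omega> * W_max * (3 * \<bar>\<gamma> - \<gamma>'\<bar> + g * norm (y - y'))" if x: "x \<in> sphere 0 1" for x
  proof -
    have "?v \<gamma> y x - ?v \<gamma>' y' x = - \<omega> * ((\<gamma> - \<gamma>') * conv y x + \<gamma>' * conv (y - y') x)"
      by (simp add: conv_diff algebra_simps)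
    then have "\<bar>?v \<gamma> y x - ?v \<gamma>' y' x\<bar> = \<omega> * \<bar>(\<gamma> - \<gamma>') * conv y x + \<gamma>' * conv (y - y') x\<bar>"
      using \<omega>_pos by (simp add: abs_mult)
    also have "\<dots> \<le> \<omega> * (\<bar>\<gamma> - \<gamma>'\<bar> * (W_max * 3) + g * (W_max * norm (y - y')))"
    proof (intro mult_left_mono order_trans[OF abs_triangle_ineq] add_mono)
      show "\<bar>(\<gamma> - \<gamma>') * conv y x\<bar> \<le> \<bar>\<gamma> - \<gamma>'\<bar> * (W_max * 3)"
        unfolding abs_mult using conv_bound[OF x, of y] y(1) W_max
        by (intro mult_left_mono order_trans[OF conv_bound[OF x]]) auto
      show "\<bar>\<gamma>' * conv (y - y') x\<bar> \<le> g * (W_max * norm (y - y'))"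
        unfolding abs_mult using g g0 conv_bound[OF x, of "y - y'"] by (intro mult_mono) auto
    qed (use \<omega>_pos in simp)
    finally show ?thesis by (simp add: algebra_simps)
  qed
  let ?f = "\<lambda>x. (?e t (?v \<gamma> y x) - ?e t' (?v \<gamma> y x)) - (?e t (?v \<gamma>' y' x) - ?e t' (?v \<gamma>' y' x))"
  have "(gibbs_quot t \<gamma> y - gibbs_quot t' \<gamma> y) - (gibbs_quot t \<gamma>' y' - gibbs_quot t' \<gamma>' y') = L2_of ?f"
    unfolding gibbs_quot_def
    by (simp only: L2_of_diff[OF gibbs_quot_sq gibbs_quot_sq] L2_of_diff[OF square_integrable_diff[OF gibbs_quot_sq gibbs_quot_sq] square_integrable_diff[OF gibbs_quot_sq gibbs_quot_sq]])
  moreover have "norm (L2_of ?f) \<le> M * exp M * \<bar>t - t'\<bar> * (\<omega> * W_max * (3 * \<bar>\<gamma> - \<gamma>'\<bar> + g * norm (y - y')))"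
  proof (rule norm_L2_of_le)
    have "square_integrable ?f" by (intro square_integrable_diff gibbs_quot_sq)
    then show "?f \<in> borel_measurable sphere_measure" by (simp add: square_integrable_def)
    fix x :: "real^'n" assume x: "x \<in> sphere 0 1"
    have "\<bar>?f x\<bar> \<le> M * exp M * \<bar>t - t'\<bar> * \<bar>?v \<gamma> y x - ?v \<gamma>' y' x\<bar>"
      by (rule exp_quotient_lipschitz[OF t vM[OF g(1) y(1) x] vM[OF g(2) y(2) x]])
    also have "\<dots> \<le> M * exp M * \<bar>t - t'\<bar> * (\<omega> * W_max * (3 * \<bar>\<gamma> - \<gamma>'\<bar> + g * norm (y - y')))"
      using vd[OF x] M0 by (intro mult_left_mono) auto
    finally show "\<bar>?f x\<bar> \<le> M * exp M * \<bar>t - t'\<bar> * (\<omega> * W_max * (3 * \<bar>\<gamma> - \<gamma>'\<bar> + g * norm (y - y')))" .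
  qed
  ultimately show ?thesis by (simp only:)
qed

text \<open>
  With \<open>u = t y\<close> and \<open>h\<close> the quotient, \<open>exp (- \<gamma> W*u) = 1 + t h\<close>, with mean \<open>m = 1 + t (mean h)\<close>.
  Multiplied by \<open>t\<close>, the hypothesis reads \<open>m (1/\<omega> + u) = (1/\<omega>) (1 + t h)\<close>, which is the Gibbs equation.
  The convolution with the uniform density is constant and cancels against the normalisation.
\<close>

lemma gibbs_map_eq_0:
  assumes y: "y = (1 / \<omega>) *\<^sub>R centred (gibbs_quot t \<gamma> y) - (t * (gibbs_quot t \<gamma> y \<bullet> L2_one)) *\<^sub>R y"
  shows "gibbs_map W (t *\<^sub>R y, \<gamma>) = 0"
proof -
  define u where "u = t *\<^sub>R y"
  define f where "f x = exp (- \<gamma> * \<omega> * conv u x)" for x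
  define h where "h = gibbs_quot t \<gamma> y"
  define m where "m = 1 + t * (h \<bullet> L2_one)"
  define \<kappa> where "\<kappa> = exp (- \<gamma> * spherical_component TYPE('n) w 0)"
  have \<kappa>: "\<kappa> > 0" by (simp add: \<kappa>_def)
  have fc: "continuous_on UNIV (\<lambda>s. exp (- \<gamma> * \<omega> * s))" by (intro continuous_intros)
  have fsq: "square_integrable f" unfolding f_def by (rule superposition_sq[OF fc])
  have f: "L2_of f = L2_one + t *\<^sub>R h"
    unfolding h_def gibbs_quot_def L2_of_scaleR[OF gibbs_quot_sq] L2_of_add[OF square_integrable_const square_integrable_scale[OF gibbs_quot_sq]]
    by (rule L2_of_cong) (simp add: exp_quotient_mult f_def u_def conv_scaleR mult_ac)
  have mf: "sphere_mean f = m"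
    using inner_L2_of[OF fsq square_integrable_const[of 1]]
    using inner_harmonic[of 0 0]
    by (simp add: f inner_add_left m_def zonal_harmonic_0[OF dim])
  \<comment> \<open>The convolution is bounded, so f is bounded below by a positive constant.\<close>
  have mpos: "m > 0"
  proof -
    have "exp (- (\<bar>\<gamma>\<bar> * \<omega> * (W_max * norm u))) \<le> f x" if x: "x \<in> sphere 0 1" for x
    proof -
      have "\<gamma> * \<omega> * conv u x \<le> \<bar>\<gamma>\<bar> * \<omega> * \<bar>conv u x\<bar>"
        using \<omega>_pos abs_ge_self[of "\<gamma> * \<omega> * conv u x"] by (simp add: abs_mult)
      also have "\<dots> \<le> \<bar>\<gamma>\<bar> * \<omega> * (W_max * norm u)"
        using \<omega>_pos by (intro mult_left_mono conv_bound x) auto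
      finally show ?thesis by (simp add: f_def)
    qed
    moreover have "integrable sphere_measure f"
      using square_integrable_mult[OF fsq square_integrable_const[of 1]] by simp
    ultimately have "sphere_mean (\<lambda>x::real^'n. exp (- (\<bar>\<gamma>\<bar> * \<omega> * (W_max * norm u)))) \<le> sphere_mean f"
      by (intro sphere_mean_mono sphere_continuous_integrable[OF continuous_on_const])
    then have "exp (- (\<bar>\<gamma>\<bar> * \<omega> * (W_max * norm u))) \<le> m" by (simp add: mf)
    then show ?thesis using exp_gt_zero less_le_trans by blast
  qed
  have U: "uniform_density = (1 / \<omega>) *\<^sub>R (L2_one :: 'n sphere_L2)"
    by (simp add: uniform_density_def L2_of_scaleR[OF square_integrable_const] \<omega>_def)
  have expo: "exp (- \<gamma> * sphere_conv W (uniform_density + u) x) = \<kappa> * f x" if x: "x \<in> sphere 0 1" for x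
  proof -
    have "sphere_conv W (uniform_density + u) x = spherical_component TYPE('n) w 0 + \<omega> * conv u x"
      using \<omega>_pos by (simp add: sphere_conv_eq[OF x] U conv_add conv_scaleR conv_one[OF x] distrib_left)
    then have "- \<gamma> * sphere_conv W (uniform_density + u) x = - \<gamma> * spherical_component TYPE('n) w 0 + - \<gamma> * \<omega> * conv u x"
      by (simp add: algebra_simps)
    then show ?thesis unfolding \<kappa>_def f_def by (simp only: exp_add)
  qed
  have Z: "gibbs_Z W \<gamma> u = \<omega> * (\<kappa> * m)"
  proof -
    have "gibbs_Z W \<gamma> u = \<omega> * sphere_mean (\<lambda>x. exp (- \<gamma> * sphere_conv W (uniform_density + u) x))"
      by (simp only: gibbs_Z_def integral_eq_sphere_mean \<omega>_def)
    also have "sphere_mean (\<lambda>x. exp (- \<gamma> * sphere_conv W (uniform_density + u) x)) = sphere_mean (\<lambda>x. \<kappa> * f x)"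
      by (rule sphere_mean_cong) (rule expo)
    finally show ?thesis by (simp only: sphere_mean_cmult mf)
  qed
  have L: "L2_of (\<lambda>x. exp (- \<gamma> * sphere_conv W (uniform_density + u) x)) = \<kappa> *\<^sub>R L2_of f"
    unfolding L2_of_scaleR[OF fsq] by (rule L2_of_cong) (rule expo)
  have "y = (1 / \<omega>) *\<^sub>R centred h - (t * (h \<bullet> L2_one)) *\<^sub>R y"
    using y unfolding h_def .
  then have "m *\<^sub>R y = (1 / \<omega>) *\<^sub>R centred h"
    by (simp add: m_def scaleR_add_left) (metis diff_add_cancel)
  then have "m *\<^sub>R u = (1 / \<omega>) *\<^sub>R (t *\<^sub>R centred h)"
    unfolding u_def by (metis scaleR_left_commute)
  also have "t *\<^sub>R centred h = L2_of f - m *\<^sub>R L2_one"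
    by (simp add: f m_def centred_def algebra_simps)
  finally have mu: "m *\<^sub>R u = (1 / \<omega>) *\<^sub>R (L2_of f - m *\<^sub>R L2_one)" .
  have "m *\<^sub>R ((1 / \<omega>) *\<^sub>R L2_one + u) = (1 / \<omega>) *\<^sub>R L2_of f"
    by (simp add: scaleR_add_right mu) (simp add: scaleR_diff_right)
  then have eqU: "(1 / \<omega>) *\<^sub>R L2_one + u = (1 / m) *\<^sub>R ((1 / \<omega>) *\<^sub>R L2_of f)"
    using mpos by (metis eq_vector_fraction_iff less_irrefl inverse_eq_divide divide_inverse scaleR_one mult_1)
  have "gibbs_map W (t *\<^sub>R y, \<gamma>) = uniform_density + u - (1 / (\<omega> * (\<kappa> * m))) *\<^sub>R (\<kappa> *\<^sub>R L2_of f)"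
    unfolding gibbs_map_def prod.case u_def[symmetric] Z L ..
  also have "\<dots> = 0"
    unfolding U eqU using \<kappa> mpos \<omega>_pos by (simp add: mult.commute)
  finally show ?thesis .
qed

end

section \<open>The bifurcating branch\<close>

context rotational_kernel
begin

text \<open>
  The numbers are the eigenvalues of the operator \<open>B\<close> in \<open>branch_of_solutions\<close>. None of them
  vanishes, and all but finitely many are at distance at most \<open>1/2\<close> from 1.
\<close>

lemma spectral_gap:
  assumes neg: "spherical_component TYPE('n) w k \<noteq> 0" and k: "1 \<le> k"
    and uniq: "\<And>j. 1 \<le> j \<Longrightarrow> j \<noteq> k \<Longrightarrow> spherical_component TYPE('n) w j \<noteq> spherical_component TYPE('n) w k"
    and g: "g * spherical_component TYPE('n) w k = - 1"
  shows "\<exists>c>0. \<forall>j. c \<le> \<bar>if j = k then spherical_component TYPE('n) w k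
      else 1 + g * (if j = 0 then 0 else spherical_component TYPE('n) w j)\<bar>"
proof -
  define \<beta> where "\<beta> j = (if j = k then spherical_component TYPE('n) w k
      else 1 + g * (if j = 0 then 0 else spherical_component TYPE('n) w j))" for j
  have g0: "g \<noteq> 0" using g by auto
  \<comment> \<open>Outside F the perturbation \<open>g W\<^sub>j\<close> is smaller than 1/2. The index k has the exceptional eigenvalue and is put into F by hand.\<close>
  define F where "F = insert k {j. 1 / (2 * \<bar>g\<bar>) \<le> \<bar>spherical_component TYPE('n) w j\<bar>}"
  have F: "finite F" unfolding F_def using g0 by (intro finite.insertI finite_large_components) simp
  have nz: "\<beta> j \<noteq> 0" for j
  proof -
    have "1 + g * spherical_component TYPE('n) w j \<noteq> 0" if "j \<noteq> 0" "j \<noteq> k"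
    proof
      assume "1 + g * spherical_component TYPE('n) w j = 0"
      then have "g * spherical_component TYPE('n) w j = g * spherical_component TYPE('n) w k" using g by simp
      then show False using uniq[of j] that g0 by simp
    qed
    then show ?thesis using neg by (simp add: \<beta>_def)
  qed
  have out: "1/2 \<le> \<bar>\<beta> j\<bar>" if "j \<notin> F" for j
  proof -
    have jk: "j \<noteq> k" and "\<bar>spherical_component TYPE('n) w j\<bar> < 1 / (2 * \<bar>g\<bar>)" using that by (auto simp: F_def)
    then have "\<bar>g * spherical_component TYPE('n) w j\<bar> < 1/2"
      using g0 by (simp add: abs_mult pos_less_divide_eq mult_ac)
    then show ?thesis using jk by (auto simp: \<beta>_def)
  qed
  define c where "c = Min (insert (1/2) ((\<lambda>j. \<bar>\<beta> j\<bar>) ` F))"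
  have "0 < c" unfolding c_def using F nz by (subst Min_gr_iff) auto
  moreover have "c \<le> \<bar>\<beta> j\<bar>" for j
  proof (cases "j \<in> F")
    case True then show ?thesis unfolding c_def using F by (intro Min_le) auto
  next
    case False
    have "c \<le> 1/2" unfolding c_def using F by (intro Min_le) auto
    then show ?thesis using out[OF False] by simp
  qed
  ultimately show ?thesis unfolding \<beta>_def by blast
qed

text \<open>
  The vector \<open>\<xi> = z + \<mu> Y k\<close> encodes both unknowns: \<open>\<mu>\<close> is its coordinate along \<open>Y k\<close>, the shift of the
  parameter, and \<open>z\<close> its part orthogonal to \<open>Y k\<close>, the correction of the direction \<open>Y k + z\<close>.
\<close>

definition direction :: "nat \<Rightarrow> 'n sphere_L2 \<Rightarrow> 'n sphere_L2" where
  "direction k \<xi> = Y k + (\<xi> - (\<xi> \<bullet> Y k) *\<^sub>R Y k)"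

text \<open>
  The three terms are the nonlinear part of the exponential, the contribution of the normalising
  constant, and the quadratic term \<open>\<mu> A z\<close> that couples the shift of the parameter to the correction.
\<close>

definition remainder :: "nat \<Rightarrow> real \<Rightarrow> real \<Rightarrow> 'n sphere_L2 \<Rightarrow> 'n sphere_L2" where
  "remainder k g t \<xi> =
    (1 / \<omega>) *\<^sub>R centred (gibbs_quot t (g + \<xi> \<bullet> Y k) (direction k \<xi>) - gibbs_quot 0 (g + \<xi> \<bullet> Y k) (direction k \<xi>))
    - (t * (gibbs_quot t (g + \<xi> \<bullet> Y k) (direction k \<xi>) \<bullet> L2_one)) *\<^sub>R direction k \<xi>
    - (\<xi> \<bullet> Y k) *\<^sub>R centred_conv (\<xi> - (\<xi> \<bullet> Y k) *\<^sub>R Y k)"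

lemma direction_in_X: "\<xi> \<in> X \<Longrightarrow> direction k \<xi> \<in> X"
  unfolding direction_def
  by (intro subspace_add subspace_diff subspace_scale subspace_symmetric_L2 harmonic_in_X)

lemma direction_inner: "direction k \<xi> \<bullet> Y k = 1"
  by (simp add: direction_def inner_add_left inner_diff_left inner_harmonic)

lemma remainder_in_X: "\<xi> \<in> X \<Longrightarrow> remainder k g t \<xi> \<in> X"
  unfolding remainder_def
  by (intro subspace_diff subspace_scale subspace_symmetric_L2 harmonic_in_X centred_in_X gibbs_quot_in_X
      direction_in_X centred_conv_in_X)

lemma remainder_0: "remainder k g 0 0 = 0"
  by (simp add: remainder_def linear_0[OF bounded_linear.linear[OF bounded_linear_centred]])

lemma inner_harmonic_le: "\<bar>\<xi> \<bullet> Y k\<bar> \<le> norm \<xi>"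
  using Cauchy_Schwarz_ineq2[of \<xi> "Y k"] by simp

lemma norm_projection_le: "norm (\<xi> - (\<xi> \<bullet> Y k) *\<^sub>R Y k) \<le> 2 * norm \<xi>"
  using norm_triangle_ineq4[of \<xi> "(\<xi> \<bullet> Y k) *\<^sub>R Y k"] inner_harmonic_le[of \<xi> k] by simp

text \<open>
  The terms in \<open>Y k\<close> alone cancel because \<open>1 + g W\<^sub>k = 0\<close>, which also makes the left-hand
  operator act on \<open>Y k\<close> as multiplication by \<open>W\<^sub>k\<close> rather than by 0.
\<close>

lemma remainder_equation:
  assumes g: "g * spherical_component TYPE('n) w k = - 1" and k: "1 \<le> k"
    and eq: "\<xi> + g *\<^sub>R centred_conv \<xi> + (spherical_component TYPE('n) w k * (\<xi> \<bullet> Y k)) *\<^sub>R Y k = remainder k g t \<xi>"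
  defines "y \<equiv> direction k \<xi>" and "\<gamma> \<equiv> g + \<xi> \<bullet> Y k"
  shows "y = (1 / \<omega>) *\<^sub>R centred (gibbs_quot t \<gamma> y) - (t * (gibbs_quot t \<gamma> y \<bullet> L2_one)) *\<^sub>R y"
proof -
  interpret centred_conv: bounded_linear centred_conv by (rule bounded_linear_centred_conv)
  interpret cen: bounded_linear centred by (rule bounded_linear_centred)
  define \<mu> where "\<mu> = \<xi> \<bullet> Y k"
  define l where "l = spherical_component TYPE('n) w k"
  have gl: "g * l = - 1" using g by (simp add: l_def)
  have AY: "centred_conv (Y k) = l *\<^sub>R Y k" using k by (simp add: centred_conv_harmonic l_def)
  have Az: "centred_conv (\<xi> - \<mu> *\<^sub>R Y k) = centred_conv \<xi> - (\<mu> * l) *\<^sub>R Y k" by (simp add: centred_conv.diff centred_conv.scaleR AY)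
  have Ay: "centred_conv y = l *\<^sub>R Y k + centred_conv \<xi> - (\<mu> * l) *\<^sub>R Y k"
    by (simp add: y_def direction_def centred_conv.add centred_conv.diff centred_conv.scaleR AY \<mu>_def)
  have q0: "(1 / \<omega>) *\<^sub>R centred (gibbs_quot 0 \<gamma> y) = - \<gamma> *\<^sub>R centred_conv y"
    unfolding gibbs_quot_0 centred_conv_def cen.scaleR scaleR_scaleR using \<omega>_pos by simp
  have R: "remainder k g t \<xi> = (1 / \<omega>) *\<^sub>R centred (gibbs_quot t \<gamma> y) + \<gamma> *\<^sub>R centred_conv y
      - (t * (gibbs_quot t \<gamma> y \<bullet> L2_one)) *\<^sub>R y - \<mu> *\<^sub>R centred_conv (\<xi> - \<mu> *\<^sub>R Y k)"
    unfolding remainder_def y_def[symmetric] \<gamma>_def[symmetric] cen.diff scaleR_diff_right q0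
    by (simp add: \<mu>_def)
  have "(g * l) *\<^sub>R Y k = - Y k" "(g * (\<mu> * l)) *\<^sub>R Y k = - \<mu> *\<^sub>R Y k"
    using gl by (simp_all add: mult.left_commute)
  then have "y + \<gamma> *\<^sub>R centred_conv y = \<xi> + g *\<^sub>R centred_conv \<xi> + (l * \<mu>) *\<^sub>R Y k + \<mu> *\<^sub>R centred_conv (\<xi> - \<mu> *\<^sub>R Y k)"
    unfolding Ay Az \<gamma>_def \<mu>_def[symmetric]
    by (simp add: y_def direction_def \<mu>_def[symmetric] algebra_simps)
  also have "\<dots> = remainder k g t \<xi> + \<mu> *\<^sub>R centred_conv (\<xi> - \<mu> *\<^sub>R Y k)"
    using eq by (simp add: l_def \<mu>_def)
  also have "\<dots> = (1 / \<omega>) *\<^sub>R centred (gibbs_quot t \<gamma> y) - (t * (gibbs_quot t \<gamma> y \<bullet> L2_one)) *\<^sub>R y + \<gamma> *\<^sub>R centred_conv y"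
    unfolding R by simp
  finally show ?thesis by simp
qed

lemma direction_bounds:
  assumes "norm \<xi> \<le> 1" "0 \<le> g"
  shows "norm (direction k \<xi>) \<le> 3" "\<bar>g + \<xi> \<bullet> Y k\<bar> \<le> g + 1"
proof -
  show "norm (direction k \<xi>) \<le> 3"
    unfolding direction_def
    using norm_triangle_ineq[of "Y k" "\<xi> - (\<xi> \<bullet> Y k) *\<^sub>R Y k"] norm_projection_le[of \<xi> k] assms by simp
  show "\<bar>g + \<xi> \<bullet> Y k\<bar> \<le> g + 1"
    using inner_harmonic_le[of \<xi> k] assms by (auto simp: abs_le_iff)
qed

lemma remainder_continuous:
  assumes \<xi>: "norm \<xi> \<le> 1" and g: "0 \<le> g"
  shows "continuous_on {-1..1} (\<lambda>t. remainder k g t \<xi>)"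
proof -
  let ?y = "direction k \<xi>" and ?\<gamma> = "g + \<xi> \<bullet> Y k"
  define M where "M = (g + 1) * \<omega> * W_max * 3"
  have M0: "M \<ge> 0" using g \<omega>_pos W_max by (simp add: M_def)
  define L where "L = M * exp M * (\<omega> * W_max * ((g + 1) * norm ?y))"
  have "L-lipschitz_on {-1..1} (\<lambda>t. gibbs_quot t ?\<gamma> ?y)"
  proof (rule lipschitz_onI)
    fix t t' :: real assume "t \<in> {-1..1}" "t' \<in> {-1..1}"
    then have t: "\<bar>t\<bar> \<le> 1" "\<bar>t'\<bar> \<le> 1" by auto
    show "dist (gibbs_quot t ?\<gamma> ?y) (gibbs_quot t' ?\<gamma> ?y) \<le> L * dist t t'"
      using gibbs_quot_lipschitz[OF t direction_bounds(2)[OF \<xi> g, of k] direction_bounds(2)[OF \<xi> g, of k] direction_bounds(1)[OF \<xi> g, of k], of 0]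
      by (simp add: gibbs_quot_at_0 dist_norm L_def M_def mult_ac)
  qed (use M0 \<omega>_pos W_max g in \<open>simp add: L_def\<close>)
  then have "continuous_on {-1..1} (\<lambda>t. gibbs_quot t ?\<gamma> ?y)" by (rule lipschitz_on_continuous_on)
  then show ?thesis
    unfolding remainder_def
    by (intro continuous_intros bounded_linear.continuous_on[OF bounded_linear_centred])
qed

text \<open>
  The first two terms of the remainder carry a factor \<open>t\<close>; the third is a product of two quantities that
  are linear in \<open>\<xi>\<close>, each of them bounded by a multiple of \<open>r\<close>.
\<close>

lemma remainder_lipschitz:
  assumes g: "0 \<le> g"
  shows "\<exists>C. \<forall>t r \<xi> \<eta>. \<bar>t\<bar> \<le> 1 \<longrightarrow> r \<le> 1 \<longrightarrow> norm \<xi> \<le> r \<longrightarrow> norm \<eta> \<le> r \<longrightarrow>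
    norm (remainder k g t \<xi> - remainder k g t \<eta>) \<le> C * (\<bar>t\<bar> + r) * norm (\<xi> - \<eta>)"
proof -
  \<comment> \<open>M bounds the exponent \<open>- \<gamma> W*y\<close> pointwise, because \<open>\<bar>\<gamma>\<bar> \<le> g + 1\<close> and \<open>norm y \<le> 3\<close> on the unit ball.\<close>
  define M where "M = (g + 1) * \<omega> * W_max * 3"
  \<comment> \<open>D is a Lipschitz constant of the exponent in \<open>\<xi>\<close>: \<open>\<gamma>\<close> varies with constant 1 and \<open>y\<close> with constant 2.\<close>
  define D where "D = \<omega> * W_max * (3 + (g + 1) * 2)"
  define C1 where "C1 = M * exp M * D"
  define H where "H = M * exp M * M + M"
  \<comment> \<open>The three summands belong to the three terms of the remainder.\<close>
  define C where "C = 2 / \<omega> * C1 + ((C1 + D) * 3 + H * 2) + 8 * W_max"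
  have pos: "M \<ge> 0" "D \<ge> 0" "C1 \<ge> 0" "H \<ge> 0" using g \<omega>_pos W_max by (auto simp: M_def D_def C1_def H_def)
  have "norm (remainder k g t \<xi> - remainder k g t \<eta>) \<le> C * (\<bar>t\<bar> + r) * norm (\<xi> - \<eta>)"
    if t: "\<bar>t\<bar> \<le> 1" and r: "r \<le> 1" and \<xi>: "norm \<xi> \<le> r" and \<eta>: "norm \<eta> \<le> r" for t r \<xi> \<eta>
  proof -
    interpret cen: bounded_linear centred by (rule bounded_linear_centred)
    interpret centred_conv: bounded_linear centred_conv by (rule bounded_linear_centred_conv)
    define d where "d = norm (\<xi> - \<eta>)"
    define z where "z \<xi> = \<xi> - (\<xi> \<bullet> Y k) *\<^sub>R Y k" for \<xi>
    define y where "y \<xi> = direction k \<xi>" for \<xi>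
    define \<gamma> where "\<gamma> \<xi> = g + \<xi> \<bullet> Y k" for \<xi>
    define q where "q s \<xi> = gibbs_quot s (\<gamma> \<xi>) (y \<xi>)" for s \<xi>
    have r0: "0 \<le> r" using \<xi> norm_ge_zero[of \<xi>] by linarith
    have d0: "0 \<le> d" by (simp add: d_def)
    have \<xi>1: "norm \<xi> \<le> 1" and \<eta>1: "norm \<eta> \<le> 1" using \<xi> \<eta> r by auto
    have zd: "norm (z \<xi> - z \<eta>) \<le> 2 * d"
    proof -
      have "z \<xi> - z \<eta> = (\<xi> - \<eta>) - ((\<xi> - \<eta>) \<bullet> Y k) *\<^sub>R Y k"
        by (simp add: z_def inner_diff_left algebra_simps)
      then show ?thesis using norm_projection_le[of "\<xi> - \<eta>" k] by (simp add: d_def)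
    qed
    have yd: "norm (y \<xi> - y \<eta>) \<le> 2 * d" using zd by (simp add: y_def direction_def z_def)
    have \<mu>d: "\<bar>\<xi> \<bullet> Y k - \<eta> \<bullet> Y k\<bar> \<le> d"
      using inner_harmonic_le[of "\<xi> - \<eta>" k] by (simp add: d_def inner_diff_left)
    then have \<gamma>d: "\<bar>\<gamma> \<xi> - \<gamma> \<eta>\<bar> \<le> d" by (simp add: \<gamma>_def)
    have y3: "norm (y \<xi>) \<le> 3" "norm (y \<eta>) \<le> 3"
      using direction_bounds(1)[OF \<xi>1 g] direction_bounds(1)[OF \<eta>1 g] by (auto simp: y_def)
    have \<gamma>g: "\<bar>\<gamma> \<xi>\<bar> \<le> g + 1" "\<bar>\<gamma> \<eta>\<bar> \<le> g + 1"
      using direction_bounds(2)[OF \<xi>1 g] direction_bounds(2)[OF \<eta>1 g] by (auto simp: \<gamma>_def)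
    have Dd: "\<omega> * W_max * (3 * \<bar>\<gamma> \<xi> - \<gamma> \<eta>\<bar> + (g + 1) * norm (y \<xi> - y \<eta>)) \<le> D * d"
    proof -
      have "3 * \<bar>\<gamma> \<xi> - \<gamma> \<eta>\<bar> + (g + 1) * norm (y \<xi> - y \<eta>) \<le> 3 * d + (g + 1) * (2 * d)"
        using \<gamma>d yd g by (intro add_mono mult_left_mono) auto
      also have "\<dots> = (3 + (g + 1) * 2) * d" by (simp add: algebra_simps)
      finally have "\<omega> * W_max * (3 * \<bar>\<gamma> \<xi> - \<gamma> \<eta>\<bar> + (g + 1) * norm (y \<xi> - y \<eta>)) \<le> \<omega> * W_max * ((3 + (g + 1) * 2) * d)"
        using \<omega>_pos W_max by (intro mult_left_mono) auto
      then show ?thesis by (simp add: D_def mult.assoc)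
    qed
    have q1: "norm ((q t \<xi> - q 0 \<xi>) - (q t \<eta> - q 0 \<eta>)) \<le> C1 * \<bar>t\<bar> * d"
    proof -
      have "norm ((q t \<xi> - q 0 \<xi>) - (q t \<eta> - q 0 \<eta>))
        \<le> M * exp M * \<bar>t - 0\<bar> * (\<omega> * W_max * (3 * \<bar>\<gamma> \<xi> - \<gamma> \<eta>\<bar> + (g + 1) * norm (y \<xi> - y \<eta>)))"
        unfolding q_def M_def by (rule gibbs_quot_lipschitz[OF t _ \<gamma>g y3]) simp
      also have "\<dots> \<le> M * exp M * \<bar>t - 0\<bar> * (D * d)"
        using Dd pos(1) by (intro mult_left_mono) simp_all
      finally show ?thesis by (simp add: C1_def mult_ac)
    qed
    have q0_lin: "norm (q 0 \<xi> - q 0 \<eta>) \<le> D * d"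
    proof -
      have K: "norm (L2_of (conv u)) \<le> W_max * norm u" for u by (rule norm_L2_of_le[OF conv_measurable conv_bound])
      have "q 0 \<xi> - q 0 \<eta> = (- \<omega>) *\<^sub>R (\<gamma> \<xi> *\<^sub>R L2_of (conv (y \<xi>)) - \<gamma> \<eta> *\<^sub>R L2_of (conv (y \<eta>)))"
        by (simp add: q_def gibbs_quot_0 algebra_simps)
      then have "norm (q 0 \<xi> - q 0 \<eta>) = \<omega> * norm (\<gamma> \<xi> *\<^sub>R L2_of (conv (y \<xi>)) - \<gamma> \<eta> *\<^sub>R L2_of (conv (y \<eta>)))"
        using \<omega>_pos by simp
      also have "\<dots> \<le> \<omega> * (\<bar>\<gamma> \<xi> - \<gamma> \<eta>\<bar> * (W_max * 3) + (g + 1) * (W_max * norm (y \<xi> - y \<eta>)))"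
      proof (intro mult_left_mono order_trans[OF norm_scaleR_diff_le] add_mono mult_mono)
        show "norm (L2_of (conv (y \<xi>))) \<le> W_max * 3" using order_trans[OF K mult_left_mono[OF y3(1)]] W_max by simp
        show "norm (L2_of (conv (y \<xi>)) - L2_of (conv (y \<eta>))) \<le> W_max * norm (y \<xi> - y \<eta>)"
          unfolding linear_diff[OF bounded_linear.linear[OF bounded_linear_L2_of_conv], symmetric] by (rule K)
      qed (use \<gamma>g g \<omega>_pos in auto)
      also have "\<dots> = \<omega> * W_max * (3 * \<bar>\<gamma> \<xi> - \<gamma> \<eta>\<bar> + (g + 1) * norm (y \<xi> - y \<eta>))" by (simp add: algebra_simps)
      also note Dd
      finally show ?thesis .
    qed
    have qd: "norm (q t \<xi> - q t \<eta>) \<le> (C1 + D) * d"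
    proof -
      have "C1 * \<bar>t\<bar> * d \<le> C1 * 1 * d" using t pos d0 by (intro mult_right_mono mult_left_mono) auto
      moreover have "norm (q t \<xi> - q t \<eta>) \<le> norm ((q t \<xi> - q 0 \<xi>) - (q t \<eta> - q 0 \<eta>)) + norm (q 0 \<xi> - q 0 \<eta>)"
      proof -
        have "q t \<xi> - q t \<eta> = ((q t \<xi> - q 0 \<xi>) - (q t \<eta> - q 0 \<eta>)) + (q 0 \<xi> - q 0 \<eta>)" by simp
        then show ?thesis by (simp only: norm_triangle_ineq)
      qed
      ultimately have "norm (q t \<xi> - q t \<eta>) \<le> C1 * d + D * d" using q1 q0_lin by linarith
      then show ?thesis by (simp add: distrib_right)
    qed
    have qH: "norm (q t \<eta>) \<le> H"
    proof -
      have "(g + 1) * norm (y \<eta>) \<le> (g + 1) * 3" using y3 g by (intro mult_left_mono) auto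
      then have yM: "\<omega> * W_max * ((g + 1) * norm (y \<eta>)) \<le> M"
        using \<omega>_pos W_max by (simp add: M_def mult_ac)
      have "norm (q t \<eta> - q 0 \<eta>) \<le> M * exp M * \<bar>t - 0\<bar> * (\<omega> * W_max * ((g + 1) * norm (y \<eta>)))"
        using gibbs_quot_lipschitz[OF t _ \<gamma>g(2) \<gamma>g(2) y3(2), of 0 0] by (simp add: q_def M_def gibbs_quot_at_0)
      also have "\<dots> \<le> M * exp M * 1 * M"
        using yM t pos \<omega>_pos W_max g by (intro mult_mono) auto
      finally have 1: "norm (q t \<eta> - q 0 \<eta>) \<le> M * exp M * M" by simp
      have "norm (q 0 \<eta>) = \<bar>\<gamma> \<eta>\<bar> * \<omega> * norm (L2_of (conv (y \<eta>)))"
        using \<omega>_pos by (simp add: q_def gibbs_quot_0 abs_mult)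
      also have "\<dots> \<le> (g + 1) * \<omega> * (W_max * norm (y \<eta>))"
        using \<gamma>g \<omega>_pos g by (intro mult_mono norm_L2_of_le[OF conv_measurable conv_bound]) auto
      also have "\<dots> = \<omega> * W_max * ((g + 1) * norm (y \<eta>))" by (simp add: mult_ac)
      also note yM
      finally have 2: "norm (q 0 \<eta>) \<le> M" .
      have "norm (q t \<eta>) \<le> norm (q t \<eta> - q 0 \<eta>) + norm (q 0 \<eta>)"
        using norm_triangle_ineq[of "q t \<eta> - q 0 \<eta>" "q 0 \<eta>"] by simp
      then show ?thesis using 1 2 by (simp add: H_def)
    qed
    define P1 where "P1 \<xi> = (1 / \<omega>) *\<^sub>R centred (q t \<xi> - q 0 \<xi>)" for \<xi>
    define P2 where "P2 \<xi> = (t * (q t \<xi> \<bullet> L2_one)) *\<^sub>R y \<xi>" for \<xi>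
    define P3 where "P3 \<xi> = (\<xi> \<bullet> Y k) *\<^sub>R centred_conv (z \<xi>)" for \<xi>
    have rem: "remainder k g t \<xi> = P1 \<xi> - P2 \<xi> - P3 \<xi>" for \<xi>
      by (simp add: remainder_def P1_def P2_def P3_def q_def y_def \<gamma>_def z_def)
    have b1: "norm (P1 \<xi> - P1 \<eta>) \<le> 2 / \<omega> * C1 * \<bar>t\<bar> * d"
    proof -
      have "P1 \<xi> - P1 \<eta> = (1 / \<omega>) *\<^sub>R centred ((q t \<xi> - q 0 \<xi>) - (q t \<eta> - q 0 \<eta>))"
        by (simp only: P1_def cen.diff scaleR_diff_right)
      then have "norm (P1 \<xi> - P1 \<eta>) \<le> 1 / \<omega> * (2 * norm ((q t \<xi> - q 0 \<xi>) - (q t \<eta> - q 0 \<eta>)))"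
        using norm_centred_le[of "(q t \<xi> - q 0 \<xi>) - (q t \<eta> - q 0 \<eta>)"] \<omega>_pos
        by (simp add: divide_right_mono)
      also have "\<dots> \<le> 1 / \<omega> * (2 * (C1 * \<bar>t\<bar> * d))"
        using q1 \<omega>_pos by (intro mult_left_mono) auto
      finally show ?thesis by (simp add: mult_ac)
    qed
    have b2: "norm (P2 \<xi> - P2 \<eta>) \<le> ((C1 + D) * 3 + H * 2) * \<bar>t\<bar> * d"
    proof -
      have "norm (P2 \<xi> - P2 \<eta>) \<le> \<bar>t * (q t \<xi> \<bullet> L2_one) - t * (q t \<eta> \<bullet> L2_one)\<bar> * norm (y \<xi>)
          + \<bar>t * (q t \<eta> \<bullet> L2_one)\<bar> * norm (y \<xi> - y \<eta>)"
        unfolding P2_def by (rule norm_scaleR_diff_le)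
      also have "\<dots> = \<bar>t\<bar> * (\<bar>(q t \<xi> - q t \<eta>) \<bullet> L2_one\<bar> * norm (y \<xi>) + \<bar>q t \<eta> \<bullet> L2_one\<bar> * norm (y \<xi> - y \<eta>))"
      proof -
        have "t * (q t \<xi> \<bullet> L2_one) - t * (q t \<eta> \<bullet> L2_one) = t * ((q t \<xi> - q t \<eta>) \<bullet> L2_one)"
          by (simp add: inner_diff_left right_diff_distrib)
        then show ?thesis by (simp only: abs_mult distrib_left mult.assoc)
      qed
      also have "\<dots> \<le> \<bar>t\<bar> * (((C1 + D) * d) * 3 + H * (2 * d))"
        using pos d0 y3 yd
        by (intro mult_left_mono add_mono mult_mono order_trans[OF inner_one_le qd] order_trans[OF inner_one_le qH]) auto
      finally show ?thesis by (simp add: algebra_simps)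
    qed
    have b3: "norm (P3 \<xi> - P3 \<eta>) \<le> 8 * W_max * r * d"
    proof -
      have "norm (P3 \<xi> - P3 \<eta>) \<le> \<bar>\<xi> \<bullet> Y k - \<eta> \<bullet> Y k\<bar> * norm (centred_conv (z \<xi>)) + \<bar>\<eta> \<bullet> Y k\<bar> * norm (centred_conv (z \<xi>) - centred_conv (z \<eta>))"
        unfolding P3_def by (rule norm_scaleR_diff_le)
      also have "\<dots> \<le> d * (2 * W_max * (2 * r)) + r * (2 * W_max * (2 * d))"
      proof (intro add_mono mult_mono \<mu>d)
        have "norm (z \<xi>) \<le> 2 * r" using norm_projection_le[of \<xi> k] \<xi> by (simp add: z_def)
        then show "norm (centred_conv (z \<xi>)) \<le> 2 * W_max * (2 * r)"
          using W_max by (intro order_trans[OF norm_centred_conv_le] mult_left_mono) auto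
        show "norm (centred_conv (z \<xi>) - centred_conv (z \<eta>)) \<le> 2 * W_max * (2 * d)"
          unfolding centred_conv.diff[symmetric] using W_max zd by (intro order_trans[OF norm_centred_conv_le] mult_left_mono) auto
        show "\<bar>\<eta> \<bullet> Y k\<bar> \<le> r" using inner_harmonic_le[of \<eta> k] \<eta> by simp
      qed (use d0 r0 in auto)
      finally show ?thesis by (simp add: mult_ac)
    qed
    have "remainder k g t \<xi> - remainder k g t \<eta> = (P1 \<xi> - P1 \<eta>) - (P2 \<xi> - P2 \<eta>) - (P3 \<xi> - P3 \<eta>)"
      by (simp add: rem)
    then have "norm (remainder k g t \<xi> - remainder k g t \<eta>)
        \<le> norm (P1 \<xi> - P1 \<eta>) + norm (P2 \<xi> - P2 \<eta>) + norm (P3 \<xi> - P3 \<eta>)"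
      using norm_triangle_ineq4[of "(P1 \<xi> - P1 \<eta>) - (P2 \<xi> - P2 \<eta>)" "P3 \<xi> - P3 \<eta>"]
        norm_triangle_ineq4[of "P1 \<xi> - P1 \<eta>" "P2 \<xi> - P2 \<eta>"] by simp
    also have "\<dots> \<le> 2 / \<omega> * C1 * \<bar>t\<bar> * d + ((C1 + D) * 3 + H * 2) * \<bar>t\<bar> * d + 8 * W_max * r * d"
      by (intro add_mono b1 b2 b3)
    also have "\<dots> \<le> 2 / \<omega> * C1 * (\<bar>t\<bar> + r) * d + ((C1 + D) * 3 + H * 2) * (\<bar>t\<bar> + r) * d + 8 * W_max * (\<bar>t\<bar> + r) * d"
      using pos \<omega>_pos W_max r0 d0 by (intro add_mono mult_right_mono mult_left_mono) auto
    also have "\<dots> = C * (\<bar>t\<bar> + r) * d" by (simp only: C_def distrib_right)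
    finally show ?thesis unfolding d_def .
  qed
  then show ?thesis by blast
qed

text \<open>
  The operator \<open>B\<close> equals \<open>I + g A\<close> except that it multiplies \<open>Y k\<close>, which \<open>I + g A\<close> would annihilate, by the
  component. It is diagonal with eigenvalues bounded away from 0, hence invertible on \<open>X\<close>, and
  the Gibbs equation has been brought into the form \<open>B \<xi> = remainder k g t \<xi>\<close>. Keeping \<open>\<xi>\<close> in the ball of
  radius \<open>g / 2\<close> keeps the parameter positive.
\<close>

theorem branch_of_solutions:
  assumes k: "1 \<le> k" and g: "0 < g" "g * spherical_component TYPE('n) w k = - 1"
    and uniq: "\<And>j. 1 \<le> j \<Longrightarrow> j \<noteq> k \<Longrightarrow> spherical_component TYPE('n) w j \<noteq> spherical_component TYPE('n) w k"
  shows "\<exists>\<delta>>0. \<exists>\<xi>. continuous_on {-\<delta><..<\<delta>} \<xi> \<and> \<xi> 0 = 0 \<and>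
    (\<forall>t\<in>{-\<delta><..<\<delta>}. \<xi> t \<in> X \<and> 0 < g + \<xi> t \<bullet> Y k \<and>
      gibbs_map W (t *\<^sub>R direction k (\<xi> t), g + \<xi> t \<bullet> Y k) = 0)"
proof -
  define l where "l = spherical_component TYPE('n) w k"
  define B where "B \<xi> = \<xi> + g *\<^sub>R centred_conv \<xi> + (l * (\<xi> \<bullet> Y k)) *\<^sub>R Y k" for \<xi>
  have l0: "l \<noteq> 0" using g by (auto simp: l_def)
  have B: "bounded_linear B"
    unfolding B_def
    by (intro bounded_linear_add bounded_linear_ident bounded_linear_compose[OF bounded_linear_scaleR_right bounded_linear_centred_conv]
        bounded_linear_compose[OF bounded_linear_scaleR_left] bounded_linear_compose[OF bounded_linear_mult_right] bounded_linear_inner_left)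
  from spectral_gap[OF l0[unfolded l_def] k uniq g(2), folded l_def]
  obtain c where c: "0 < c" "\<And>j. c \<le> \<bar>if j = k then l
      else 1 + g * (if j = 0 then 0 else spherical_component TYPE('n) w j)\<bar>"
    by blast
  have BY: "B (Y j) = (if j = k then l else 1 + g * (if j = 0 then 0 else spherical_component TYPE('n) w j)) *\<^sub>R Y j" for j
  proof (cases "j = k")
    case True
    have "B (Y k) = (1 + g * l + l) *\<^sub>R Y k"
      using k by (simp add: B_def centred_conv_harmonic inner_harmonic l_def scaleR_add_left)
    then show ?thesis using True g(2) by (simp add: l_def)
  next
    case False
    then show ?thesis by (simp add: B_def centred_conv_harmonic inner_harmonic scaleR_add_left)
  qed
  note diag = diagonal_operator_lower[OF orthonormal_zonal_harmonic[OF dim] B BY c, folded symmetric_L2_def]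
    diagonal_operator_surj[OF orthonormal_zonal_harmonic[OF dim] B BY c, folded symmetric_L2_def, OF complete_symmetric_L2]
  obtain C where C: "\<And>t r \<xi> \<eta>. \<bar>t\<bar> \<le> 1 \<Longrightarrow> r \<le> 1 \<Longrightarrow> norm \<xi> \<le> r \<Longrightarrow> norm \<eta> \<le> r \<Longrightarrow>
    norm (remainder k g t \<xi> - remainder k g t \<eta>) \<le> C * (\<bar>t\<bar> + r) * norm (\<xi> - \<eta>)"
    using remainder_lipschitz[OF less_imp_le[OF g(1)], of k] by blast
  have g2: "0 < g / 2" using g by simp
  have "\<exists>\<delta>>0. \<exists>\<xi>. continuous_on {-\<delta><..<\<delta>} \<xi> \<and> \<xi> 0 = 0 \<and>
    (\<forall>t\<in>{-\<delta><..<\<delta>}. \<xi> t \<in> X \<and> norm (\<xi> t) \<le> g / 2 \<and> B (\<xi> t) = remainder k g t (\<xi> t))"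
  proof (rule small_nonlinear_perturbation[OF complete_symmetric_L2[of p] subspace_symmetric_L2 B])
    show "\<exists>y\<in>X. B y = x" if "x \<in> X" for x using diag(2)[OF that] .
    show "0 < c" by (rule c(1))
    show "c * norm y \<le> norm (B y)" if "y \<in> X" for y using diag(1)[OF that] .
    show "remainder k g t \<xi> \<in> X" if "\<xi> \<in> X" for t \<xi> by (rule remainder_in_X[OF that])
    show "norm (remainder k g t \<xi> - remainder k g t \<eta>) \<le> C * (\<bar>t\<bar> + r) * norm (\<xi> - \<eta>)"
      if "\<bar>t\<bar> \<le> 1" "r \<le> 1" "\<xi> \<in> X" "\<eta> \<in> X" "norm \<xi> \<le> r" "norm \<eta> \<le> r" for t r \<xi> \<eta>
      using that by (intro C)
    show "continuous_on {-1..1} (\<lambda>t. remainder k g t \<xi>)" if "\<xi> \<in> X" "norm \<xi> \<le> 1" for \<xi>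
      using that g by (intro remainder_continuous) auto
    show "remainder k g 0 0 = 0" by (rule remainder_0)
    show "0 < g / 2" by (rule g2)
  qed
  then obtain \<delta> \<xi> where *: "0 < \<delta>" "continuous_on {-\<delta><..<\<delta>} \<xi>" "\<xi> 0 = 0"
    "\<And>t. t \<in> {-\<delta><..<\<delta>} \<Longrightarrow> \<xi> t \<in> X \<and> norm (\<xi> t) \<le> g / 2 \<and> B (\<xi> t) = remainder k g t (\<xi> t)"
    by blast
  have "\<xi> t \<in> X \<and> 0 < g + \<xi> t \<bullet> Y k \<and> gibbs_map W (t *\<^sub>R direction k (\<xi> t), g + \<xi> t \<bullet> Y k) = 0"
    if "t \<in> {-\<delta><..<\<delta>}" for t
  proof -
    note t = *(4)[OF that]
    have "\<bar>\<xi> t \<bullet> Y k\<bar> \<le> g / 2" using inner_harmonic_le[of "\<xi> t" k] t by simp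
    then have "0 < g + \<xi> t \<bullet> Y k" using g by (auto simp: abs_le_iff)
    moreover have "\<xi> t + g *\<^sub>R centred_conv (\<xi> t) + (spherical_component TYPE('n) w k * (\<xi> t \<bullet> Y k)) *\<^sub>R Y k = remainder k g t (\<xi> t)"
      using t by (simp only: B_def l_def)
    then have "gibbs_map W (t *\<^sub>R direction k (\<xi> t), g + \<xi> t \<bullet> Y k) = 0"
      by (intro gibbs_map_eq_0 remainder_equation[OF g(2) k])
    ultimately show ?thesis using t by blast
  qed
  then show ?thesis using * by blast
qed

end

theorem theorem4p9:
  fixes W :: "real^'n::finite \<Rightarrow> real^'n \<Rightarrow> real" and w :: "real \<Rightarrow> real"
    and p :: 'n and k :: nat and \<gamma>\<^sub>k :: real
  assumes dim: "3 \<le> CARD('n)"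
    and cont: "continuous_on (sphere 0 1 \<times> sphere 0 1) (\<lambda>(x, y). W x y)"
    and bdd: "bounded ((\<lambda>(x, y). W x y) ` (sphere 0 1 \<times> sphere 0 1))"
    and rot: "rotationally_symmetric W w"
    and k: "1 \<le> k"
    and neg: "spherical_component TYPE('n) w k < 0"
    and uniq: "\<And>j. 1 \<le> j \<Longrightarrow> j \<noteq> k \<Longrightarrow>
                 spherical_component TYPE('n) w j \<noteq> spherical_component TYPE('n) w k"
    and gamma: "\<gamma>\<^sub>k = - 1 / spherical_component TYPE('n) w k"
  shows "bifurcation_point W (0, \<gamma>\<^sub>k) \<and>
    (\<exists>\<delta>>0. \<exists>S z \<mu>.
       bifurcation_curve W (0, \<gamma>\<^sub>k) \<delta> S \<and>
       continuous_on {-\<delta><..<\<delta>} z \<and> continuous_on {-\<delta><..<\<delta>} \<mu> \<and> z 0 = 0 \<and> \<mu> 0 = 0 \<and>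
       (\<forall>t\<in>{-\<delta><..<\<delta>}.
          S t = (t *\<^sub>R zonal_harmonic p k + t *\<^sub>R z t, \<gamma>\<^sub>k + \<mu> t) \<and>
          fst (S t) \<in> symmetric_L2 p))"
proof -
  interpret rotational_kernel W w p by unfold_locales (fact dim cont rot)+
  have g: "0 < \<gamma>\<^sub>k" "\<gamma>\<^sub>k * spherical_component TYPE('n) w k = - 1"
    using neg by (auto simp: gamma field_simps)
  from branch_of_solutions[OF k g uniq] obtain \<delta> \<xi> where \<delta>: "0 < \<delta>"
    and \<xi>: "continuous_on {-\<delta><..<\<delta>} \<xi>" "\<xi> 0 = 0"
      "\<And>t. t \<in> {-\<delta><..<\<delta>} \<Longrightarrow> \<xi> t \<in> X \<and> 0 < \<gamma>\<^sub>k + \<xi> t \<bullet> Y k \<and>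
        gibbs_map W (t *\<^sub>R direction k (\<xi> t), \<gamma>\<^sub>k + \<xi> t \<bullet> Y k) = 0"
    by blast
  define \<mu> where "\<mu> t = \<xi> t \<bullet> Y k" for t
  define z where "z t = \<xi> t - \<mu> t *\<^sub>R Y k" for t
  define S where "S t = (t *\<^sub>R Y k + t *\<^sub>R z t, \<gamma>\<^sub>k + \<mu> t)" for t
  have S: "S t = (t *\<^sub>R direction k (\<xi> t), \<gamma>\<^sub>k + \<xi> t \<bullet> Y k)" for t
    by (simp add: S_def z_def \<mu>_def direction_def scaleR_add_right)
  have \<mu>c: "continuous_on {-\<delta><..<\<delta>} \<mu>" unfolding \<mu>_def by (intro continuous_intros \<xi>)
  have zc: "continuous_on {-\<delta><..<\<delta>} z" unfolding z_def by (intro continuous_intros \<xi> \<mu>c)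
  have Sc: "continuous_on {-\<delta><..<\<delta>} S" unfolding S_def by (intro continuous_intros zc \<mu>c)
  have S0: "S 0 = (0, \<gamma>\<^sub>k)" by (simp add: S \<xi>(2))
  have curve: "bifurcation_curve W (0, \<gamma>\<^sub>k) \<delta> S"
    unfolding bifurcation_curve_def using Sc S0 \<xi>(3) by (auto simp: S)
  have point: "bifurcation_point W (0, \<gamma>\<^sub>k)"
    unfolding bifurcation_point_def closure_approachable
  proof (intro allI impI)
    fix e :: real assume e: "0 < e"
    have "0 \<in> {-\<delta><..<\<delta>}" using \<delta> by simp
    from Sc[unfolded continuous_on_iff, rule_format, OF this e]
    obtain d where d0: "d > 0" and d: "\<forall>t\<in>{-\<delta><..<\<delta>}. dist t 0 < d \<longrightarrow> dist (S t) (S 0) < e"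
      by (elim exE conjE) (rule that)
    define t where "t = min d \<delta> / 2"
    have t: "0 < t" "t < d" "t < \<delta>" using d0 \<delta> by (auto simp: t_def)
    then have tin: "t \<in> {-\<delta><..<\<delta>}" by simp
    \<comment> \<open>The component along \<open>Y k\<close> is 1, so the branch leaves the trivial solution for every nonzero t.\<close>
    have "direction k (\<xi> t) \<noteq> 0"
    proof
      assume "direction k (\<xi> t) = 0"
      then show False using direction_inner[of k "\<xi> t"] by simp
    qed
    then have nz: "t *\<^sub>R direction k (\<xi> t) \<noteq> 0" using t(1) by (simp only: scaleR_eq_0_iff) simp
    have "S t \<in> {(u, \<gamma>). 0 < \<gamma> \<and> gibbs_map W (u, \<gamma>) = 0 \<and> u \<noteq> 0}"
      unfolding S mem_Collect_eq prod.case using \<xi>(3)[OF tin] nz by blast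
    moreover have "dist t 0 < d" using t by (simp add: dist_real_def)
    then have "dist (S t) (0, \<gamma>\<^sub>k) < e" using d tin unfolding S0 by blast
    ultimately show "\<exists>y\<in>{(u, \<gamma>). 0 < \<gamma> \<and> gibbs_map W (u, \<gamma>) = 0 \<and> u \<noteq> 0}. dist y (0, \<gamma>\<^sub>k) < e"
      by (rule bexI[rotated])
  qed
  have sym: "fst (S t) \<in> X" if "t \<in> {-\<delta><..<\<delta>}" for t
    unfolding S fst_conv using \<xi>(3)[OF that]
    by (intro subspace_scale[OF subspace_symmetric_L2] direction_in_X) simp
  have z0: "z 0 = 0" "\<mu> 0 = 0" by (simp_all add: z_def \<mu>_def \<xi>(2))
  have form: "\<forall>t\<in>{-\<delta><..<\<delta>}. S t = (t *\<^sub>R Y k + t *\<^sub>R z t, \<gamma>\<^sub>k + \<mu> t) \<and> fst (S t) \<in> X"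
    using sym by (simp add: S_def)
  show ?thesis
    by (rule conjI[OF point], rule exI[of _ \<delta>], rule conjI[OF \<delta>], rule exI[of _ S], rule exI[of _ z],
        rule exI[of _ \<mu>]) (intro conjI curve zc \<mu>c z0 form)
qed

end
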